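(* Let $\alpha$ be an irrational number with sequence of convergent denominators $(q_n)$, and let $g:\mathbb{T}\to\mathbb{R}$ be a function such that: (i) $g$ is continuous; (ii) $\sup_{x\in\mathbb{T}}|S_{q_n}(g)(x)|=o\big(q_{n+1}^{-4/5}\big)$ as $n\to\infty$; (iii) for every $r\in\mathbb{R}\setminus\{0\}$ and every $\beta\in\mathbb{R}$ there is no measurable function $\psi:\mathbb{T}\to\mathbb{R}$ such that $r g(x)\equiv\psi(x+\alpha)-\psi(x)+\beta \pmod 1$ for almost every $x\in\mathbb{T}$. Let $T_{\alpha,g}:\mathbb{T}^2\to\mathbb{T}^2$ be the map $T_{\alpha,g}(x,y)=(x+\alpha,\,y+g(x))$ (with $g$ taken modulo $1$). Then for every $z\in\mathbb{T}^2$ the square orbit $(T_{\alpha,g}^{n^2}z)_{n\in\mathbb{N}}$ is equidistributed in $\mathbb{T}^2$, i.e. for every $f\in C(\mathbb{T}^2)$, $$\lim_{N\to\infty}\frac1N\sum_{0\le n<N}f(T_{\alpha,g}^{n^2}z)=\int_{\mathbb{T}^2}f\,d\lambda,$$ where $\lambda$ is the normalized Lebesgue measure.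
   Context: $\mathbb{T}=\mathbb{R}/\mathbb{Z}$. $(q_n)$ is the sequence of denominators of the continued fraction convergents of $\alpha$. For a positive integer $n$, $S_n(g)(x)=\sum_{i=0}^{n-1}g(x+i\alpha)$. *)

theory Defs
  imports "HOL-Analysis.Analysis" "HOL-Library.Landau_Symbols"
begin

quotient_type circle = real / "\<lambda>x y::real. x - y \<in> \<int>"
  morphisms rep_circle circle_of
proof (intro equivpI reflpI sympI transpI)
  fix x y z :: real
  show "x - x \<in> \<int>" by simp
  show "y - x \<in> \<int>" if "x - y \<in> \<int>"
    using Ints_minus[OF that] by simp
  show "x - z \<in> \<int>" if "x - y \<in> \<int>" "y - z \<in> \<int>"
    using Ints_add[OF that] by simp
qed

instantiation circle :: ab_group_add
begin

lift_definition zero_circle :: circle is "0 :: real" .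

lift_definition plus_circle :: "circle \<Rightarrow> circle \<Rightarrow> circle" is "(+) :: real \<Rightarrow> real \<Rightarrow> real"
proof -
  fix a b c d :: real
  assume "a - b \<in> \<int>" "c - d \<in> \<int>"
  from Ints_add[OF this] show "(a + c) - (b + d) \<in> \<int>"
    by (simp add: algebra_simps)
qed

lift_definition uminus_circle :: "circle \<Rightarrow> circle" is "uminus :: real \<Rightarrow> real"
proof -
  fix a b :: real
  assume "a - b \<in> \<int>"
  from Ints_minus[OF this] show "- a - - b \<in> \<int>"
    by simp
qed

lift_definition minus_circle :: "circle \<Rightarrow> circle \<Rightarrow> circle" is "(-) :: real \<Rightarrow> real \<Rightarrow> real"
proof -
  fix a b c d :: real
  assume "a - b \<in> \<int>" "c - d \<in> \<int>"
  from Ints_diff[OF this] show "(a - c) - (b - d) \<in> \<int>"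
    by (simp add: algebra_simps)
qed

instance
  by standard (transfer, simp)+

end

instantiation circle :: topological_space
begin

definition open_circle :: "circle set \<Rightarrow> bool"
  where "open_circle U \<longleftrightarrow> open (circle_of -` U)"

instance
proof
  show "open (UNIV :: circle set)"
    by (simp add: open_circle_def)
  show "open (S \<inter> T)" if "open S" "open T" for S T :: "circle set"
    using that by (simp add: open_circle_def open_Int)
  show "open (\<Union>K)" if "\<forall>S\<in>K. open S" for K :: "circle set set"
    using that by (auto simp: open_circle_def vimage_Union)
qed

end

definition circle_lebesgue :: "circle measure"
  where "circle_lebesgue = distr (restrict_space lborel {0..<1}) borel circle_of"

lemma continuous_on_circle_of: "continuous_on A circle_of"
  by (rule continuous_on_subset[of UNIV])
     (auto simp: continuous_on_open_vimage open_circle_def)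

lemma emeasure_space_circle_lebesgue: "emeasure circle_lebesgue (space circle_lebesgue) = 1"
proof -
  have "circle_of \<in> restrict_space lborel {0..<1} \<rightarrow>\<^sub>M borel"
    by (intro measurable_restrict_space1)
       (simp add: borel_measurable_continuous_onI continuous_on_circle_of)
  then show ?thesis
    by (simp add: circle_lebesgue_def emeasure_distr space_restrict_space
        emeasure_restrict_space)
qed

text \<open>Continued fraction expansion: the complete quotients are given by
  \<open>\<alpha>\<^sub>0 = \<alpha>\<close> and \<open>\<alpha>\<^sub>n\<^sub>+\<^sub>1 = 1 / (\<alpha>\<^sub>n - \<lfloor>\<alpha>\<^sub>n\<rfloor>)\<close>; they are all defined (no division
  by zero) when \<open>\<alpha>\<close> is irrational.\<close>

primrec cf_complete_quotient :: "real \<Rightarrow> nat \<Rightarrow> real" where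
  "cf_complete_quotient \<alpha> 0 = \<alpha>"
| "cf_complete_quotient \<alpha> (Suc n) = 1 / frac (cf_complete_quotient \<alpha> n)"

definition cf_partial_quotient :: "real \<Rightarrow> nat \<Rightarrow> int"
  where "cf_partial_quotient \<alpha> n = \<lfloor>cf_complete_quotient \<alpha> n\<rfloor>"

text \<open>Truncation by \<^const>\<open>nat\<close> is harmless: for irrational \<open>\<alpha>\<close> every partial quotient of
  positive index is at least 1.\<close>

fun cf_denom :: "real \<Rightarrow> nat \<Rightarrow> nat" where
  "cf_denom \<alpha> 0 = 1"
| "cf_denom \<alpha> (Suc 0) = nat (cf_partial_quotient \<alpha> 1)"
| "cf_denom \<alpha> (Suc (Suc n)) =
     nat (cf_partial_quotient \<alpha> (Suc (Suc n))) * cf_denom \<alpha> (Suc n) + cf_denom \<alpha> n"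

definition birkhoff_sum :: "real \<Rightarrow> nat \<Rightarrow> (circle \<Rightarrow> real) \<Rightarrow> circle \<Rightarrow> real"
  where "birkhoff_sum \<alpha> n g x = (\<Sum>i<n. g (x + circle_of (real i * \<alpha>)))"

definition skew_product :: "real \<Rightarrow> (circle \<Rightarrow> real) \<Rightarrow> circle \<times> circle \<Rightarrow> circle \<times> circle"
  where "skew_product \<alpha> g = (\<lambda>(x, y). (x + circle_of \<alpha>, y + circle_of (g x)))"

end

theory Submission
  imports Defs "HOL-Number_Theory.Cong" "HOL-Real_Asymp.Real_Asymp"
begin

text \<open>
  By Stone-Weierstrass it is enough to treat the characters of the torus, that is, to show that the
  average over \<open>n < N\<close> of \<open>F (n\<^sup>2)\<close> tends to 0, where
  \<open>F b = e(j (x + b \<alpha>) + k (y + S\<^sub>b(g)(x)))\<close> and \<open>(j, k) \<noteq> (0, 0)\<close>. Put \<open>q\<close>, \<open>Q\<close>, \<open>P\<close> for three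
  consecutive denominators. The smallness of the Birkhoff sums makes \<open>F\<close> almost invariant under
  shifts by \<open>q\<close> (up to about \<open>Q\<^bsup>4/5\<^esup>\<close> times) and by \<open>Q\<close> (up to about \<open>P\<^bsup>4/5\<^esup>\<close> times).
  For \<open>N\<close> between \<open>Q\<^bsup>4/5\<^esup>\<close> and \<open>P\<^bsup>4/5\<^esup>\<close> cut \<open>{0..<N}\<close> into blocks \<open>{X..<X+H}\<close> with
  \<open>H = \<lfloor>Q\<^bsup>3/4\<^esup>\<rfloor>\<close>. On a block, \<open>F ((X+h)\<^sup>2)\<close> is close to \<open>F (X\<^sup>2 + (2Xh + h\<^sup>2 + qm) mod Q)\<close> for
  every \<open>m < H\<close>. Since \<open>q\<close> is invertible modulo \<open>Q\<close>, Weyl's bound for quadratic exponential sums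
  shows that the residues \<open>2Xh + h\<^sup>2 + qm\<close> are equidistributed modulo \<open>Q\<close> in mean square, as
  soon as \<open>Q\<^sup>2 (ln Q)\<^sup>2\<close> is small compared with \<open>H\<^sup>3\<close>. Hence the block average is close to the average
  of \<open>F\<close> over \<open>Q\<close> consecutive times, and this tends to 0 uniformly in the starting point: otherwise
  the mean ergodic theorem would give a nonzero invariant function, whose argument solves the
  cohomological equation.
\<close>

section \<open>Characters of the circle and trigonometric polynomials\<close>

text \<open>A block holds only H < Q squares, too few to be spread over Q residues, and H must stay
  below Q^(4/5), where the range of N starts. The second parameter m repairs this at little cost,
  since F hardly moves under shifts by q: with m < H there are H^2 > Q points. On the Fourier side
  the sum over m damps the high frequencies, which is what makes the Weyl bounds summable.
  Exponents: H shifts by q cost H Q^(-4/5), and H / N must tend to 0, so H = Q^c asks for c < 4/5;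
  the Weyl bound asks for c > 2/3; 3/4 lies between. The rotation part of a shift by q costs about
  1/Q, less than Q^(-4/5). Reducing modulo Q takes about N H / Q + H shifts by Q at a cost of
  P^(-4/5) each, which is harmless up to N = P^(4/5); there the next triple of denominators takes
  over, so the ranges of N leave no gap. Blocks start at arbitrary times X^2, whence the need for
  decay uniform in the starting point. The mean ergodic theorem gives it in mean square; unique
  ergodicity of the rotation makes it uniform.\<close>

lift_definition circle_char :: "int \<Rightarrow> circle \<Rightarrow> complex" is "\<lambda>j x. cis (2 * pi * of_int j * x)"
proof -
  fix j :: int and x y :: real
  assume "x - y \<in> \<int>"
  then obtain n where "x = y + of_int n" by (auto elim!: Ints_cases simp: algebra_simps)
  then have "cis (2 * pi * of_int j * x) = cis (2 * pi * of_int j * y) * cis (2 * pi * of_int (j * n))"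
    by (simp add: cis_mult algebra_simps)
  then show "cis (2 * pi * of_int j * x) = cis (2 * pi * of_int j * y)"
    using cis_multiple_2pi[of "of_int (j * n)"] by (simp del: of_int_mult)
qed

lemma circle_char_circle_of: "circle_char j (circle_of x) = cis (2 * pi * of_int j * x)"
  by transfer simp

lemma circle_char_0 [simp]: "circle_char 0 x = 1" "circle_char j 0 = 1"
  by (transfer, simp)+

lemma norm_circle_char [simp]: "norm (circle_char j x) = 1"
  by transfer simp

lemma circle_char_add: "circle_char j (x + y) = circle_char j x * circle_char j y"
  by transfer (simp add: cis_mult algebra_simps)

lemma circle_char_int_add: "circle_char (i + j) x = circle_char i x * circle_char j x"
  by transfer (simp add: cis_mult algebra_simps)

lemma cnj_circle_char: "cnj (circle_char j x) = circle_char (- j) x"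
  by transfer (simp add: cis_cnj)

lemma circle_of_add: "circle_of (x + y) = circle_of x + circle_of y"
  by transfer simp

lemma circle_of_0: "circle_of 0 = 0"
  by transfer simp

lemma circle_of_eq_iff: "circle_of x = circle_of y \<longleftrightarrow> x - y \<in> \<int>"
  using circle.abs_eq_iff by simp

lemma circle_of_exhaust: obtains t where "x = circle_of t" "0 \<le> t" "t < 1"
proof -
  obtain s where s: "x = circle_of s" by (induction x) auto
  have "circle_of s = circle_of (frac s)"
    by (simp add: circle_of_eq_iff frac_def)
  then show ?thesis using that[of "frac s"] s by (simp add: frac_lt_1)
qed

text \<open>The circle carries the quotient topology, so continuity may be tested on the lift to the
  real line.\<close>

lemma continuous_on_circleI:
  assumes "continuous_on UNIV (\<lambda>x. f (circle_of x))"
  shows "continuous_on UNIV f"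
  using assms unfolding continuous_on_open_vimage[OF open_UNIV] open_circle_def
  by (simp add: vimage_def)

lemma continuous_on_circle_char: "continuous_on UNIV (circle_char j)"
  by (rule continuous_on_circleI) (auto simp: circle_char_circle_of intro!: continuous_intros)

lemma continuous_on_circle_char' [continuous_intros]:
  "continuous_on A f \<Longrightarrow> continuous_on A (\<lambda>x. circle_char j (f x))"
  by (rule continuous_on_compose2[OF continuous_on_circle_char]) auto

lemma continuous_on_circle_of' [continuous_intros]:
  "continuous_on A f \<Longrightarrow> continuous_on A (\<lambda>x. circle_of (f x))"
  by (rule continuous_on_compose2[OF continuous_on_circle_of[of UNIV]]) auto

lemma continuous_on_circle_add [continuous_intros]:
  fixes c :: circle
  assumes "continuous_on A f"
  shows "continuous_on A (\<lambda>x. f x + c)"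
proof -
  obtain t where t: "c = circle_of t" by (rule circle_of_exhaust)
  have "continuous_on UNIV (\<lambda>x. x + c)"
    by (rule continuous_on_circleI)
       (auto simp: t circle_of_add[symmetric] intro!: continuous_intros)
  then show ?thesis by (rule continuous_on_compose2) (use assms in auto)
qed

text \<open>One character already separates points. This yields both the Hausdorff property and the
  separation hypothesis of Stone-Weierstrass.\<close>

lemma circle_char_1_inj: "circle_char 1 x = circle_char 1 y \<Longrightarrow> x = y"
proof -
  obtain s where s: "x = circle_of s" "0 \<le> s" "s < 1" by (rule circle_of_exhaust)
  obtain t where t: "y = circle_of t" "0 \<le> t" "t < 1" by (rule circle_of_exhaust)
  assume "circle_char 1 x = circle_char 1 y"
  then have "cis (2 * pi * s) = cis (2 * pi * t)"
    by (simp add: s t circle_char_circle_of)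
  then have "sin (2 * pi * s) = sin (2 * pi * t) \<and> cos (2 * pi * s) = cos (2 * pi * t)"
    by (simp add: complex_eq_iff)
  then obtain n where "2 * pi * s = 2 * pi * t + 2 * of_int n * pi"
    using sin_cos_eq_iff[of "2 * pi * s" "2 * pi * t"] by auto
  then have "2 * pi * (s - t - of_int n) = 0" by (simp add: algebra_simps)
  then have "s - t = of_int n" by simp
  then show "x = y" by (simp add: s t circle_of_eq_iff)
qed

text \<open>The Stone-Weierstrass locale asks for a Hausdorff domain; the property is pulled back
  from the complex plane along the injective character.\<close>

instance circle :: t2_space
proof
  fix x y :: circle
  assume "x \<noteq> y"
  then have "circle_char 1 x \<noteq> circle_char 1 y" using circle_char_1_inj by blast
  then obtain U V where UV: "open U" "open V" "circle_char 1 x \<in> U" "circle_char 1 y \<in> V" "U \<inter> V = {}"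
    by (meson hausdorff)
  have "open (circle_char 1 -` U)" "open (circle_char 1 -` V)"
    using UV continuous_on_circle_char[of 1] by (auto simp: continuous_on_open_vimage)
  then show "\<exists>U V. open U \<and> open V \<and> x \<in> U \<and> y \<in> V \<and> U \<inter> V = {}"
    using UV by (intro exI[of _ "circle_char 1 -` U"] exI[of _ "circle_char 1 -` V"]) auto
qed

lemma compact_circle: "compact (UNIV :: circle set)"
proof -
  have "compact (circle_of ` {0..1})"
    by (intro compact_continuous_image continuous_on_circle_of) auto
  moreover have "circle_of ` {0..1} = UNIV"
    by (metis UNIV_eq_I atLeastAtMost_iff circle_of_exhaust imageI less_imp_le)
  ultimately show ?thesis by simp
qed

text \<open>Real-valued, as Stone-Weierstrass requires. The complex coefficient \<open>c\<close>
  supplies sines as well as cosines, and \<open>j = k = 0\<close> gives the constants.\<close>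

inductive_set trig_poly :: "(circle \<times> circle \<Rightarrow> real) set" where
  monom: "(\<lambda>z. Re (c * circle_char j (fst z) * circle_char k (snd z))) \<in> trig_poly"
| add: "p \<in> trig_poly \<Longrightarrow> q \<in> trig_poly \<Longrightarrow> (\<lambda>z. p z + q z) \<in> trig_poly"

lemma continuous_on_trig_poly: "p \<in> trig_poly \<Longrightarrow> continuous_on A p"
  by (induction rule: trig_poly.induct) (auto intro!: continuous_intros)

text \<open>Re u * Re v = Re (u * v) / 2 + Re (u * cnj v) / 2, and conjugating a character negates
  its frequency.\<close>

lemma trig_poly_mult:
  assumes "p \<in> trig_poly" "q \<in> trig_poly"
  shows "(\<lambda>z. p z * q z) \<in> trig_poly"
  using assms(2)
proof induction
  case (monom d l m)
  show ?case using assms(1)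
  proof induction
    case (monom c j k)
    have "Re (c * circle_char j (fst z) * circle_char k (snd z)) * Re (d * circle_char l (fst z)
        * circle_char m (snd z)) =
       Re (c * d / 2 * circle_char (j + l) (fst z) * circle_char (k + m) (snd z))
       + Re (c * cnj d / 2 * circle_char (j - l) (fst z) * circle_char (k - m) (snd z))" for z
    proof -
      define u v where "u = c * circle_char j (fst z) * circle_char k (snd z)" and "v = d
          * circle_char l (fst z) * circle_char m (snd z)"
      have "Re u * Re v = Re (u * v / 2) + Re (u * cnj v / 2)"
        by (simp add: field_simps)
      also have "u * v / 2 = c * d / 2 * circle_char (j + l) (fst z) * circle_char (k + m) (snd z)"
        by (simp add: u_def v_def circle_char_int_add)
      also have "u * cnj v / 2 = c * cnj d / 2 * circle_char (j - l) (fst z) * circle_char (k - m) (snd z)"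
        using circle_char_int_add[of j "- l" "fst z"] circle_char_int_add[of k "- m" "snd z"]
        by (simp add: u_def v_def cnj_circle_char)
      finally show ?thesis unfolding u_def v_def .
    qed
    then show ?case by (simp only:) (intro trig_poly.intros)
  next
    case (add p q)
    then show ?case by (simp add: distrib_right trig_poly.add)
  qed
next
  case (add p q)
  then show ?case by (simp add: distrib_left trig_poly.add)
qed

lemma trig_poly_dense:
  fixes f :: "circle \<times> circle \<Rightarrow> real"
  assumes "continuous_on UNIV f" "e > 0"
  obtains p where "p \<in> trig_poly" "\<And>z. \<bar>f z - p z\<bar> < e"
proof -
  interpret function_ring_on trig_poly "UNIV :: (circle \<times> circle) set"
  proof
    show "compact (UNIV :: (circle \<times> circle) set)"
      using compact_Times[OF compact_circle compact_circle] by simp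
    show "(\<lambda>_. c) \<in> trig_poly" for c
      using trig_poly.monom[of "of_real c" 0 0] by simp
    fix x y :: "circle \<times> circle"
    assume "x \<noteq> y"
    \<comment> \<open>Coefficients 1 and \<open>\<i>\<close> read off real and imaginary parts, so
      the four functions below determine the first character of both coordinates.\<close>
    define F :: "complex \<Rightarrow> circle \<times> circle \<Rightarrow> real" where "F c z = Re (c * circle_char 1 (fst z)
        * circle_char 0 (snd z))" for c z
    define G :: "complex \<Rightarrow> circle \<times> circle \<Rightarrow> real" where "G c z = Re (c * circle_char 0 (fst z)
        * circle_char 1 (snd z))" for c z
    have "\<exists>h \<in> {F 1, F \<i>, G 1, G \<i>}. h x \<noteq> h y"
    proof (rule ccontr)
      assume "\<not> ?thesis"
      then have "circle_char 1 (fst x) = circle_char 1 (fst y)" "circle_char 1 (snd x)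
          = circle_char 1 (snd y)"
        by (auto simp: F_def G_def complex_eq_iff)
      then show False using \<open>x \<noteq> y\<close> by (auto dest: circle_char_1_inj simp: prod_eq_iff)
    qed
    moreover have "F c \<in> trig_poly" "G c \<in> trig_poly" for c
      unfolding F_def[abs_def] G_def[abs_def] by (rule trig_poly.monom)+
    ultimately show "\<exists>f\<in>trig_poly. f x \<noteq> f y" by blast
  qed (auto intro: continuous_on_trig_poly trig_poly.add trig_poly_mult)
  show ?thesis using Stone_Weierstrass_basic[OF assms] that by auto
qed

section \<open>Lebesgue measure on the circle\<close>

lemma sets_circle_lebesgue [simp, measurable_cong]: "sets circle_lebesgue = sets borel"
  by (simp add: circle_lebesgue_def)

lemma space_circle_lebesgue [simp]: "space circle_lebesgue = UNIV"
  by (simp add: circle_lebesgue_def)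

lemma finite_measure_circle_lebesgue: "finite_measure circle_lebesgue"
  by (rule finite_measureI) (use emeasure_space_circle_lebesgue in auto)

interpretation circle_lebesgue: finite_measure circle_lebesgue
  by (rule finite_measure_circle_lebesgue)

lemma measure_circle_lebesgue_UNIV [simp]: "measure circle_lebesgue UNIV = 1"
  using emeasure_space_circle_lebesgue by (simp add: measure_def)

lemma circle_char_measurable [measurable]: "circle_char j \<in> borel_measurable borel"
  by (intro borel_measurable_continuous_onI continuous_on_circle_char)

lemma circle_add_measurable [measurable]: "(\<lambda>x::circle. x + c) \<in> borel_measurable borel"
  by (intro borel_measurable_continuous_onI continuous_intros)

lemma circle_of_measurable [measurable]: "circle_of \<in> borel_measurable borel"
  by (intro borel_measurable_continuous_onI continuous_on_circle_of)

lemma integrable_circle_char: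
  assumes "finite_measure M" "sets M = sets borel"
  shows "integrable M (circle_char j)"
proof -
  interpret finite_measure M by fact
  show ?thesis
    by (rule integrable_const_bound[of _ 1]) (use assms(2) in \<open>auto cong: measurable_cong_sets\<close>)
qed

lemma integral_circle_char: "(LINT x|circle_lebesgue. circle_char j x) = (if j = 0 then 1 else 0)"
proof (cases "j = 0")
  case False
  define F :: "real \<Rightarrow> complex" where "F t = cis (2 * pi * of_int j * t) / (2 * pi * of_int j * \<i>)" for t
  define f :: "real \<Rightarrow> complex" where "f t = cis (2 * pi * of_int j * t)" for t
  have [measurable]: "f \<in> borel_measurable borel"
    unfolding f_def by (intro borel_measurable_continuous_onI continuous_intros)
  define c :: complex where "c = 2 * pi * of_int j * \<i>"
  have nz: "c \<noteq> 0" using False by (simp add: c_def)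
  have "(F has_vector_derivative f t) (at t within {0..1})" for t
  proof -
    have "((\<lambda>z. exp (c * z) / c) has_field_derivative exp (c * of_real t)) (at (of_real t))"
      using nz by (auto intro!: derivative_eq_intros)
    then have "((\<lambda>t. exp (c * of_real t) / c) has_vector_derivative exp (c * of_real t)) (at t within {0..1})"
      by (rule has_vector_derivative_real_field)
    then show ?thesis by (simp add: F_def[abs_def] f_def c_def cis_conv_exp mult_ac)
  qed
  moreover have "continuous_on {0..1} f"
    unfolding f_def by (intro continuous_intros)
  ultimately have "has_bochner_integral lborel (\<lambda>x. indicator {0..1} x *\<^sub>R f x) (F 1 - F 0)"
    by (intro has_bochner_integral_FTC_Icc) auto
  moreover have "F 1 - F 0 = 0"
    using cis_multiple_2pi[of "of_int j"] by (simp add: F_def mult_ac)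
  ultimately have *: "(LINT x|lborel. indicator {0..1} x *\<^sub>R f x) = 0"
    by (simp add: has_bochner_integral_iff)
  have "(LINT x|circle_lebesgue. circle_char j x) = (LINT t|restrict_space lborel {0..<1}. f t)"
    unfolding circle_lebesgue_def f_def
    by (subst integral_distr) (auto intro: measurable_restrict_space1 simp: circle_char_circle_of)
  also have "\<dots> = (LINT x|lborel. indicator {0..<1} x *\<^sub>R f x)"
    by (subst integral_restrict_space) (auto simp: set_lebesgue_integral_def)
  also have "\<dots> = (LINT x|lborel. indicator {0..1} x *\<^sub>R f x)"
  proof (rule integral_cong_AE)
    show "AE x in lborel. indicator {0..<1} x *\<^sub>R f x = indicator {0..1} x *\<^sub>R f x"
      using AE_lborel_singleton[of 1] by eventually_elim (auto simp: indicator_def)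
  qed measurable
  finally show ?thesis using * False by simp
qed simp

text \<open>Torus polynomials double as circle polynomials once the second coordinate is frozen at
  0, where every character equals 1.\<close>

lemma integral_trig_poly_cong:
  assumes "finite_measure M" "sets M = sets borel" "finite_measure N" "sets N = sets borel"
    and "\<And>j. (LINT x|M. circle_char j x) = (LINT x|N. circle_char j x)" and "p \<in> trig_poly"
  shows "(LINT x|M. p (x, 0)) = (LINT x|N. p (x, 0))"
proof -
  interpret M: finite_measure M by fact
  interpret N: finite_measure N by fact
  note int = integrable_circle_char[OF assms(1,2)] integrable_circle_char[OF assms(3,4)]
  have "integrable M (\<lambda>x. p (x, 0)) \<and> integrable N (\<lambda>x. p (x, 0))
      \<and> (LINT x|M. p (x, 0)) = (LINT x|N. p (x, 0))"
    using assms(6)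
    by induction (use int assms(5) in auto)
  then show ?thesis by blast
qed

lemma integrable_circle_continuous:
  fixes f :: "circle \<Rightarrow> 'b::{banach, second_countable_topology}"
  assumes "finite_measure M" "sets M = sets borel" "continuous_on UNIV f"
  shows "integrable M f"
proof -
  interpret finite_measure M by fact
  have "bounded (range f)"
    using compact_imp_bounded[OF compact_continuous_image[OF assms(3) compact_circle]] .
  then obtain B where "\<And>x. norm (f x) \<le> B" by (auto simp: bounded_iff)
  moreover have "f \<in> borel_measurable M"
    using borel_measurable_continuous_onI[OF assms(3)] assms(2) by (simp cong: measurable_cong_sets)
  ultimately show ?thesis by (intro integrable_const_bound[of _ B]) auto
qed

lemma integral_circle_continuous_cong:
  fixes f :: "circle \<Rightarrow> real"
  assumes "finite_measure M" "sets M = sets borel" "finite_measure N" "sets N = sets borel"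
    and "\<And>j. (LINT x|M. circle_char j x) = (LINT x|N. circle_char j x)" and "continuous_on UNIV f"
  shows "(LINT x|M. f x) = (LINT x|N. f x)"
proof -
  interpret M: finite_measure M by fact
  interpret N: finite_measure N by fact
  define K where "K = measure M (space M) + measure N (space N)"
  have "K \<ge> 0" by (simp add: K_def)
  have "\<bar>(LINT x|M. f x) - (LINT x|N. f x)\<bar> \<le> e" if "e > 0" for e
  proof -
    \<comment> \<open>\<open>K + 1\<close> rather than \<open>K\<close>, because both measures may
      have mass 0.\<close>
    have e': "e / (K + 1) > 0" using that \<open>K \<ge> 0\<close> by simp
    have "continuous_on UNIV (\<lambda>z::circle \<times> circle. f (fst z))"
      by (rule continuous_on_compose2[OF assms(6)]) (auto intro!: continuous_intros)
    then obtain p where p: "p \<in> trig_poly" "\<And>z::circle \<times> circle. \<bar>f (fst z) - p z\<bar> < e / (K + 1)"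
      using trig_poly_dense[OF _ e'] by metis
    have pc: "continuous_on UNIV (\<lambda>x. p (x, 0))"
      by (rule continuous_on_compose2[OF continuous_on_trig_poly[OF p(1), of UNIV]])
         (auto intro!: continuous_intros)
    have *: "\<bar>(LINT x|L. f x) - (LINT x|L. p (x, 0))\<bar> \<le> e / (K + 1) * measure L (space L)"
      if "finite_measure L" "sets L = sets borel" for L
    proof -
      interpret L: finite_measure L by fact
      have i: "integrable L f" "integrable L (\<lambda>x. p (x, 0))"
        using integrable_circle_continuous[OF that] assms(6) pc by auto
      have "\<bar>(LINT x|L. f x) - (LINT x|L. p (x, 0))\<bar> = \<bar>LINT x|L. f x - p (x, 0)\<bar>"
        using i by simp
      also have "\<dots> \<le> (LINT x|L. \<bar>f x - p (x, 0)\<bar>)"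
        by (rule integral_abs_bound)
      also have "\<dots> \<le> (LINT x|L. e / (K + 1))"
        by (rule integral_mono) (use i less_imp_le[OF p(2)[of "(_, 0)"]] in auto)
      finally show ?thesis by (simp add: mult.commute)
    qed
    have "\<bar>(LINT x|M. f x) - (LINT x|N. f x)\<bar> \<le> e / (K + 1) * measure M (space M) + e / (K + 1)
        * measure N (space N)"
      using *[OF assms(1,2)] *[OF assms(3,4)] integral_trig_poly_cong[OF assms(1-5) p(1)] by linarith
    also have "\<dots> = e * (K / (K + 1))" unfolding distrib_left[symmetric] K_def[symmetric] by simp
    also have "\<dots> \<le> e * 1"
      by (rule mult_left_mono) (use that \<open>K \<ge> 0\<close> in auto)
    finally show ?thesis by simp
  qed
  then show ?thesis using field_le_epsilon[of "\<bar>(LINT x|M. f x) - (LINT x|N. f x)\<bar>" 0] by force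
qed

lemma infdist_shift:
  fixes A :: "real set"
  assumes "\<And>t. t + c \<in> A \<longleftrightarrow> t \<in> A"
  shows "infdist (t + c) A = infdist t A"
proof -
  have "A = (\<lambda>t. t + c) ` A"
    using assms by (auto simp: image_iff) (metis diff_add_cancel)
  then have "infdist (t + c) A = infdist (t + c) ((\<lambda>t. t + c) ` A)" by simp
  also have "\<dots> = infdist t A" by (simp add: infdist_def image_image)
  finally show ?thesis .
qed

text \<open>Fourier uniqueness: equal coefficients give equal integrals of continuous functions,
  these converge to indicators of open sets, and the open sets form an intersection-stable
  generator.\<close>

lemma circle_measure_eqI:
  assumes M: "finite_measure M" "sets M = sets borel" and N: "finite_measure N" "sets N = sets borel"
    and eq: "\<And>j. (LINT x|M. circle_char j x) = (LINT x|N. circle_char j x)"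
  shows "M = N"
proof -
  interpret M: finite_measure M by fact
  interpret N: finite_measure N by fact
  have sp: "space M = UNIV" "space N = UNIV"
    using M(2) N(2) by (metis sets_eq_imp_space_eq space_borel)+
  have full: "measure M UNIV = measure N UNIV"
    using eq[of 0] sp by simp
  have "measure M U = measure N U" if "open U" for U
  \<comment> \<open>For \<open>U = UNIV\<close> the complement \<open>V\<close> is empty and
    \<open>infdist\<close> to it is 0 by convention; that case is settled by the total masses, that
    is, by frequency 0.\<close>
  proof (cases "U = UNIV")
    case False
    define V where "V = - (circle_of -` U)"
    have "closed V" using that by (simp add: V_def open_circle_def closed_def)
    have "V \<noteq> {}"
      using False circle_of_exhaust unfolding V_def by (metis ComplI UNIV_eq_I empty_iff vimage_eq)
    have per: "infdist (t + of_int n) V = infdist t V" for t n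
    proof (rule infdist_shift)
      fix t
      have "circle_of (t + of_int n) = circle_of t" by (simp add: circle_of_eq_iff)
      then show "t + of_int n \<in> V \<longleftrightarrow> t \<in> V" by (simp add: V_def)
    qed
    \<comment> \<open>Continuous functions increasing to the indicator of \<open>U\<close>. The
      distance is measured on the real line to the lifted complement; by \<open>per\<close> it does
      not depend on which representative \<open>rep_circle\<close> returns.\<close>
    define h where "h n x = min 1 (real n * infdist (rep_circle x) V)" for n x
    have h: "h n (circle_of t) = min 1 (real n * infdist t V)" for n t
    proof -
      have "rep_circle (circle_of t) - t \<in> \<int>"
        by (metis Quotient3_circle Quotient3_def circle_of_eq_iff Quotient3_abs_rep)
      then obtain m where "rep_circle (circle_of t) = t + of_int m"
        by (auto elim!: Ints_cases simp: algebra_simps)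
      then show ?thesis by (simp add: h_def per)
    qed
    have hc: "continuous_on UNIV (h n)" for n
      by (rule continuous_on_circleI) (auto simp: h intro!: continuous_intros)
    have hlim: "(\<lambda>n. h n x) \<longlonglongrightarrow> indicator U x" for x
    proof -
      obtain t where t: "x = circle_of t" by (rule circle_of_exhaust)
      show ?thesis
      proof (cases "x \<in> U")
        case True
        then have "t \<notin> V" by (simp add: V_def t)
        then have pos: "infdist t V > 0"
          using \<open>closed V\<close> \<open>V \<noteq> {}\<close> by (simp add: infdist_pos_not_in_closed)
        obtain n0 where n0: "1 / infdist t V < real n0" using reals_Archimedean2 by blast
        have "\<forall>\<^sub>F n in sequentially. h n x = 1"
        proof (rule eventually_sequentiallyI)
          fix n assume "n0 \<le> n"
          then have "1 \<le> real n0 * infdist t V" "real n0 * infdist t V \<le> real n * infdist t V"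
            using n0 pos by (auto simp: field_simps)
          then show "h n x = 1" by (simp add: t h)
        qed
        then show ?thesis using True by (auto intro: tendsto_eventually)
      next
        case False
        then show ?thesis by (simp add: t h V_def)
      qed
    qed
    have hb: "norm (h n x) \<le> 1" for n x
      by (simp add: h_def infdist_nonneg)
    have lim: "(\<lambda>n. LINT x|L. h n x) \<longlonglongrightarrow> measure L U"
      if "finite_measure L" "sets L = sets borel" "space L = UNIV" for L
    proof -
      interpret L: finite_measure L by fact
      have "U \<in> sets L" using \<open>open U\<close> that(2) by simp
      have [measurable]: "h n \<in> borel_measurable L" for n
        using borel_measurable_continuous_onI[OF hc] that(2) by (simp cong: measurable_cong_sets)
      have "(\<lambda>n. LINT x|L. h n x) \<longlonglongrightarrow> (LINT x|L. indicator U x)"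
        by (rule integral_dominated_convergence[where w = "\<lambda>_. 1"])
           (use hlim hb \<open>U \<in> sets L\<close> in auto)
      then show ?thesis using that(3) by simp
    qed
    have "(LINT x|M. h n x) = (LINT x|N. h n x)" for n
      by (rule integral_circle_continuous_cong[OF M N eq hc])
    then show ?thesis
      using lim[OF M sp(1)] lim[OF N sp(2)] LIMSEQ_unique by auto
  qed (use full in simp)
  then have "emeasure M U = emeasure N U" if "open U" for U
    using that by (simp add: M.emeasure_eq_measure N.emeasure_eq_measure)
  then show ?thesis
    by (intro measure_eqI_generator_eq[where E = "{U. open U}" and \<Omega> = UNIV and A = "\<lambda>_. UNIV"])
       (auto simp: Int_stable_def M(2) N(2) borel_def)
qed

text \<open>Translation multiplies the coefficient of frequency j by a phase, which is 1 for j = 0,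
  and all other coefficients are 0. Fourier uniqueness concludes.\<close>

lemma circle_lebesgue_translation:
  "distr circle_lebesgue borel (\<lambda>x. x + c) = circle_lebesgue"
proof (rule circle_measure_eqI)
  show "finite_measure (distr circle_lebesgue borel (\<lambda>x. x + c))"
    by (rule circle_lebesgue.finite_measure_distr) measurable
  show "(LINT x|distr circle_lebesgue borel (\<lambda>x. x + c). circle_char j x)
      = (LINT x|circle_lebesgue. circle_char j x)" for j
    by (subst integral_distr) (auto simp: circle_char_add integral_circle_char)
qed (auto intro: finite_measure_circle_lebesgue)

lemma integral_circle_translation:
  fixes f :: "circle \<Rightarrow> 'b::{banach, second_countable_topology}"
  assumes "f \<in> borel_measurable borel"
  shows "(LINT x|circle_lebesgue. f (x + c)) = (LINT x|circle_lebesgue. f x)"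
proof -
  have "(LINT x|circle_lebesgue. f x) = (LINT x|distr circle_lebesgue borel (\<lambda>x. x + c). f x)"
    by (simp add: circle_lebesgue_translation)
  also have "\<dots> = (LINT x|circle_lebesgue. f (x + c))"
    by (rule integral_distr) (use assms in measurable)
  finally show ?thesis by simp
qed

text \<open>The exceptional set need not be Borel, so the translation is applied to a Borel null set
  containing it.\<close>

lemma AE_circle_translation:
  assumes "AE x in circle_lebesgue. P x"
  shows "AE x in circle_lebesgue. P (x + c)"
proof -
  obtain N where N: "{x. \<not> P x} \<subseteq> N" "N \<in> sets borel" "emeasure circle_lebesgue N = 0"
    using AE_E[OF assms] by auto
  have [measurable]: "N \<in> sets borel" by (rule N(2))
  have "AE x in circle_lebesgue. x \<notin> N"
    by (rule AE_I[of _ _ N]) (use N in auto)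
  then have "AE x in distr circle_lebesgue borel (\<lambda>x. x + c). x \<notin> N"
    unfolding circle_lebesgue_translation .
  then have "AE x in circle_lebesgue. x + c \<notin> N"
    by (subst (asm) AE_distr_iff) auto
  then show ?thesis by eventually_elim (use N(1) in auto)
qed

lemma circle_char_irrational_neq_1:
  assumes "\<alpha> \<notin> \<rat>" "j \<noteq> 0" shows "circle_char j (circle_of \<alpha>) \<noteq> 1"
proof
  assume "circle_char j (circle_of \<alpha>) = 1"
  then have "cis (2 * pi * of_int j * \<alpha>) = 1" by (simp add: circle_char_circle_of)
  then have "cos (2 * pi * of_int j * \<alpha>) = 1" by (simp add: complex_eq_iff)
  then obtain n :: int where "2 * pi * of_int j * \<alpha> = of_int n * 2 * pi"
    by (auto simp: cos_one_2pi_int)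
  then have "2 * pi * (of_int j * \<alpha> - of_int n) = 0" by (simp add: algebra_simps)
  then have "\<alpha> = of_int n / of_int j" using assms(2) by (simp add: field_simps)
  then show False using assms(1) by auto
qed

text \<open>The nontrivial Fourier coefficients of the indicator of an invariant set vanish, so the
  restriction of Lebesgue measure to it is a multiple of Lebesgue measure.\<close>

lemma rotation_ergodic:
  assumes irr: "\<alpha> \<notin> \<rat>" and [measurable]: "E \<in> sets borel"
    and inv: "AE x in circle_lebesgue. x + circle_of \<alpha> \<in> E \<longleftrightarrow> x \<in> E"
    and pos: "emeasure circle_lebesgue E \<noteq> 0"
  shows "AE x in circle_lebesgue. x \<in> E"
proof -
  define m where "m = measure circle_lebesgue E"
  have mm: "emeasure circle_lebesgue E = ennreal m"
    by (simp add: m_def circle_lebesgue.emeasure_eq_measure)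
  have "m > 0" using pos by (simp add: mm m_def zero_less_measure_iff)
  define M where "M = density circle_lebesgue (\<lambda>x. ennreal (indicator E x))"
  define N where "N = density circle_lebesgue (\<lambda>x. ennreal m)"
  have z: "(LINT x|circle_lebesgue. indicator E x *\<^sub>R circle_char j x) = 0" if "j \<noteq> 0" for j
  proof -
    define I where "I = (LINT x|circle_lebesgue. indicator E x *\<^sub>R circle_char j x)"
    have "I = (LINT x|circle_lebesgue. indicator E (x + circle_of \<alpha>) *\<^sub>R circle_char j (x + circle_of \<alpha>))"
      unfolding I_def by (rule integral_circle_translation[symmetric]) measurable
    also have "\<dots> = (LINT x|circle_lebesgue. (indicator E x *\<^sub>R circle_char j x)
        * circle_char j (circle_of \<alpha>))"
    proof (rule integral_cong_AE)
      show "AE x in circle_lebesgue. indicator E (x + circle_of \<alpha>) *\<^sub>R circle_char j (x + circle_of \<alpha>)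
          = (indicator E x *\<^sub>R circle_char j x) * circle_char j (circle_of \<alpha>)"
        using inv by eventually_elim (auto simp: indicator_def circle_char_add)
    qed measurable
    also have "\<dots> = I * circle_char j (circle_of \<alpha>)"
      unfolding I_def by (rule integral_mult_left_zero)
    finally have "I * (circle_char j (circle_of \<alpha>) - 1) = 0" by (simp add: algebra_simps)
    then show ?thesis using circle_char_irrational_neq_1[OF irr that] by (simp add: I_def)
  qed
  have z0: "(LINT x|circle_lebesgue. indicator E x *\<^sub>R (1::complex)) = m *\<^sub>R 1"
    by (subst integral_scaleR_left)
       (auto simp: m_def intro!: circle_lebesgue.integrable_const_bound[of _ 1])
  have "M = N"
  proof (rule circle_measure_eqI)
    show "finite_measure M"
      by (rule finite_measureI)
         (auto simp: M_def emeasure_density ennreal_indicator mm)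
    show "finite_measure N"
      by (rule finite_measureI)
         (auto simp: N_def emeasure_density circle_lebesgue.emeasure_eq_measure ennreal_mult[symmetric])
    show "(LINT x|M. circle_char j x) = (LINT x|N. circle_char j x)" for j
      unfolding M_def N_def using z[of j] z0
      by (subst (1 2) integral_density) (auto simp: integral_circle_char m_def)
  qed (auto simp: M_def N_def)
  then have "emeasure M (- E) = emeasure N (- E)" by simp
  moreover have "emeasure M (- E) = (\<integral>\<^sup>+x. 0 \<partial>circle_lebesgue)"
    unfolding M_def
    by (subst emeasure_density, simp, simp, rule nn_integral_cong) (simp add: indicator_def)
  moreover have "emeasure N (- E) = ennreal m * emeasure circle_lebesgue (- E)"
    unfolding N_def by (subst emeasure_density) (auto simp: nn_integral_cmult_indicator)
  ultimately have "emeasure circle_lebesgue (- E) = 0"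
    using \<open>m > 0\<close> by auto
  then show ?thesis
    by (intro AE_I[of _ _ "- E"]) auto
qed

section \<open>Continued fraction denominators\<close>

text \<open>With \<open>p\<^sub>n / q\<^sub>n\<close> the convergents, this product is \<open>\<bar>q\<^sub>n \<alpha> - p\<^sub>n\<bar>\<close>.\<close>

definition cf_frac_prod :: "real \<Rightarrow> nat \<Rightarrow> real"
  where "cf_frac_prod \<alpha> n = (\<Prod>i\<le>n. frac (cf_complete_quotient \<alpha> i))"

lemma cf_complete_quotient_irrational:
  "\<alpha> \<notin> \<rat> \<Longrightarrow> cf_complete_quotient \<alpha> n \<notin> \<rat>"
proof (induction n)
  case (Suc n)
  then have *: "cf_complete_quotient \<alpha> n \<notin> \<rat>" by blast
  show ?case
  proof
    assume "cf_complete_quotient \<alpha> (Suc n) \<in> \<rat>"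
    then have "frac (cf_complete_quotient \<alpha> n) \<in> \<rat>"
      using Rats_inverse by (fastforce simp: divide_inverse)
    then have "frac (cf_complete_quotient \<alpha> n) + of_int \<lfloor>cf_complete_quotient \<alpha> n\<rfloor> \<in> \<rat>"
      by (intro Rats_add) auto
    then show False using * by (simp add: frac_def)
  qed
qed simp

lemma frac_cf_complete_quotient_pos:
  assumes "\<alpha> \<notin> \<rat>" shows "frac (cf_complete_quotient \<alpha> n) > 0"
  using cf_complete_quotient_irrational[OF assms, of n] Ints_subset_Rats
  by (auto simp: frac_gt_0_iff)

lemma cf_partial_quotient_Suc_ge_1:
  assumes "\<alpha> \<notin> \<rat>" shows "cf_partial_quotient \<alpha> (Suc n) \<ge> 1"
proof -
  have "1 / frac (cf_complete_quotient \<alpha> n) \<ge> 1"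
    using frac_cf_complete_quotient_pos[OF assms, of n] frac_lt_1[of "cf_complete_quotient \<alpha> n"]
    by (simp add: field_simps)
  then show ?thesis by (simp add: cf_partial_quotient_def le_floor_iff)
qed

lemma cf_complete_quotient_split:
  assumes "\<alpha> \<notin> \<rat>"
  shows "cf_complete_quotient \<alpha> (Suc n)
    = real (nat (cf_partial_quotient \<alpha> (Suc n))) + frac (cf_complete_quotient \<alpha> (Suc n))"
  using cf_partial_quotient_Suc_ge_1[OF assms, of n]
  by (simp add: cf_partial_quotient_def frac_def del: cf_complete_quotient.simps)

lemma cf_denom_pos:
  assumes "\<alpha> \<notin> \<rat>" shows "cf_denom \<alpha> n > 0 \<and> cf_denom \<alpha> (Suc n) > 0"
proof (induction n)
  case 0
  then show ?case using cf_partial_quotient_Suc_ge_1[OF assms, of 0] by simp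
next
  case (Suc n)
  then show ?case by simp
qed

text \<open>The indices start at 1: if the first partial quotient is 1, the denominators of index 0
  and 1 are both 1.\<close>

lemma cf_denom_strict_mono:
  assumes "\<alpha> \<notin> \<rat>" shows "cf_denom \<alpha> (Suc n) < cf_denom \<alpha> (Suc (Suc n))"
proof -
  have "nat (cf_partial_quotient \<alpha> (Suc (Suc n))) \<ge> 1"
    using cf_partial_quotient_Suc_ge_1[OF assms, of "Suc n"] by simp
  then have "1 * cf_denom \<alpha> (Suc n) \<le> nat (cf_partial_quotient \<alpha> (Suc (Suc n))) * cf_denom \<alpha> (Suc n)"
    by (rule mult_le_mono1)
  then show ?thesis unfolding cf_denom.simps(3) using cf_denom_pos[OF assms, of n] by linarith
qed

lemma cf_denom_ge:
  assumes "\<alpha> \<notin> \<rat>" shows "n \<le> cf_denom \<alpha> n"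
proof (cases n)
  case (Suc m)
  have "Suc m \<le> cf_denom \<alpha> (Suc m)"
  proof (induction m)
    case 0 then show ?case using cf_denom_pos[OF assms, of 0] by simp
  next
    case (Suc m) then show ?case using cf_denom_strict_mono[OF assms, of m] by linarith
  qed
  then show ?thesis using Suc by simp
qed simp

lemma coprime_cf_denom: "coprime (cf_denom \<alpha> n) (cf_denom \<alpha> (Suc n))"
proof (induction n)
  case (Suc n)
  have "gcd (cf_denom \<alpha> (Suc n)) (nat (cf_partial_quotient \<alpha> (Suc (Suc n))) * cf_denom \<alpha> (Suc n)
      + cf_denom \<alpha> n) = gcd (cf_denom \<alpha> (Suc n)) (cf_denom \<alpha> n)"
    by (rule gcd_add_mult)
  with Suc show ?case by (simp add: coprime_iff_gcd_eq_1 gcd.commute)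
qed simp

lemma cf_frac_prod_Suc:
  "cf_frac_prod \<alpha> (Suc n) = cf_frac_prod \<alpha> n * frac (cf_complete_quotient \<alpha> (Suc n))"
  by (simp add: cf_frac_prod_def del: cf_complete_quotient.simps)

lemma cf_frac_prod_eq:
  assumes "\<alpha> \<notin> \<rat>"
  shows "cf_frac_prod \<alpha> n = cf_frac_prod \<alpha> (Suc n) * cf_complete_quotient \<alpha> (Suc (Suc n))"
  using frac_cf_complete_quotient_pos[OF assms, of "Suc n"]
  by (simp add: cf_frac_prod_Suc cf_complete_quotient.simps(2)[of \<alpha> "Suc n"]
      del: cf_complete_quotient.simps)

lemma cf_frac_prod_pos: "\<alpha> \<notin> \<rat> \<Longrightarrow> cf_frac_prod \<alpha> n > 0"
  unfolding cf_frac_prod_def by (intro prod_pos ballI frac_cf_complete_quotient_pos)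

text \<open>Classically, consecutive convergents have determinant 1 or -1 and errors of opposite
  sign. Here the induction step merely redistributes the splitting \<open>x = a + frac x\<close> of
  a complete quotient. Discarding the nonnegative second summand gives the bound in
  \<open>cf_denom_near_int\<close>.\<close>

lemma cf_denom_frac_prod:
  assumes "\<alpha> \<notin> \<rat>"
  shows "cf_denom \<alpha> (Suc n) * cf_frac_prod \<alpha> n + cf_denom \<alpha> n * cf_frac_prod \<alpha> (Suc n) = 1"
proof (induction n)
  case 0
  define x0 x1 where "x0 = cf_complete_quotient \<alpha> 0" and "x1 = cf_complete_quotient \<alpha> (Suc 0)"
  have "x1 * frac x0 = 1"
    using frac_cf_complete_quotient_pos[OF assms, of 0] by (simp add: x0_def x1_def)
  moreover have "x1 = real (cf_denom \<alpha> 1) + frac x1"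
    unfolding x1_def using cf_complete_quotient_split[OF assms, of 0] by simp
  moreover have "cf_frac_prod \<alpha> 0 = frac x0" "cf_frac_prod \<alpha> (Suc 0) = frac x0 * frac x1"
    by (simp_all add: cf_frac_prod_def x0_def x1_def)
  ultimately have "(real (cf_denom \<alpha> 1) + frac x1) * frac x0 = 1" by simp
  then show ?case
    using \<open>cf_frac_prod \<alpha> 0 = frac x0\<close> \<open>cf_frac_prod \<alpha> (Suc 0) = frac x0 * frac x1\<close>
    by (simp add: algebra_simps)
next
  case (Suc n)
  define a where "a = nat (cf_partial_quotient \<alpha> (Suc (Suc n)))"
  define x where "x = cf_complete_quotient \<alpha> (Suc (Suc n))"
  define P where "P = cf_frac_prod \<alpha> (Suc n)"
  have x: "x = real a + frac x"
    unfolding x_def a_def by (rule cf_complete_quotient_split[OF assms])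
  have 1: "cf_frac_prod \<alpha> n = P * x" "cf_frac_prod \<alpha> (Suc (Suc n)) = P * frac x"
    unfolding P_def x_def by (rule cf_frac_prod_eq[OF assms], rule cf_frac_prod_Suc)
  have 2: "real (cf_denom \<alpha> (Suc (Suc n))) = a * cf_denom \<alpha> (Suc n) + cf_denom \<alpha> n"
    by (simp add: a_def)
  have "real (cf_denom \<alpha> (Suc n)) * (P * (real a + frac x)) + cf_denom \<alpha> n * P = 1"
    using Suc 1 x P_def by simp
  then show ?case unfolding 1 2 P_def[symmetric] by (simp add: algebra_simps)
qed

text \<open>Numerators are never defined; membership in the integers stands in for them. Two
  consecutive indices feed the recurrence, and the alternating sign makes \<open>a * P\<close>
  cancel from \<open>P * (a + frac x)\<close>, leaving the next product.\<close>

lemma cf_denom_mult_approx: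
  assumes "\<alpha> \<notin> \<rat>"
  shows "real (cf_denom \<alpha> n) * \<alpha> - (-1) ^ n * cf_frac_prod \<alpha> n \<in> \<int>
     \<and> real (cf_denom \<alpha> (Suc n)) * \<alpha> - (-1) ^ Suc n * cf_frac_prod \<alpha> (Suc n) \<in> \<int>"
proof (induction n)
  case 0
  define a where "a = nat (cf_partial_quotient \<alpha> (Suc 0))"
  define x where "x = cf_complete_quotient \<alpha> (Suc 0)"
  have x: "x = real a + frac x"
    unfolding x_def a_def by (rule cf_complete_quotient_split[OF assms])
  have e: "frac \<alpha> * x = 1"
    using frac_cf_complete_quotient_pos[OF assms, of 0] by (simp add: x_def)
  have "real a * \<alpha> + frac \<alpha> * frac x = real a * of_int \<lfloor>\<alpha>\<rfloor> + frac \<alpha> * (a + frac x)"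
    by (simp add: frac_def[of \<alpha>] algebra_simps)
  also have "\<dots> = of_int (int a * \<lfloor>\<alpha>\<rfloor> + 1)"
    using e x by simp
  finally have "real a * \<alpha> + frac \<alpha> * frac x \<in> \<int>" by (simp only: Ints_of_int)
  then show ?case
    by (simp add: cf_frac_prod_def a_def x_def frac_def[of \<alpha>])
next
  case (Suc n)
  define a where "a = nat (cf_partial_quotient \<alpha> (Suc (Suc n)))"
  define x where "x = cf_complete_quotient \<alpha> (Suc (Suc n))"
  define P where "P = cf_frac_prod \<alpha> (Suc n)"
  have x: "x = real a + frac x"
    unfolding x_def a_def by (rule cf_complete_quotient_split[OF assms])
  have 1: "cf_frac_prod \<alpha> n = P * (real a + frac x)" "cf_frac_prod \<alpha> (Suc (Suc n)) = P * frac x"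
    unfolding P_def x[symmetric] unfolding x_def
    by (rule cf_frac_prod_eq[OF assms], rule cf_frac_prod_Suc)
  have 2: "real (cf_denom \<alpha> (Suc (Suc n))) = a * cf_denom \<alpha> (Suc n) + cf_denom \<alpha> n"
    by (simp add: a_def)
  have "a * (real (cf_denom \<alpha> (Suc n)) * \<alpha> - (-1) ^ Suc n * P)
      + (real (cf_denom \<alpha> n) * \<alpha> - (-1) ^ n * (P * (real a + frac x))) \<in> \<int>"
    using Suc unfolding 1 P_def by (intro Ints_add Ints_mult) auto
  moreover have "a * (real (cf_denom \<alpha> (Suc n)) * \<alpha> - (-1) ^ Suc n * P)
      + (real (cf_denom \<alpha> n) * \<alpha> - (-1) ^ n * (P * (real a + frac x)))
    = real (cf_denom \<alpha> (Suc (Suc n))) * \<alpha> - (-1) ^ Suc (Suc n) * (P * frac x)"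
    unfolding 2 by (simp add: algebra_simps)
  ultimately show ?case using Suc 1 by auto
qed

lemma cf_denom_near_int:
  assumes "\<alpha> \<notin> \<rat>"
  obtains p :: int where "\<bar>real (cf_denom \<alpha> n) * \<alpha> - p\<bar> \<le> 1 / cf_denom \<alpha> (Suc n)"
proof -
  obtain p where p: "real (cf_denom \<alpha> n) * \<alpha> - (-1) ^ n * cf_frac_prod \<alpha> n = of_int p"
    using cf_denom_mult_approx[OF assms, of n] by (auto elim: Ints_cases)
  have pos: "cf_frac_prod \<alpha> n > 0" "cf_frac_prod \<alpha> (Suc n) > 0" "cf_denom \<alpha> (Suc n) > 0"
    using cf_frac_prod_pos[OF assms] cf_denom_pos[OF assms] by auto
  have "cf_denom \<alpha> (Suc n) * cf_frac_prod \<alpha> n \<le> 1"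
    using cf_denom_frac_prod[OF assms, of n] pos by (smt (verit) mult_nonneg_nonneg of_nat_0_le_iff)
  then have "cf_frac_prod \<alpha> n \<le> 1 / cf_denom \<alpha> (Suc n)"
    using pos by (simp add: field_simps)
  moreover have "\<bar>real (cf_denom \<alpha> n) * \<alpha> - p\<bar> = cf_frac_prod \<alpha> n"
    unfolding p[symmetric] using pos by (simp add: abs_mult)
  ultimately show ?thesis using that[of p] by simp
qed

section \<open>Quadratic exponential sums\<close>

definition unit_exp :: "real \<Rightarrow> complex" where "unit_exp t = cis (2 * pi * t)"

lemma norm_unit_exp [simp]: "norm (unit_exp t) = 1"
  by (simp add: unit_exp_def)

lemma unit_exp_add: "unit_exp (s + t) = unit_exp s * unit_exp t"
  by (simp add: unit_exp_def cis_mult algebra_simps)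

lemma unit_exp_0 [simp]: "unit_exp 0 = 1"
  by (simp add: unit_exp_def)

lemma unit_exp_int: "t \<in> \<int> \<Longrightarrow> unit_exp t = 1"
  by (auto simp: unit_exp_def elim!: Ints_cases)

lemma cnj_unit_exp: "cnj (unit_exp t) = unit_exp (- t)"
  by (simp add: unit_exp_def cis_cnj)

lemma unit_exp_cong: "s - t \<in> \<int> \<Longrightarrow> unit_exp s = unit_exp t"
  using unit_exp_add[of "s - t" t] by (simp add: unit_exp_int)

lemma unit_exp_mult_nat: "unit_exp (t * real n) = unit_exp t ^ n"
  unfolding unit_exp_def Complex.DeMoivre by (rule arg_cong[of _ _ cis]) simp

lemma norm_one_minus_unit_exp: "norm (1 - unit_exp t) = 2 * \<bar>sin (pi * t)\<bar>"
proof -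
  have "(norm (1 - unit_exp t))\<^sup>2 = (1 - cos (2 * (pi * t)))\<^sup>2 + (sin (2 * (pi * t)))\<^sup>2"
    by (simp add: cmod_power2 unit_exp_def mult_ac)
  also have "\<dots> = 2 - 2 * cos (2 * (pi * t))"
    using sin_cos_squared_add[of "2 * (pi * t)"] by (simp add: power2_eq_square algebra_simps)
  also have "\<dots> = (2 * \<bar>sin (pi * t)\<bar>)\<^sup>2"
    unfolding cos_double_sin by (simp add: power_mult_distrib)
  finally show ?thesis by (subst (asm) power2_eq_iff_nonneg) simp_all
qed

text \<open>Sine is concave on [0, pi/2], so its graph lies above the chord.\<close>

lemma sin_jordan:
  assumes "0 \<le> x" "x \<le> pi / 2"
  shows "2 * x / pi \<le> sin x"
proof -
  have "convex_on {0..pi/2} (\<lambda>x. - sin x)"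
    by (rule f''_ge0_imp_convex[where f' = "\<lambda>x. - cos x" and f'' = sin])
       (auto intro!: derivative_eq_intros sin_ge_zero)
  from convex_onD[OF this, of "2 * x / pi" 0 "pi / 2"] show ?thesis
    using assms by (simp add: field_simps)
qed

lemma sin_pi_mult_lower:
  assumes "0 \<le> t" "t \<le> 1"
  shows "2 * min t (1 - t) \<le> sin (pi * t)"
proof (cases "t \<le> 1/2")
  case True
  then show ?thesis using sin_jordan[of "pi * t"] assms by (simp add: field_simps min_def)
next
  case False
  have "sin (pi * t) = sin (pi * (1 - t))"
    using sin_pi_minus[of "pi * t"] by (simp add: algebra_simps)
  moreover have "2 * (1 - t) \<le> sin (pi * (1 - t))"
    using False sin_jordan[of "pi * (1 - t)"] assms by simp
  ultimately show ?thesis using False by (simp add: min_def)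
qed

text \<open>In the geometric series the numerator is at most 2, and the denominator
  \<open>2 * sin (pi * t)\<close> is at least \<open>4 * min t (1 - t)\<close>.\<close>

lemma norm_sum_unit_exp_le:
  assumes "0 < t" "t < 1"
  shows "norm (\<Sum>h<H. unit_exp (t * real h)) \<le> 1 / (2 * min t (1 - t))"
proof -
  have pos: "min t (1 - t) > 0" using assms by simp
  have low: "4 * min t (1 - t) \<le> norm (1 - unit_exp t)"
    unfolding norm_one_minus_unit_exp using sin_pi_mult_lower[of t] assms by linarith
  have "(1 - unit_exp t) * (\<Sum>h<H. unit_exp (t * real h)) = 1 - unit_exp t ^ H"
    by (simp add: one_diff_power_eq unit_exp_mult_nat)
  then have "norm (1 - unit_exp t) * norm (\<Sum>h<H. unit_exp (t * real h)) = norm (1 - unit_exp t ^ H)"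
    by (metis norm_mult)
  also have "\<dots> \<le> 2"
    using norm_triangle_ineq4[of 1 "unit_exp t ^ H"] by (simp add: norm_power)
  finally have "4 * min t (1 - t) * norm (\<Sum>h<H. unit_exp (t * real h)) \<le> 2"
    using mult_right_mono[OF low, of "norm (\<Sum>h<H. unit_exp (t * real h))"] by simp
  then show ?thesis using pos by (simp add: field_simps)
qed

lemma norm_sum_unit_exp_le_card: "norm (\<Sum>h<(H::nat). unit_exp (f h)) \<le> real H"
  using sum_norm_le[of "{..<H}" "\<lambda>h. unit_exp (f h)" "\<lambda>_. 1"] by simp

text \<open>The reciprocal of a minimum is replaced by the sum of both reciprocals, so that summing
  the bound over residues produces harmonic sums.\<close>

lemma norm_sum_unit_exp_frac_le:
  assumes "D > 0" "r mod D \<noteq> 0"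
  shows "norm (\<Sum>h<H. unit_exp (real r / real D * real h))
    \<le> real D / 2 * (1 / real (r mod D) + 1 / real (D - r mod D))"
proof -
  define \<rho> where "\<rho> = r mod D"
  have \<rho>: "0 < \<rho>" "\<rho> < D" using assms by (auto simp: \<rho>_def)
  define t where "t = real \<rho> / real D"
  have t: "0 < t" "t < 1" using \<rho> by (auto simp: t_def)
  have "unit_exp (real r / real D * real h) = unit_exp (t * real h)" for h
  proof (rule unit_exp_cong)
    have "real r = real (r div D) * real D + real \<rho>"
      by (metis \<rho>_def div_mult_mod_eq of_nat_add of_nat_mult)
    then have "real r / real D * real h - t * real h = real (r div D * h)"
      using assms by (simp add: t_def field_simps)
    then show "real r / real D * real h - t * real h \<in> \<int>" by simp
  qed
  then have "norm (\<Sum>h<H. unit_exp (real r / real D * real h)) \<le> 1 / (2 * min t (1 - t))"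
    using norm_sum_unit_exp_le[OF t] by simp
  also have "\<dots> \<le> 1 / 2 * (1 / t + 1 / (1 - t))"
    using t by (auto simp: min_def)
  also have "1 / t = real D / real \<rho>" by (simp add: t_def)
  also have "1 / (1 - t) = real D / real (D - \<rho>)"
    using \<rho> by (simp add: t_def field_simps of_nat_diff)
  finally show ?thesis by (simp add: \<rho>_def field_simps)
qed

text \<open>Off-diagonal pairs come in conjugate couples, so it is enough to keep the differences
  \<open>d\<close> that are not negative and double the real part. This counts the diagonal
  \<open>d = 0\<close> twice, whence the second sum on the left.\<close>

lemma norm_sum_sq_eq:
  fixes z :: "nat \<Rightarrow> complex"
  shows "(norm (\<Sum>h<H. z h))\<^sup>2 + (\<Sum>h<H. (norm (z h))\<^sup>2)
    = 2 * Re (\<Sum>d<H. \<Sum>h<H-d. z (h + d) * cnj (z h))"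
proof (induction H)
  case (Suc H)
  define S where "S = (\<Sum>h<H. z h)"
  have "(\<Sum>d<Suc H. \<Sum>h<Suc H-d. z (h + d) * cnj (z h))
      = (\<Sum>d<Suc H. (\<Sum>h<H-d. z (h + d) * cnj (z h)) + z H * cnj (z (H - d)))"
    by (rule sum.cong) (auto simp: Suc_diff_le)
  also have "\<dots> = (\<Sum>d<H. \<Sum>h<H-d. z (h + d) * cnj (z h)) + z H * cnj (\<Sum>d<Suc H. z (H - d))"
    by (simp add: sum.distrib sum_distrib_left algebra_simps)
  also have "(\<Sum>d<Suc H. z (H - d)) = (\<Sum>d<Suc H. z d)"
    using sum.nat_diff_reindex[of z "Suc H"] by simp
  finally have *: "Re (\<Sum>d<Suc H. \<Sum>h<Suc H-d. z (h + d) * cnj (z h))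
    = Re (\<Sum>d<H. \<Sum>h<H-d. z (h + d) * cnj (z h)) + Re (z H * cnj (S + z H))"
    by (simp add: S_def)
  have "(norm (S + z H))\<^sup>2 + (norm (z H))\<^sup>2 = (norm S)\<^sup>2 + 2 * Re (z H * cnj (S + z H))"
    unfolding cmod_power2 by (simp add: power2_eq_square algebra_simps)
  then show ?case unfolding * using Suc by (simp add: S_def[symmetric])
qed simp

text \<open>This is the differencing inequality: in the inner sums a quadratic phase becomes linear
  in \<open>h\<close>.\<close>

lemma norm_sum_sq_le:
  fixes z :: "nat \<Rightarrow> complex"
  shows "(norm (\<Sum>h<H. z h))\<^sup>2 \<le> 2 * (\<Sum>d<H. norm (\<Sum>h<H-d. z (h + d) * cnj (z h)))"
proof -
  have "(norm (\<Sum>h<H. z h))\<^sup>2 \<le> 2 * Re (\<Sum>d<H. \<Sum>h<H-d. z (h + d) * cnj (z h))"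
    using norm_sum_sq_eq[of z H] sum_nonneg[of "{..<H}" "\<lambda>h. (norm (z h))\<^sup>2"] by simp
  also have "\<dots> \<le> 2 * norm (\<Sum>d<H. \<Sum>h<H-d. z (h + d) * cnj (z h))"
    by (intro mult_left_mono complex_Re_le_cmod) simp
  also have "\<dots> \<le> 2 * (\<Sum>d<H. norm (\<Sum>h<H-d. z (h + d) * cnj (z h)))"
    by (simp add: norm_sum)
  finally show ?thesis .
qed

lemma bij_betw_mult_mod:
  assumes "coprime a D" "D > (0::nat)"
  shows "bij_betw (\<lambda>\<rho>. (a * \<rho>) mod D) {..<D} {..<D}"
proof -
  have "inj_on (\<lambda>\<rho>. (a * \<rho>) mod D) {..<D}"
  proof (rule inj_onI)
    fix x y assume xy: "x \<in> {..<D}" "y \<in> {..<D}" "(a * x) mod D = (a * y) mod D"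
    then have "[a * x = a * y] (mod D)" by (simp add: cong_def)
    then have "[x = y] (mod D)" using assms by (simp add: cong_mult_lcancel_nat)
    then show "x = y" using xy by (simp add: cong_def)
  qed
  moreover have "(\<lambda>\<rho>. (a * \<rho>) mod D) ` {..<D} \<subseteq> {..<D}" using assms by auto
  ultimately show ?thesis
    by (simp add: bij_betw_def endo_inj_surj)
qed

lemma sum_mult_mod_periods:
  fixes f :: "nat \<Rightarrow> real"
  assumes "coprime a D" "D > 0"
  shows "(\<Sum>d<B * D. f ((a * d) mod D)) = real B * (\<Sum>\<rho><D. f \<rho>)"
proof (induction B)
  case (Suc B)
  have "(\<Sum>d<Suc B * D. f ((a * d) mod D))
      = (\<Sum>d<B * D. f ((a * d) mod D)) + (\<Sum>d\<in>{B*D..<B*D+D}. f ((a * d) mod D))"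
    by (subst sum.union_disjoint[symmetric]) (auto intro!: sum.cong)
  also have "(\<Sum>d\<in>{B*D..<B*D+D}. f ((a * d) mod D)) = (\<Sum>d<D. f ((a * (B * D + d)) mod D))"
    using sum.shift_bounds_nat_ivl[of "\<lambda>d. f ((a * d) mod D)" 0 "B * D" D]
    by (simp add: add.commute atLeast0LessThan)
  also have "\<dots> = (\<Sum>d<D. f ((a * d) mod D))"
    by (simp add: distrib_left mult.assoc[symmetric])
  also have "\<dots> = (\<Sum>\<rho><D. f \<rho>)"
    by (rule sum.reindex_bij_betw[OF bij_betw_mult_mod[OF assms]])
  finally show ?case using Suc by (simp add: algebra_simps)
qed simp

text \<open>Multiplication by \<open>a\<close> permutes the residues, so every run of
  \<open>D\<close> consecutive \<open>d\<close> contributes the full sum of \<open>f\<close>;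
  nonnegativity permits rounding \<open>H\<close> up to whole periods.\<close>

lemma sum_mult_mod_le:
  fixes f :: "nat \<Rightarrow> real"
  assumes "coprime a D" "D > 0" "\<And>\<rho>. f \<rho> \<ge> 0"
  shows "(\<Sum>d<H. f ((a * d) mod D)) \<le> (real H / real D + 1) * (\<Sum>\<rho><D. f \<rho>)"
proof -
  have "H \<le> (H div D + 1) * D"
    using dividend_less_div_times[OF assms(2), of H] by simp
  then have "(\<Sum>d<H. f ((a * d) mod D)) \<le> (\<Sum>d<(H div D + 1) * D. f ((a * d) mod D))"
    by (intro sum_mono2) (auto simp: assms(3))
  also have "\<dots> = real (H div D + 1) * (\<Sum>\<rho><D. f \<rho>)"
    by (rule sum_mult_mod_periods[OF assms(1,2)])
  also have "\<dots> \<le> (real H / real D + 1) * (\<Sum>\<rho><D. f \<rho>)"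
  proof (intro mult_right_mono sum_nonneg)
    have "real (H div D * D) \<le> real H" by (intro of_nat_mono div_times_less_eq_dividend)
    then show "real (H div D + 1) \<le> real H / real D + 1"
      using assms(2) by (simp add: field_simps)
  qed (rule assms(3))
  finally show ?thesis .
qed

lemma sum_reciprocals_le_harm:
  "(\<Sum>\<rho>\<in>{1..<D}. 1 / real \<rho> + 1 / real (D - \<rho>)) \<le> 2 * harm D"
proof -
  have 1: "(\<Sum>\<rho>\<in>{1..<D}. 1 / real \<rho>) \<le> harm D"
    unfolding harm_def by (auto simp: field_simps intro!: sum_mono2)
  have "(\<Sum>\<rho>\<in>{1..<D}. 1 / real (D - \<rho>)) = (\<Sum>\<rho>\<in>{1..<D}. 1 / real \<rho>)"
    by (rule sum.reindex_bij_witness[of _ "\<lambda>\<rho>. D - \<rho>" "\<lambda>\<rho>. D - \<rho>"]) auto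
  then show ?thesis using 1 by (simp add: sum.distrib)
qed

lemma harm_mono: "m \<le> n \<Longrightarrow> harm m \<le> (harm n :: real)"
  unfolding harm_def by (intro sum_mono2) auto

lemma harm_ge_1: "n > 0 \<Longrightarrow> harm n \<ge> (1::real)"
  using harm_mono[of 1 n] by (simp add: harm_def)

text \<open>Weyl differencing. As \<open>gcd (2 * j) Q \<le> 2 * min j (Q - j)\<close>, the fraction \<open>2 j c / Q\<close> has reduced
  denominator at least \<open>Q / (2 * min j (Q - j))\<close>; this is what replaces a divisor bound.\<close>

lemma quadratic_sum_sq_le:
  fixes Q c j X H :: nat
  assumes "coprime c Q" "0 < j" "j < Q" "H \<le> Q"
  shows "(norm (\<Sum>h<H. unit_exp (real (j * (c * (h\<^sup>2 + 2 * X * h))) / real Q)))\<^sup>2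
    \<le> 4 * (2 * real H * real (min j (Q - j)) / real Q + 1) * (real Q * harm Q)"
proof -
  define g where "g = gcd (2 * j) Q"
  have g0: "g > 0" using assms by (simp add: g_def)
  obtain j1 D where jD: "2 * j = g * j1" "Q = g * D" "coprime j1 D"
    using gcd_coprime_exists[of "2 * j" Q] g0 unfolding g_def by (metis mult.commute neq0_conv)
  have D0: "D > 0" using assms jD by (cases D) auto
  have DQ: "D \<le> Q" using jD(2) g0 by simp
  have g1: "g \<le> 2 * j" using assms(2) by (simp add: g_def gcd_le1_nat)
  have "g dvd 2 * Q - 2 * j" unfolding g_def by (intro dvd_diff_nat) auto
  then have g2: "g \<le> 2 * (Q - j)" using assms(3) by (intro dvd_imp_le) (auto simp: diff_mult_distrib2)
  have gmin: "g \<le> 2 * min j (Q - j)" using g1 g2 by simp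
  define a where "a = j1 * c"
  have cop: "coprime a D" using jD assms(1) unfolding a_def
    by (metis coprime_mult_left_iff coprime_mult_right_iff)
  \<comment> \<open>Bounds a linear sum whose slope is congruent to \<open>\<rho>\<close> /
    \<open>D\<close>: trivially by \<open>H\<close> at 0, by the geometric series elsewhere. Its
    total over the residues is of order Q log Q.\<close>
  define f :: "nat \<Rightarrow> real" where
    "f \<rho> = (if \<rho> = 0 then real H else real D / 2 * (1 / real \<rho> + 1 / real (D - \<rho>)))" for \<rho>
  define z where "z h = unit_exp (real (j * (c * (h\<^sup>2 + 2 * X * h))) / real Q)" for h
  have Q0: "real Q > 0" using assms by simp
  \<comment> \<open>Differencing by \<open>d\<close> leaves slope 2 j c d / Q; after cancelling
    \<open>g\<close> it is a d / D with \<open>a\<close> coprime to \<open>D\<close>, so the slopes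
    run evenly through the residues modulo \<open>D\<close>.\<close>
  have inner: "norm (\<Sum>h<H-d. z (h + d) * cnj (z h)) \<le> f ((a * d) mod D)" for d
  proof -
    have "z (h + d) * cnj (z h) = unit_exp (real (j * c * (d\<^sup>2 + 2 * X * d)) / real Q)
        * unit_exp (real (a * d) / real D * real h)" for h
    proof -
      have "real (a * d) / real D = real (2 * j * c * d) / real Q"
        using g0 unfolding jD(1,2) a_def by (simp add: field_simps)
      moreover have "real (j * (c * ((h + d)\<^sup>2 + 2 * X * (h + d)))) / real Q - real (j * (c * (h\<^sup>2 + 2
          * X * h))) / real Q
        = real (j * c * (d\<^sup>2 + 2 * X * d)) / real Q + real (2 * j * c * d) / real Q * real h"
        by (simp add: power2_eq_square diff_divide_distrib[symmetric] add_divide_distrib[symmetric] algebra_simps)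
      ultimately show ?thesis
        unfolding z_def cnj_unit_exp unit_exp_add[symmetric] by simp
    qed
    then have "norm (\<Sum>h<H-d. z (h + d) * cnj (z h)) = norm (\<Sum>h<H-d. unit_exp (real (a * d) / real D
        * real h))"
      by (simp add: sum_distrib_left[symmetric] norm_mult)
    also have "\<dots> \<le> f ((a * d) mod D)"
    proof (cases "(a * d) mod D = 0")
      case True
      then show ?thesis using norm_sum_unit_exp_le_card[of "\<lambda>h. real (a * d) / real D * real h" "H - d"]
        by (simp add: f_def)
    next
      case False
      then show ?thesis using norm_sum_unit_exp_frac_le[OF D0 False, of "H - d"] by (simp add: f_def)
    qed
    finally show ?thesis .
  qed
  have "(\<Sum>\<rho><D. f \<rho>) = f 0 + (\<Sum>\<rho>\<in>{1..<D}. f \<rho>)"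
    using D0 by (simp add: lessThan_atLeast0 sum.atLeast_Suc_lessThan)
  also have "(\<Sum>\<rho>\<in>{1..<D}. f \<rho>) = real D / 2 * (\<Sum>\<rho>\<in>{1..<D}. 1 / real \<rho> + 1 / real (D - \<rho>))"
    unfolding sum_distrib_left by (rule sum.cong) (auto simp: f_def)
  also have "\<dots> \<le> real D / 2 * (2 * harm D)"
    by (intro mult_left_mono sum_reciprocals_le_harm) simp
  also have "f 0 + real D / 2 * (2 * harm D) \<le> real Q * harm Q + real Q * harm Q"
  proof -
    have "real H \<le> real Q * harm Q"
      using assms(4) harm_ge_1[of Q] assms mult_mono[of "real H" "real Q" 1 "harm Q"] by simp
    moreover have "real D * harm D \<le> real Q * harm Q"
      using DQ by (intro mult_mono harm_mono) (auto simp: harm_nonneg)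
    moreover have "f 0 + real D / 2 * (2 * harm D) = real H + real D * harm D" by (simp add: f_def)
    ultimately show ?thesis by linarith
  qed
  finally have sumf: "(\<Sum>\<rho><D. f \<rho>) \<le> 2 * (real Q * harm Q)" by linarith
  have "(norm (\<Sum>h<H. z h))\<^sup>2 \<le> 2 * (\<Sum>d<H. norm (\<Sum>h<H-d. z (h + d) * cnj (z h)))"
    by (rule norm_sum_sq_le)
  also have "\<dots> \<le> 2 * (\<Sum>d<H. f ((a * d) mod D))"
    by (intro mult_left_mono sum_mono inner) simp
  also have "\<dots> \<le> 2 * ((real H / real D + 1) * (\<Sum>\<rho><D. f \<rho>))"
    by (intro mult_left_mono sum_mult_mod_le[OF cop D0]) (auto simp: f_def)
  also have "\<dots> \<le> 2 * ((real H * (2 * real (min j (Q - j))) / real Q + 1) * (2 * (real Q * harm Q)))"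
  proof -
    have "real H / real D = real H * real g / real Q"
      using g0 jD(2) by simp
    also have "\<dots> \<le> real H * (2 * real (min j (Q - j))) / real Q"
    proof (intro divide_right_mono mult_left_mono)
      have "real g \<le> real (2 * min j (Q - j))" using gmin by (simp only: of_nat_le_iff)
      then show "real g \<le> 2 * real (min j (Q - j))" by simp
    qed simp_all
    finally show ?thesis
      by (intro mult_left_mono mult_mono sumf add_right_mono) (auto intro!: sum_nonneg simp: f_def)
  qed
  also have "\<dots> = 4 * (2 * real H * real (min j (Q - j)) / real Q + 1) * (real Q * harm Q)"
  proof -
    have "2 * ((u * (2 * v) / q + 1) * (2 * w)) = 4 * (2 * u * v / q + 1) * w" for u v q w :: real
      by (simp add: algebra_simps)
    then show ?thesis .
  qed
  finally show ?thesis unfolding z_def .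
qed

text \<open>The Weyl bound for frequency j has a part proportional to \<open>\<mu>\<close> = min j
  (Q - j) and a constant part. The linear sum is at most \<open>M\<close> and at most
  \<open>Q / (2 * \<mu>)\<close>. Against the first part the second bound is used twice, against the
  constant part each bound once. Either way 1 / \<open>\<mu>\<close> remains, and summing it over j
  costs one more factor \<open>harm Q\<close>.\<close>

lemma sum_quadratic_linear_le:
  fixes Q c X H M :: nat
  assumes "coprime c Q" "H \<le> Q" "Q > 0"
  shows "(\<Sum>j\<in>{1..<Q}. (norm ((\<Sum>h<H. unit_exp (real (j * (c * (h\<^sup>2 + 2 * X * h))) / real Q))
        * (\<Sum>m<M. unit_exp (real (j * m) / real Q))))\<^sup>2)
    \<le> 4 * real Q ^ 2 * (harm Q)\<^sup>2 * (real H + real M)"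
proof -
  have term_le: "(norm ((\<Sum>h<H. unit_exp (real (j * (c * (h\<^sup>2 + 2 * X * h))) / real Q))
        * (\<Sum>m<M. unit_exp (real (j * m) / real Q))))\<^sup>2
      \<le> 2 * real Q ^ 2 * harm Q * (real H + real M) * (1 / real j + 1 / real (Q - j))"
    if j: "j \<in> {1..<Q}" for j
  proof -
    define \<mu> where "\<mu> = real (min j (Q - j))"
    have \<mu>: "\<mu> > 0" using j by (auto simp: \<mu>_def)
    define Dj where "Dj = norm (\<Sum>m<M. unit_exp (real (j * m) / real Q))"
    have D1: "Dj \<le> real M" unfolding Dj_def by (rule norm_sum_unit_exp_le_card)
    have D2: "Dj \<le> real Q / (2 * \<mu>)"
    proof -
      define t where "t = real j / real Q"
      have "0 < t" "t < 1" using j by (auto simp: t_def)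
      from norm_sum_unit_exp_le[OF this, of M] have "Dj \<le> 1 / (2 * min t (1 - t))"
        by (simp add: Dj_def t_def)
      also have "min t (1 - t) = \<mu> / real Q"
        using j by (auto simp: t_def \<mu>_def min_def field_simps of_nat_diff)
      finally show ?thesis by simp
    qed
    have D0: "Dj \<ge> 0" by (simp add: Dj_def)
    have "(norm ((\<Sum>h<H. unit_exp (real (j * (c * (h\<^sup>2 + 2 * X * h))) / real Q))
        * (\<Sum>m<M. unit_exp (real (j * m) / real Q))))\<^sup>2
       = (norm (\<Sum>h<H. unit_exp (real (j * (c * (h\<^sup>2 + 2 * X * h))) / real Q)))\<^sup>2 * Dj\<^sup>2"
      by (simp add: norm_mult power_mult_distrib Dj_def)
    also have "\<dots> \<le> (4 * (2 * real H * \<mu> / real Q + 1) * (real Q * harm Q)) * Dj\<^sup>2"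
      unfolding \<mu>_def using j by (intro mult_right_mono quadratic_sum_sq_le assms) auto
    also have "\<dots> = 4 * real Q * harm Q * (2 * real H * \<mu> / real Q * Dj\<^sup>2 + Dj\<^sup>2)"
      by (simp add: algebra_simps)
    also have "\<dots> \<le> 4 * real Q * harm Q * (2 * real H * \<mu> / real Q * (real Q / (2 * \<mu>))\<^sup>2 + real M
        * (real Q / (2 * \<mu>)))"
    proof -
      have "Dj\<^sup>2 \<le> (real Q / (2 * \<mu>))\<^sup>2" by (rule power_mono[OF D2 D0])
      moreover have "Dj\<^sup>2 \<le> real M * (real Q / (2 * \<mu>))"
        unfolding power2_eq_square by (intro mult_mono D1 D2 D0) simp
      ultimately show ?thesis using \<mu>
        by (intro mult_left_mono add_mono) (auto simp: harm_nonneg)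
    qed
    also have "\<dots> = 2 * real Q ^ 2 * harm Q * (real H + real M) * (1 / \<mu>)"
      using \<mu> assms(3) by (simp add: field_simps power2_eq_square)
    also have "\<dots> \<le> 2 * real Q ^ 2 * harm Q * (real H + real M) * (1 / real j + 1 / real (Q - j))"
      using j by (intro mult_left_mono) (auto simp: \<mu>_def min_def harm_nonneg)
    finally show ?thesis .
  qed
  have "(\<Sum>j\<in>{1..<Q}. (norm ((\<Sum>h<H. unit_exp (real (j * (c * (h\<^sup>2 + 2 * X * h))) / real Q))
        * (\<Sum>m<M. unit_exp (real (j * m) / real Q))))\<^sup>2)
      \<le> (\<Sum>j\<in>{1..<Q}. 2 * real Q ^ 2 * harm Q * (real H + real M) * (1 / real j + 1 / real (Q - j)))"
    by (intro sum_mono term_le)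
  also have "\<dots> \<le> 2 * real Q ^ 2 * harm Q * (real H + real M) * (2 * harm Q)"
    unfolding sum_distrib_left[symmetric]
    by (intro mult_left_mono sum_reciprocals_le_harm) (auto simp: harm_nonneg)
  finally show ?thesis by (simp add: power2_eq_square algebra_simps)
qed

section \<open>Fourier analysis on the residues modulo Q\<close>

lemma sum_unit_exp_orthogonal:
  fixes t :: int
  assumes "Q > 0"
  shows "(\<Sum>j<Q. unit_exp (real j * of_int t / real Q)) = (if int Q dvd t then of_nat Q else 0)"
proof (cases "int Q dvd t")
  case True
  then obtain s where s: "t = int Q * s" by auto
  have "unit_exp (real j * of_int t / real Q) = 1" for j
    by (rule unit_exp_int) (use assms s in simp)
  then show ?thesis using True by simp
next
  case False
  define x where "x = unit_exp (of_int t / real Q)"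
  have "x ^ Q = unit_exp (of_int t / real Q * real Q)" unfolding x_def by (rule unit_exp_mult_nat[symmetric])
  also have "\<dots> = 1" using assms by (intro unit_exp_int) simp
  finally have "(1 - x) * (\<Sum>j<Q. x ^ j) = 0" by (simp add: one_diff_power_eq[symmetric])
  moreover have "x \<noteq> 1"
  proof
    assume "x = 1"
    then have "sin (pi * (of_int t / real Q)) = 0"
      using norm_one_minus_unit_exp[of "of_int t / real Q"] by (simp add: x_def)
    then obtain i :: int where "pi * (of_int t / real Q) = of_int i * pi" by (auto simp: sin_zero_iff_int2)
    then have "of_int t = of_int i * real Q" using assms by (simp add: field_simps)
    then have "t = i * int Q" by (metis of_int_eq_iff of_int_mult of_int_of_nat_eq)
    then show False using False by simp
  qed
  moreover have "unit_exp (real j * of_int t / real Q) = x ^ j" for j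
    using unit_exp_mult_nat[of "of_int t / real Q" j] by (simp add: x_def mult.commute)
  ultimately show ?thesis using False by simp
qed

text \<open>A general index set \<open>J\<close> makes it possible to leave out frequency 0, which
  carries the mean.\<close>

lemma parseval_finite:
  assumes "Q > 0" "J \<subseteq> {..<Q}"
  shows "(\<Sum>b<Q. (norm (\<Sum>j\<in>J. a j * unit_exp (- (real j * real b / real Q))))\<^sup>2) = real Q *
      (\<Sum>j\<in>J. (norm (a j))\<^sup>2)"
proof -
  have fin: "finite J" using assms(2) finite_subset by blast
  have "complex_of_real (\<Sum>b<Q. (norm (\<Sum>j\<in>J. a j * unit_exp (- (real j * real b / real Q))))\<^sup>2)
    = (\<Sum>b<Q. \<Sum>i\<in>J. \<Sum>j\<in>J. (a i * cnj (a j)) * unit_exp (real b * of_int (int j - int i) / real Q))"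
    unfolding of_real_sum
  proof (rule sum.cong[OF refl])
    fix b
    have "complex_of_real ((norm (\<Sum>j\<in>J. a j * unit_exp (- (real j * real b / real Q))))\<^sup>2)
      = (\<Sum>i\<in>J. a i * unit_exp (- (real i * real b / real Q))) * (\<Sum>j\<in>J. cnj (a j) * unit_exp (real j
          * real b / real Q))"
      by (simp add: complex_norm_square cnj_unit_exp del: of_real_power)
    also have "\<dots> = (\<Sum>i\<in>J. \<Sum>j\<in>J. (a i * cnj (a j)) * unit_exp (real b * of_int (int j - int i) / real Q))"
      unfolding sum_product
    proof (intro sum.cong refl)
      fix i j
      have "unit_exp (real b * of_int (int j - int i) / real Q) = unit_exp (- (real i * real b / real Q))
          * unit_exp (real j * real b / real Q)"
        unfolding unit_exp_add[symmetric] by (rule arg_cong[of _ _ unit_exp])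
            (simp add: diff_divide_distrib algebra_simps)
      then show "a i * unit_exp (- (real i * real b / real Q)) * (cnj (a j) * unit_exp (real j
          * real b / real Q))
        = (a i * cnj (a j)) * unit_exp (real b * of_int (int j - int i) / real Q)" by simp
    qed
    finally show "complex_of_real ((norm (\<Sum>j\<in>J. a j * unit_exp (- (real j * real b / real Q))))\<^sup>2)
      = (\<Sum>i\<in>J. \<Sum>j\<in>J. (a i * cnj (a j)) * unit_exp (real b * of_int (int j - int i) / real Q))" .
  qed
  also have "\<dots> = (\<Sum>i\<in>J. \<Sum>j\<in>J. (a i * cnj (a j)) * (\<Sum>b<Q. unit_exp (real b * of_int (int j
      - int i) / real Q)))"
    by (subst sum.swap, rule sum.cong[OF refl], subst sum.swap) (simp add: sum_distrib_left)
  also have "\<dots> = (\<Sum>i\<in>J. \<Sum>j\<in>J. (a i * cnj (a j)) * (if j = i then of_nat Q else 0))"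
  proof (intro sum.cong refl)
    fix i j assume ij: "i \<in> J" "j \<in> J"
    have "int Q dvd int j - int i \<longleftrightarrow> j = i"
    proof
      assume d: "int Q dvd int j - int i"
      have "i < Q" "j < Q" using ij assms(2) by auto
      then have "\<bar>int j - int i\<bar> < int Q" by linarith
      then show "j = i" using d zdvd_imp_le[of "int Q" "\<bar>int j - int i\<bar>"] by auto
    qed simp
    then show "a i * cnj (a j) * (\<Sum>b<Q. unit_exp (real b * of_int (int j - int i) / real Q))
        = a i * cnj (a j) * (if j = i then of_nat Q else 0)"
      unfolding sum_unit_exp_orthogonal[OF assms(1)] by simp
  qed
  also have "\<dots> = complex_of_real (real Q * (\<Sum>j\<in>J. (norm (a j))\<^sup>2))"
    using fin by (simp add: sum_distrib_left complex_norm_square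
        if_distrib mult.commute del: of_real_power cong: if_cong)
  finally show ?thesis by (simp only: of_real_eq_iff)
qed

text \<open>The double sum pairs \<open>G b\<close> with the number \<open>W b\<close> of
  representations of the residue b. Frequency 0 of \<open>W\<close> is its mean
  \<open>H * M / Q\<close>; the other frequencies form \<open>R\<close>. Cauchy-Schwarz against the
  bounded \<open>G\<close> costs a factor sqrt Q, which Parseval gives back.\<close>

lemma residue_sum_deviation:
  fixes G :: "nat \<Rightarrow> complex" and v :: "nat \<Rightarrow> nat"
  assumes Q: "Q > 0" and G: "\<And>b. norm (G b) \<le> 1"
  shows "norm ((\<Sum>h<H. \<Sum>m<M. G ((v h + m) mod Q)) - of_nat (H * M) / of_nat Q * (\<Sum>b<Q. G b))
    \<le> sqrt (\<Sum>j\<in>{1..<Q}. (norm ((\<Sum>h<H. unit_exp (real (j * v h) / real Q)) * (\<Sum>m<M. unit_exp (real (j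
        * m) / real Q))))\<^sup>2)"
proof -
  define a where "a j = (\<Sum>h<H. unit_exp (real (j * v h) / real Q)) * (\<Sum>m<M. unit_exp (real (j
      * m) / real Q))" for j
  define W :: "nat \<Rightarrow> complex" where "W b = (\<Sum>h<H. \<Sum>m<M. if (v h + m) mod Q = b then 1 else 0)" for b
  define R where "R b = (\<Sum>j\<in>{1..<Q}. a j * unit_exp (- (real j * real b / real Q))) / of_nat Q" for b
  have "(\<Sum>h<H. \<Sum>m<M. G ((v h + m) mod Q)) = (\<Sum>h<H. \<Sum>m<M. \<Sum>b<Q. G b * (if (v h + m) mod Q = b then 1 else 0))"
    by (intro sum.cong refl) (use Q in \<open>simp add: if_distrib cong: if_cong\<close>)
  also have "\<dots> = (\<Sum>h<H. \<Sum>b<Q. \<Sum>m<M. G b * (if (v h + m) mod Q = b then 1 else 0))"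
    by (intro sum.cong refl sum.swap)
  also have "\<dots> = (\<Sum>b<Q. G b * W b)"
    by (subst sum.swap) (simp add: W_def sum_distrib_left)
  finally have A: "(\<Sum>h<H. \<Sum>m<M. G ((v h + m) mod Q)) = (\<Sum>b<Q. G b * W b)" .
  have W: "W b = of_nat (H * M) / of_nat Q + R b" if b: "b < Q" for b
  proof -
    have "of_nat Q * W b = (\<Sum>h<H. \<Sum>m<M. \<Sum>j<Q. unit_exp (real j * of_int (int (v h + m) - int b) / real Q))"
      unfolding W_def sum_distrib_left
    proof (intro sum.cong refl)
      fix h m
      have "int Q dvd int (v h + m) - int b \<longleftrightarrow> (v h + m) mod Q = b"
        using b by (metis mod_eq_dvd_iff mod_less of_nat_eq_iff zmod_int)
      then show "of_nat Q * (if (v h + m) mod Q = b then 1 else 0)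
        = (\<Sum>j<Q. unit_exp (real j * of_int (int (v h + m) - int b) / real Q))"
        unfolding sum_unit_exp_orthogonal[OF Q] by simp
    qed
    also have "\<dots> = (\<Sum>h<H. \<Sum>j<Q. \<Sum>m<M. unit_exp (real j * of_int (int (v h + m) - int b) / real Q))"
      by (intro sum.cong refl sum.swap)
    also have "\<dots> = (\<Sum>j<Q. \<Sum>h<H. \<Sum>m<M. unit_exp (real j * of_int (int (v h + m) - int b) / real Q))"
      by (rule sum.swap)
    also have "\<dots> = (\<Sum>j<Q. a j * unit_exp (- (real j * real b / real Q)))"
    proof (rule sum.cong[OF refl])
      fix j
      have "unit_exp (real j * of_int (int (v h + m) - int b) / real Q)
        = unit_exp (real (j * v h) / real Q) * unit_exp (real (j * m) / real Q) * unit_exp (- (real j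
            * real b / real Q))" for h m
        unfolding unit_exp_add[symmetric] by (rule arg_cong[of _ _ unit_exp])
            (simp add: diff_divide_distrib add_divide_distrib algebra_simps)
      then show "(\<Sum>h<H. \<Sum>m<M. unit_exp (real j * of_int (int (v h + m) - int b) / real Q)) = a j
          * unit_exp (- (real j * real b / real Q))"
        by (simp only: a_def sum_product) (simp only: sum_distrib_right)
    qed
    also have "\<dots> = a 0 + of_nat Q * R b"
      using Q by (simp add: R_def lessThan_atLeast0 sum.atLeast_Suc_lessThan)
    also have "a 0 = of_nat (H * M)" by (simp add: a_def)
    finally show ?thesis using Q by (simp add: field_simps)
  qed
  have "(\<Sum>b<Q. G b * W b) = (\<Sum>b<Q. of_nat (H * M) / of_nat Q * G b + G b * R b)"
    by (rule sum.cong[OF refl]) (simp only: W lessThan_iff distrib_left mult.commute)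
  then have "(\<Sum>b<Q. G b * W b) - of_nat (H * M) / of_nat Q * (\<Sum>b<Q. G b) = (\<Sum>b<Q. G b * R b)"
    by (simp only: sum.distrib sum_distrib_left add_diff_cancel_left')
  also have "norm \<dots> \<le> (\<Sum>b<Q. 1 * norm (R b))"
    by (rule order_trans[OF norm_sum]) (unfold norm_mult, intro sum_mono mult_right_mono G norm_ge_zero)
  also have "\<dots> \<le> sqrt (real Q * (\<Sum>b<Q. (norm (R b))\<^sup>2))"
  proof (rule real_le_rsqrt)
    show "(\<Sum>b<Q. 1 * norm (R b))\<^sup>2 \<le> real Q * (\<Sum>b<Q. (norm (R b))\<^sup>2)"
      using Cauchy_Schwarz_ineq_sum[of "\<lambda>_. 1" "\<lambda>b. norm (R b)" "{..<Q}"] by simp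
  qed
  also have "real Q * (\<Sum>b<Q. (norm (R b))\<^sup>2)
      = (\<Sum>b<Q. (norm (\<Sum>j\<in>{1..<Q}. a j * unit_exp (- (real j * real b / real Q))))\<^sup>2) / real Q"
  proof -
    have "(norm (R b))\<^sup>2 = (norm (\<Sum>j\<in>{1..<Q}. a j * unit_exp (- (real j
        * real b / real Q))))\<^sup>2 / (real Q)\<^sup>2" for b
      by (simp add: R_def norm_divide power_divide)
    then show ?thesis
      using Q by (simp add: sum_divide_distrib[symmetric] power2_eq_square)
  qed
  also have "\<dots> = (\<Sum>j\<in>{1..<Q}. (norm (a j))\<^sup>2)"
    using Q by (subst parseval_finite) auto
  finally show ?thesis unfolding A a_def .
qed

section \<open>Uniform decay of averages of unimodular cocycles\<close>

lemma norm_geometric_sum_le: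
  fixes z :: complex
  assumes "norm z = 1" "z \<noteq> 1"
  shows "norm (\<Sum>r<R. z ^ r) \<le> 2 / norm (1 - z)"
proof -
  have "norm (1 - z) * norm (\<Sum>r<R. z ^ r) = norm (1 - z ^ R)"
    unfolding norm_mult[symmetric] by (simp add: one_diff_power_eq)
  also have "\<dots> \<le> 2"
    using norm_triangle_ineq4[of 1 "z ^ R"] assms by (simp add: norm_power)
  finally show ?thesis using assms(2) by (simp add: field_simps)
qed

lemma circle_char_circle_of_mult: "circle_char j (circle_of (real r * \<alpha>)) = circle_char j (circle_of \<alpha>) ^ r"
  by (simp add: circle_char_circle_of Complex.DeMoivre mult_ac)

lemma trig_poly_rotation_uniform_limit:
  assumes irr: "\<alpha> \<notin> \<rat>" and p: "p \<in> trig_poly"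
  shows "uniform_limit UNIV (\<lambda>R x. (\<Sum>r<R. p (x + circle_of (real r * \<alpha>), 0)) / real R)
    (\<lambda>_. LINT x|circle_lebesgue. p (x, 0)) sequentially"
  using p
proof induction
  case (monom c j k)
  have int: "(LINT x|circle_lebesgue. Re (c * circle_char j (fst (x, 0::circle))
      * circle_char k (snd (x, 0::circle))))
    = Re (c * (if j = 0 then 1 else 0))"
    using integrable_circle_char[OF finite_measure_circle_lebesgue, of j] by (simp add: integral_circle_char)
  show ?case
  proof (cases "j = 0")
    case True
    have "\<forall>\<^sub>F R in sequentially. \<forall>x\<in>UNIV. (\<Sum>r<R. Re (c * circle_char j (fst (x + circle_of (real r
        * \<alpha>), 0::circle))
        * circle_char k (snd (x + circle_of (real r * \<alpha>), 0::circle)))) / real R = Re c"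
      using eventually_gt_at_top[of 0] by eventually_elim (simp add: True)
    then show ?thesis unfolding int using True
      by (subst uniform_limit_cong[where g = "\<lambda>_ _. Re c" and i
          = "\<lambda>_. Re c"]) (auto intro: uniform_limit_const)
  next
    case False
    define z where "z = circle_char j (circle_of \<alpha>)"
    have z: "norm z = 1" "z \<noteq> 1" using circle_char_irrational_neq_1[OF irr False] by (auto simp: z_def)
    define B where "B = norm c * (2 / norm (1 - z))"
    have bound: "norm ((\<Sum>r<R. Re (c * circle_char j (x + circle_of (real r * \<alpha>)))) / real R)
        \<le> B / real R" for R x
    proof -
      have "(\<Sum>r<R. Re (c * circle_char j (x + circle_of (real r * \<alpha>)))) = Re (c * circle_char j x *
          (\<Sum>r<R. z ^ r))"
        by (simp add: circle_char_add circle_char_circle_of_mult z_def sum_distrib_left mult.assoc)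
      then have "\<bar>\<Sum>r<R. Re (c * circle_char j (x + circle_of (real r * \<alpha>)))\<bar> \<le> norm (c * circle_char j x
          * (\<Sum>r<R. z ^ r))"
        by (simp only: abs_Re_le_cmod)
      also have "\<dots> \<le> B"
        unfolding B_def norm_mult norm_circle_char mult_1_right
            by (intro mult_left_mono norm_geometric_sum_le z norm_ge_zero)
      finally show ?thesis by (simp add: divide_right_mono)
    qed
    have "uniform_limit UNIV (\<lambda>R x. (\<Sum>r<R. Re (c * circle_char j (x + circle_of (real r
        * \<alpha>)))) / real R) (\<lambda>_. 0) sequentially"
    proof (rule uniform_limitI)
      fix e :: real assume "e > 0"
      have "(\<lambda>R. B / real R) \<longlonglongrightarrow> 0" by (rule lim_const_over_n)
      then have "\<forall>\<^sub>F R in sequentially. B / real R < e" using \<open>e > 0\<close> by (rule order_tendstoD(2))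
      then show "\<forall>\<^sub>F R in sequentially. \<forall>x\<in>UNIV. dist ((\<Sum>r<R. Re (c * circle_char j (x
          + circle_of (real r * \<alpha>)))) / real R) 0 < e"
        by eventually_elim (use bound in \<open>auto simp: dist_norm intro: le_less_trans\<close>)
    qed
    then show ?thesis unfolding int using False by simp
  qed
next
  case (add p q)
  have int: "integrable circle_lebesgue (\<lambda>x. f (x, 0))" if "f \<in> trig_poly" for f
    by (rule integrable_circle_continuous[OF finite_measure_circle_lebesgue])
       (auto intro!: continuous_on_compose2[OF continuous_on_trig_poly[OF that, of UNIV]] continuous_intros)
  show ?case
    using uniform_limit_add[OF add.IH] int[OF add.hyps(1)] int[OF add.hyps(2)]
    by (simp add: sum.distrib add_divide_distrib)
qed

text \<open>The uniformity in \<open>x\<close> is the point: in \<open>avg_uniform_limit\<close> it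
  turns smallness in mean into smallness at every starting point.\<close>

lemma rotation_uniform_limit:
  fixes h :: "circle \<Rightarrow> real"
  assumes irr: "\<alpha> \<notin> \<rat>" and h: "continuous_on UNIV h"
  shows "uniform_limit UNIV (\<lambda>R x. (\<Sum>r<R. h (x + circle_of (real r * \<alpha>))) / real R)
    (\<lambda>_. LINT x|circle_lebesgue. h x) sequentially"
proof (rule uniform_limitI)
  fix e :: real assume "e > 0"
  then have e3: "e / 3 > 0" by simp
  have "continuous_on UNIV (\<lambda>z::circle \<times> circle. h (fst z))"
    by (rule continuous_on_compose2[OF h]) (auto intro!: continuous_intros)
  then obtain p where p: "p \<in> trig_poly" "\<And>z::circle \<times> circle. \<bar>h (fst z) - p z\<bar> < e / 3"
    using trig_poly_dense[OF _ e3] by metis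
  have pd: "\<bar>h x - p (x, 0)\<bar> < e / 3" for x using p(2)[of "(x, 0)"] by simp
  have ih: "integrable circle_lebesgue h"
    by (rule integrable_circle_continuous[OF finite_measure_circle_lebesgue _ h]) simp
  have ip: "integrable circle_lebesgue (\<lambda>x. p (x, 0))"
    by (rule integrable_circle_continuous[OF finite_measure_circle_lebesgue])
       (auto intro!: continuous_on_compose2[OF continuous_on_trig_poly[OF p(1), of UNIV]] continuous_intros)
  have "\<bar>(LINT x|circle_lebesgue. h x) - (LINT x|circle_lebesgue. p (x, 0))\<bar>
      = \<bar>LINT x|circle_lebesgue. h x - p (x, 0)\<bar>"
    using ih ip by simp
  also have "\<dots> \<le> (LINT x|circle_lebesgue. \<bar>h x - p (x, 0)\<bar>)" by (rule integral_abs_bound)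
  also have "\<dots> \<le> (LINT x|circle_lebesgue. e / 3)"
    by (rule integral_mono) (use ih ip less_imp_le[OF pd] in auto)
  finally have I: "\<bar>(LINT x|circle_lebesgue. h x) - (LINT x|circle_lebesgue. p (x, 0))\<bar> \<le> e / 3" by simp
  have A: "\<bar>(\<Sum>r<R. h (x + circle_of (real r * \<alpha>))) / real R - (\<Sum>r<R. p (x + circle_of (real r
      * \<alpha>), 0)) / real R\<bar> \<le> e / 3"
    for R x
  proof -
    have "\<bar>(\<Sum>r<R. h (x + circle_of (real r * \<alpha>))) - (\<Sum>r<R. p (x + circle_of (real r * \<alpha>), 0))\<bar> \<le> real R
        * (e / 3)"
      unfolding sum_subtractf[symmetric]
      using sum_norm_le[of "{..<R}" "\<lambda>r. h (x + circle_of (real r * \<alpha>)) - p (x + circle_of (real r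
          * \<alpha>), 0)" "\<lambda>_. e / 3"]
        less_imp_le[OF pd] by simp
    then show ?thesis using \<open>e > 0\<close> by (cases "R = 0")
        (simp_all add: diff_divide_distrib[symmetric] field_simps)
  qed
  have "\<forall>\<^sub>F R in sequentially. \<forall>x\<in>UNIV. dist ((\<Sum>r<R. p (x + circle_of (real r * \<alpha>), 0)) / real R)
      (LINT x|circle_lebesgue. p (x, 0)) < e / 3"
    by (rule uniform_limitD[OF trig_poly_rotation_uniform_limit[OF irr p(1)] e3])
  then show "\<forall>\<^sub>F R in sequentially. \<forall>x\<in>UNIV. dist ((\<Sum>r<R. h (x + circle_of (real r * \<alpha>))) / real R)
      (LINT x|circle_lebesgue. h x) < e"
  proof eventually_elim
    case (elim R)
    show ?case
    proof
      fix x
      show "dist ((\<Sum>r<R. h (x + circle_of (real r * \<alpha>))) / real R) (LINT x|circle_lebesgue. h x) < e"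
        using bspec[OF elim UNIV_I, of x] A[of x R] I unfolding dist_real_def by linarith
    qed
  qed
qed

section \<open>Mean-square averages of a unimodular cocycle\<close>

definition energy :: "(circle \<Rightarrow> complex) \<Rightarrow> real"
  where "energy f = (LINT x|circle_lebesgue. (norm (f x))\<^sup>2)"

lemma integrable_norm_sq:
  fixes f :: "circle \<Rightarrow> complex"
  assumes "continuous_on UNIV f" shows "integrable circle_lebesgue (\<lambda>x. (norm (f x))\<^sup>2)"
  by (rule integrable_circle_continuous[OF finite_measure_circle_lebesgue])
     (auto intro!: continuous_intros assms)

lemma energy_nonneg: "energy f \<ge> 0"
  unfolding energy_def by (rule Bochner_Integration.integral_nonneg) simp

lemma energy_perturb:
  assumes "continuous_on UNIV f" "continuous_on UNIV g"
    and "\<And>x. norm (f x - g x) \<le> e" "\<And>x. norm (f x) \<le> B" "\<And>x. norm (g x) \<le> B"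
  shows "energy f \<le> energy g + 2 * B * e"
proof -
  have pt: "(norm (f x))\<^sup>2 \<le> (norm (g x))\<^sup>2 + 2 * B * e" for x
  proof -
    have "(norm (f x))\<^sup>2 - (norm (g x))\<^sup>2 = (norm (f x) - norm (g x)) * (norm (f x) + norm (g x))"
      by (simp add: power2_eq_square algebra_simps)
    also have "\<dots> \<le> e * (2 * B)"
    proof (rule order_trans[OF mult_right_mono mult_left_mono])
      show "norm (f x) - norm (g x) \<le> e" using norm_triangle_ineq2[of "f x" "g x"] assms(3)[of x] by linarith
      show "norm (f x) + norm (g x) \<le> 2 * B" using assms(4,5)[of x] by linarith
      show "0 \<le> e" using assms(3)[of x] norm_ge_zero order_trans by blast
    qed simp
    finally show ?thesis by (simp add: algebra_simps)
  qed
  have "energy f \<le> (LINT x|circle_lebesgue. (norm (g x))\<^sup>2 + 2 * B * e)"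
    unfolding energy_def by (rule integral_mono) (use integrable_norm_sq assms pt in auto)
  also have "\<dots> = energy g + 2 * B * e"
    unfolding energy_def using integrable_norm_sq[OF assms(2)] by simp
  finally show ?thesis .
qed

lemma energy_parallelogram:
  assumes "continuous_on UNIV f" "continuous_on UNIV g"
  shows "energy (\<lambda>x. f x - g x) = 2 * energy f + 2 * energy g - energy (\<lambda>x. f x + g x)"
proof -
  have "(norm (a - b))\<^sup>2 = 2 * (norm a)\<^sup>2 + 2 * (norm b)\<^sup>2 - (norm (a + b))\<^sup>2" for a b :: complex
    unfolding cmod_power2 by (simp add: power2_eq_square algebra_simps)
  then have "energy (\<lambda>x. f x - g x)
      = (LINT x|circle_lebesgue. 2 * (norm (f x))\<^sup>2 + 2 * (norm (g x))\<^sup>2 - (norm (f x + g x))\<^sup>2)"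
    by (simp add: energy_def)
  also have "\<dots> = 2 * energy f + 2 * energy g - energy (\<lambda>x. f x + g x)"
    unfolding energy_def
    using integrable_norm_sq[OF assms(1)] integrable_norm_sq[OF assms(2)]
      integrable_norm_sq[OF continuous_on_add[OF assms]] by simp
  finally show ?thesis .
qed

text \<open>Each shift by one exchanges a single end term for another, both of norm at most
  1.\<close>

lemma norm_shifted_sum_diff_le:
  fixes c :: "nat \<Rightarrow> complex"
  assumes "\<And>r. norm (c r) \<le> 1"
  shows "norm ((\<Sum>r<R. c (r + k)) - (\<Sum>r<R. c r)) \<le> 2 * real k"
proof (induction k)
  case (Suc k)
  have "(\<Sum>r<R. c (r + Suc k)) - (\<Sum>r<R. c (r + k)) = c (R + k) - c k"
    using sum_lessThan_telescope[of "\<lambda>r. c (r + k)" R] by (simp add: sum_subtractf)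
  then have "(\<Sum>r<R. c (r + Suc k)) - (\<Sum>r<R. c r)
      = ((\<Sum>r<R. c (r + k)) - (\<Sum>r<R. c r)) + (c (R + k) - c k)"
    by (simp add: algebra_simps)
  also have "norm \<dots> \<le> norm ((\<Sum>r<R. c (r + k)) - (\<Sum>r<R. c r)) + (norm (c (R + k)) + norm (c k))"
    by (rule order_trans[OF norm_triangle_ineq add_left_mono[OF norm_triangle_ineq4]])
  finally show ?case using Suc assms[of "R + k"] assms[of k] by simp
qed simp

locale unimodular_cocycle =
  fixes \<alpha> :: real and u :: "circle \<Rightarrow> complex"
  assumes continuous_u: "continuous_on UNIV u" and norm_u [simp]: "norm (u x) = 1"
begin

definition rot :: "nat \<Rightarrow> circle \<Rightarrow> circle"
  where "rot r x = x + circle_of (real r * \<alpha>)"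

definition iter :: "nat \<Rightarrow> circle \<Rightarrow> complex"
  where "iter n x = (\<Prod>i<n. u (rot i x))"

definition avg :: "nat \<Rightarrow> circle \<Rightarrow> complex"
  where "avg n x = (\<Sum>b<n. iter b x) / of_nat n"

text \<open>Cesaro mean of the powers of the operator that rotates \<open>f\<close> and multiplies
  by \<open>u\<close>, an isometry in mean square; \<open>avg n\<close> is this mean applied to the
  constant 1.\<close>

definition wavg :: "nat \<Rightarrow> (circle \<Rightarrow> complex) \<Rightarrow> circle \<Rightarrow> complex"
  where "wavg n f x = (\<Sum>r<n. iter r x * f (rot r x)) / of_nat n"

lemma rot_0 [simp]: "rot 0 x = x"
  by (simp add: rot_def circle_of_0)

lemma rot_rot: "rot i (rot j x) = rot (i + j) x"
  by (simp add: rot_def circle_of_add distrib_right add_ac)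

lemma rot_1: "rot (Suc 0) x = x + circle_of \<alpha>"
  by (simp add: rot_def)

lemma continuous_on_rot: "continuous_on A (rot r)"
  unfolding rot_def[abs_def] by (intro continuous_intros)

lemma continuous_on_comp_rot:
  assumes "continuous_on UNIV f" shows "continuous_on A (\<lambda>x. f (rot r x))"
  by (rule continuous_on_compose2[OF assms continuous_on_rot]) simp

lemma continuous_on_iter: "continuous_on A (iter n)"
  unfolding iter_def[abs_def] by (intro continuous_intros continuous_on_comp_rot continuous_u)

lemma continuous_on_avg: "continuous_on A (avg n)"
  unfolding avg_def[abs_def] divide_inverse by (intro continuous_intros continuous_on_iter)

lemma continuous_on_wavg: "continuous_on UNIV f \<Longrightarrow> continuous_on A (wavg n f)"
  unfolding wavg_def[abs_def] divide_inverse
  by (intro continuous_intros continuous_on_iter continuous_on_comp_rot)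

lemma norm_iter [simp]: "norm (iter n x) = 1"
  by (simp add: iter_def prod_norm[symmetric])

lemma norm_avg_le: "norm (avg n x) \<le> 1"
proof -
  have "norm (\<Sum>b<n. iter b x) \<le> real n"
    using sum_norm_le[of "{..<n}" "\<lambda>b. iter b x" "\<lambda>_. 1"] by simp
  then show ?thesis by (cases "n = 0") (simp_all add: avg_def norm_divide)
qed

lemma norm_wavg_le:
  assumes "\<And>x. norm (f x) \<le> B"
  shows "norm (wavg n f x) \<le> B"
proof -
  have "norm (\<Sum>b<n. iter b x * f (rot b x)) \<le> real n * B"
    using sum_norm_le[of "{..<n}" "\<lambda>b. iter b x * f (rot b x)" "\<lambda>_. B"] assms by (simp add: norm_mult)
  moreover have "B \<ge> 0" using assms[of x] norm_ge_zero order_trans by blast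
  ultimately show ?thesis by (cases "n = 0") (simp_all add: wavg_def norm_divide field_simps)
qed

lemma iter_add: "iter (r + k) x = iter r x * iter k (rot r x)"
proof (induction k)
  case (Suc k)
  then show ?case by (simp add: iter_def rot_rot add.commute mult.assoc)
qed (simp add: iter_def)

text \<open>By the cocycle identity the double average consists of \<open>K\<close> copies of the
  sum of length \<open>R\<close>, each shifted by some k < K, and a shift by k changes a sum by at
  most 2 k. So a long average can be computed from any short one.\<close>

lemma wavg_avg_close:
  assumes "K > 0" "R > 0"
  shows "norm (wavg R (avg K) x - avg R x) \<le> 2 * real K / real R"
proof -
  have "wavg R (avg K) x = (\<Sum>r<R. \<Sum>k<K. iter (r + k) x) / (of_nat K * of_nat R)"
    by (simp add: wavg_def avg_def iter_add sum_distrib_left sum_divide_distrib)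
  also have "\<dots> = (\<Sum>k<K. \<Sum>r<R. iter (r + k) x) / (of_nat K * of_nat R)"
    by (subst sum.swap) simp
  finally have "wavg R (avg K) x - avg R x
      = (\<Sum>k<K. (\<Sum>r<R. iter (r + k) x) - (\<Sum>r<R. iter r x)) / (of_nat K * of_nat R)"
    using assms by (simp add: avg_def sum_subtractf diff_divide_distrib)
  also have "norm \<dots> \<le> (real K * (2 * real K)) / (real K * real R)"
  proof -
    have "norm (\<Sum>k<K. (\<Sum>r<R. iter (r + k) x) - (\<Sum>r<R. iter r x)) \<le> (\<Sum>k<K. 2 * real K)"
    proof (rule sum_norm_le)
      fix k assume "k \<in> {..<K}"
      then show "norm ((\<Sum>r<R. iter (r + k) x) - (\<Sum>r<R. iter r x)) \<le> 2 * real K"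
        using norm_shifted_sum_diff_le[of "\<lambda>r. iter r x" k R] by simp
    qed
    then have "norm (\<Sum>k<K. (\<Sum>r<R. iter (r + k) x) - (\<Sum>r<R. iter r x)) \<le> real K * (2 * real K)" by simp
    then show ?thesis unfolding norm_divide norm_mult norm_of_nat by (rule divide_right_mono) simp
  qed
  also have "\<dots> = 2 * real K / real R" using assms by simp
  finally show ?thesis .
qed

text \<open>Averages of powers of an isometry are contractions. Concretely: Cauchy-Schwarz at each
  point, after which translation invariance removes the rotations.\<close>

lemma energy_wavg_le:
  assumes f: "continuous_on UNIV f" and "R > 0"
  shows "energy (wavg R f) \<le> energy f"
proof -
  have pt: "(norm (wavg R f x))\<^sup>2 \<le> (\<Sum>r<R. (norm (f (rot r x)))\<^sup>2) / real R" for x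
  proof -
    have "norm (\<Sum>r<R. iter r x * f (rot r x)) \<le> (\<Sum>r<R. norm (f (rot r x)))"
      by (rule sum_norm_le) (simp add: norm_mult)
    then have "(norm (\<Sum>r<R. iter r x * f (rot r x)))\<^sup>2 \<le> (\<Sum>r<R. 1 * norm (f (rot r x)))\<^sup>2"
      by (simp add: power_mono)
    also have "\<dots> \<le> real R * (\<Sum>r<R. (norm (f (rot r x)))\<^sup>2)"
      using Cauchy_Schwarz_ineq_sum[of "\<lambda>_. 1" "\<lambda>r. norm (f (rot r x))" "{..<R}"] by simp
    finally show ?thesis using \<open>R > 0\<close>
      by (simp add: wavg_def norm_divide power_divide divide_le_eq power2_eq_square mult.commute)
  qed
  have i: "integrable circle_lebesgue (\<lambda>x. (norm (f (rot r x)))\<^sup>2)" for r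
    by (rule integrable_norm_sq[OF continuous_on_comp_rot[OF f]])
  have e: "(LINT x|circle_lebesgue. (norm (f (rot r x)))\<^sup>2) = energy f" for r
    unfolding rot_def energy_def
    by (rule integral_circle_translation)
       (auto intro!: borel_measurable_continuous_onI continuous_intros f)
  have "energy (wavg R f) \<le> (LINT x|circle_lebesgue. (\<Sum>r<R. (norm (f (rot r x)))\<^sup>2) / real R)"
    unfolding energy_def
    by (rule integral_mono) (use i pt integrable_norm_sq[OF continuous_on_wavg[OF f]] in auto)
  also have "\<dots> = energy f"
    using i e \<open>R > 0\<close> by simp
  finally show ?thesis .
qed

lemma energy_avg_le:
  assumes "K > 0" "R > 0"
  shows "energy (avg R) \<le> energy (avg K) + 4 * real K / real R"
proof -
  have "energy (avg R) \<le> energy (wavg R (avg K)) + 2 * 1 * (2 * real K / real R)"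
  proof (rule energy_perturb)
    show "norm (avg R x - wavg R (avg K) x) \<le> 2 * real K / real R" for x
      using wavg_avg_close[OF assms, of x] by (simp add: norm_minus_commute)
  qed (auto intro!: continuous_on_avg continuous_on_wavg norm_avg_le norm_wavg_le)
  also have "energy (wavg R (avg K)) \<le> energy (avg K)"
    by (rule energy_wavg_le[OF continuous_on_avg assms(2)])
  finally show ?thesis by simp
qed

text \<open>A mean ergodic theorem: the energies of the averages tend to their infimum, and the sum of two
  averages has at least four times that energy, so by the parallelogram law the averages form a
  Cauchy sequence in mean square.\<close>

definition min_energy :: real
  where "min_energy = (INF K\<in>{0<..}. energy (avg K))"

lemma min_energy_le: "K > 0 \<Longrightarrow> min_energy \<le> energy (avg K)"
  unfolding min_energy_def by (rule cINF_lower) (auto intro!: bdd_belowI2[of _ 0] energy_nonneg)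

lemma min_energy_approx:
  assumes "e > 0" obtains K where "K > 0" "energy (avg K) < min_energy + e"
proof -
  have "(INF K\<in>{0<..}. energy (avg K)) < min_energy + e" using assms by (simp add: min_energy_def)
  then show ?thesis
    by (subst (asm) cINF_less_iff) (auto intro!: bdd_belowI2[of _ 0] energy_nonneg that)
qed

lemma energy_avg_tendsto: "(\<lambda>R. energy (avg R)) \<longlonglongrightarrow> min_energy"
proof (rule order_tendstoI)
  fix a assume "a < min_energy"
  show "\<forall>\<^sub>F R in sequentially. a < energy (avg R)"
    using eventually_gt_at_top[of 0]
  proof eventually_elim
    case (elim R)
    then show ?case using min_energy_le[of R] \<open>a < min_energy\<close> by linarith
  qed
next
  fix a assume "min_energy < a"
  then obtain K where K: "K > 0" "energy (avg K) < a"
    using min_energy_approx[of "a - min_energy"] by auto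
  have "(\<lambda>R. energy (avg K) + 4 * real K / real R) \<longlonglongrightarrow> energy (avg K) + 0"
    by (intro tendsto_add tendsto_const lim_const_over_n)
  then have "\<forall>\<^sub>F R in sequentially. energy (avg K) + 4 * real K / real R < a"
    using K(2) by (intro order_tendstoD(2)) auto
  then show "\<forall>\<^sub>F R in sequentially. energy (avg R) < a"
    using eventually_gt_at_top[of 0]
  proof eventually_elim
    case (elim R)
    then show ?case using energy_avg_le[OF K(1), of R] by linarith
  qed
qed

text \<open>Averaging \<open>avg K + avg L\<close> over \<open>R\<close> further steps gives nearly
  \<open>2 * avg R\<close>, of energy at least \<open>4 * min_energy\<close>, and averaging does not
  increase energy. The error vanishes as \<open>R\<close> grows.\<close>

lemma energy_avg_add_ge:
  assumes "K > 0" "L > 0"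
  shows "4 * min_energy \<le> energy (\<lambda>x. avg K x + avg L x)"
proof (rule LIMSEQ_le_const)
  define f where "f x = avg K x + avg L x" for x
  have cf: "continuous_on UNIV f" unfolding f_def by (intro continuous_intros continuous_on_avg)
  have fb: "norm (f x) \<le> 2" for x
    using norm_triangle_ineq[of "avg K x" "avg L x"] norm_avg_le[of K x] norm_avg_le[of L x]
    by (simp add: f_def)
  have "4 * min_energy \<le> energy (\<lambda>x. avg K x + avg L x) + 8 * real (K + L) / real R" if "R > 0" for R
  proof -
    have "energy (\<lambda>x. 2 * avg R x) \<le> energy (wavg R f) + 2 * 2 * (2 * real (K + L) / real R)"
    proof (rule energy_perturb)
      fix x
      have "wavg R f x = wavg R (avg K) x + wavg R (avg L) x"
        by (simp add: wavg_def f_def distrib_left sum.distrib add_divide_distrib)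
      then have "2 * avg R x - wavg R f x = - ((wavg R (avg K) x - avg R x) + (wavg R (avg L) x - avg R x))"
        by simp
      also have "norm \<dots> \<le> 2 * real K / real R + 2 * real L / real R"
        unfolding norm_minus_cancel
        by (rule norm_triangle_le) (intro add_mono wavg_avg_close assms that)
      finally show "norm (2 * avg R x - wavg R f x) \<le> 2 * real (K + L) / real R"
        by (simp add: add_divide_distrib distrib_left)
      show "norm (2 * avg R x) \<le> 2" using norm_avg_le[of R x] by (simp add: norm_mult)
      show "norm (wavg R f x) \<le> 2" by (rule norm_wavg_le[OF fb])
    qed (auto intro!: continuous_intros continuous_on_avg continuous_on_wavg cf)
    moreover have "energy (\<lambda>x. 2 * avg R x) = 4 * energy (avg R)"
      by (simp add: energy_def norm_mult power_mult_distrib)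
    moreover have "energy (wavg R f) \<le> energy f" by (rule energy_wavg_le[OF cf that])
    moreover have "min_energy \<le> energy (avg R)" by (rule min_energy_le[OF that])
    ultimately show ?thesis unfolding f_def by simp
  qed
  then show "\<exists>N. \<forall>R\<ge>N. 4 * min_energy \<le> energy (\<lambda>x. avg K x + avg L x) + 8 * real (K + L) / real R"
    by (intro exI[of _ 1]) auto
  have "(\<lambda>R. energy (\<lambda>x. avg K x + avg L x) + 8 * real (K + L) / real R)
      \<longlonglongrightarrow> energy (\<lambda>x. avg K x + avg L x) + 0"
    by (intro tendsto_add tendsto_const lim_const_over_n)
  then show "(\<lambda>R. energy (\<lambda>x. avg K x + avg L x) + 8 * real (K + L) / real R)
      \<longlonglongrightarrow> energy (\<lambda>x. avg K x + avg L x)" by simp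
qed

lemma energy_avg_Cauchy:
  assumes "e > 0"
  shows "\<exists>N. \<forall>K\<ge>N. \<forall>L\<ge>N. energy (\<lambda>x. avg K x - avg L x) \<le> e"
proof -
  have "\<forall>\<^sub>F R in sequentially. energy (avg R) < min_energy + e / 4"
    using assms by (intro order_tendstoD(2)[OF energy_avg_tendsto]) simp
  then obtain N where N: "\<And>R. R \<ge> N \<Longrightarrow> energy (avg R) < min_energy + e / 4"
    by (auto simp: eventually_sequentially)
  have "energy (\<lambda>x. avg K x - avg L x) \<le> e" if "K \<ge> Suc N" "L \<ge> Suc N" for K L
    using energy_parallelogram[OF continuous_on_avg continuous_on_avg, of K L]
      energy_avg_add_ge[of K L] N[of K] N[of L] that by simp
  then show ?thesis by blast
qed

text \<open>Rotating and multiplying by \<open>u x\<close> moves the window of cocycle products by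
  one place, so the averages are almost invariant and their limits are exactly so.\<close>

lemma u_mult_avg_rot:
  assumes "n > 0"
  shows "norm (u x * avg n (x + circle_of \<alpha>) - avg n x) \<le> 2 / real n"
proof -
  have "iter (Suc b) x = u x * iter b (x + circle_of \<alpha>)" for b
    using iter_add[of 1 b x] by (simp add: rot_1) (simp add: iter_def)
  then have "u x * (\<Sum>b<n. iter b (x + circle_of \<alpha>)) = (\<Sum>b<n. iter (b + 1) x)"
    by (simp add: sum_distrib_left)
  then have "u x * avg n (x + circle_of \<alpha>) - avg n x
      = ((\<Sum>b<n. iter (b + 1) x) - (\<Sum>b<n. iter b x)) / of_nat n"
    by (simp add: avg_def diff_divide_distrib)
  also have "norm \<dots> \<le> 2 / real n"
    using norm_shifted_sum_diff_le[of "\<lambda>r. iter r x" 1 n] by (simp add: norm_divide divide_right_mono)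
  finally show ?thesis .
qed

end

section \<open>The dichotomy: an invariant function or uniform decay\<close>

context unimodular_cocycle
begin

text \<open>The rate 1/8 is fast enough for the increments to stay summable in mean after the
  weighting by 2^i in \<open>AE_convergent_avg\<close>; \<open>i < s i\<close> forces
  \<open>s\<close> to infinity.\<close>

lemma fast_subsequence:
  obtains s :: "nat \<Rightarrow> nat" where "\<And>i. i < s i" "\<And>i. energy (\<lambda>x. avg (s (Suc i)) x - avg (s i) x) \<le> (1/8) ^ i"
proof -
  have "\<forall>i. \<exists>N. \<forall>K\<ge>N. \<forall>L\<ge>N. energy (\<lambda>x. avg K x - avg L x) \<le> (1/8) ^ i"
    by (intro allI energy_avg_Cauchy) simp
  then obtain N where N: "\<And>i K L. K \<ge> N i \<Longrightarrow> L \<ge> N i \<Longrightarrow> energy (\<lambda>x. avg K x - avg L x) \<le> (1/8) ^ i"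
    by metis
  \<comment> \<open>Adding all thresholds up to \<open>i\<close> puts both \<open>s i\<close> and
    \<open>s (Suc i)\<close> beyond \<open>N i\<close>.\<close>
  define s where "s i = Suc i + (\<Sum>j\<le>i. N j)" for i
  have ge: "s i \<ge> N i" for i
    using member_le_sum[of i "{..i}" N] by (simp add: s_def)
  have "s (Suc i) \<ge> N i" for i
    using member_le_sum[of i "{..Suc i}" N] by (simp add: s_def)
  then show ?thesis
    using that[of s] N ge by (force simp: s_def)
qed

text \<open>The norms of the increments have integrals at most 2^(-i), so their sum is finite almost
  everywhere and the telescoping series converges absolutely there.\<close>

lemma AE_convergent_avg:
  assumes s: "\<And>i. energy (\<lambda>x. avg (s (Suc i)) x - avg (s i) x) \<le> (1/8) ^ i"
  shows "AE x in circle_lebesgue. convergent (\<lambda>i. avg (s i) x)"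
proof -
  define d where "d i x = norm (avg (s (Suc i)) x - avg (s i) x)" for i x
  have cd: "continuous_on UNIV (\<lambda>x. avg (s (Suc i)) x - avg (s i) x)" for i
    by (intro continuous_intros continuous_on_avg)
  have int: "integrable circle_lebesgue (d i)" for i
    unfolding d_def
    by (rule integrable_circle_continuous[OF finite_measure_circle_lebesgue])
       (auto intro!: continuous_intros continuous_on_avg)
  have int2: "integrable circle_lebesgue (\<lambda>x. (d i x)\<^sup>2)" for i
    unfolding d_def by (rule integrable_norm_sq[OF cd])
  have en: "energy (\<lambda>x. avg (s (Suc i)) x - avg (s i) x) = (LINT x|circle_lebesgue. (d i x)\<^sup>2)" for i
    by (simp add: energy_def d_def)
  have Ile: "(LINT x|circle_lebesgue. d i x) \<le> (1/2) ^ i" for i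
  proof -
    \<comment> \<open>The arithmetic-geometric mean inequality with weight 2^i takes the place of
      Cauchy-Schwarz: up to the factor 1/2, the two parts integrate to at most 4^(-i) and
      2^(-i).\<close>
    have pt: "d i x \<le> (2 ^ i * (d i x)\<^sup>2 + (1/2) ^ i) / 2" for x
    proof -
      have "0 \<le> (2 ^ i * d i x - 1)\<^sup>2 * (1/2) ^ i" by simp
      also have "\<dots> = (2 ^ i * (1/2) ^ i) * (2 ^ i * (d i x)\<^sup>2) - 2 * (2 ^ i * (1/2) ^ i) * d i x + (1/2) ^ i"
        by (simp add: power2_eq_square algebra_simps)
      also have "(2::real) ^ i * (1/2) ^ i = 1" by (simp add: power_mult_distrib[symmetric])
      finally show ?thesis by simp
    qed
    have "(LINT x|circle_lebesgue. d i x) \<le> (LINT x|circle_lebesgue. (2 ^ i * (d i x)\<^sup>2 + (1/2) ^ i) / 2)"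
      by (rule integral_mono) (use int[of i] int2[of i] pt in auto)
    also have "\<dots> = (2 ^ i * energy (\<lambda>x. avg (s (Suc i)) x - avg (s i) x) + (1/2) ^ i) / 2"
      unfolding en using int2[of i] by simp
    also have "\<dots> \<le> (2 ^ i * (1/8) ^ i + (1/2) ^ i) / 2"
      using s[of i] by simp
    also have "(2::real) ^ i * (1/8) ^ i = (1/4) ^ i" by (simp add: power_mult_distrib[symmetric])
    also have "(1/4::real) ^ i \<le> (1/2) ^ i" by (intro power_mono) auto
    finally show ?thesis by simp
  qed
  have [measurable]: "d i \<in> borel_measurable circle_lebesgue" for i using int by blast
  have "(\<integral>\<^sup>+x. (\<Sum>i. ennreal (d i x)) \<partial>circle_lebesgue) = (\<Sum>i. \<integral>\<^sup>+x. ennreal (d i x) \<partial>circle_lebesgue)"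
    by (rule nn_integral_suminf) measurable
  also have "\<dots> = (\<Sum>i. ennreal (LINT x|circle_lebesgue. d i x))"
    by (intro suminf_cong nn_integral_eq_integral int) (simp add: d_def)
  also have "\<dots> \<le> (\<Sum>i. ennreal ((1/2) ^ i))"
    by (intro suminf_le ennreal_leI Ile) auto
  also have "\<dots> = ennreal (\<Sum>i. (1/2) ^ i)"
    by (rule suminf_ennreal2) (auto intro: summable_geometric)
  finally have "(\<integral>\<^sup>+x. (\<Sum>i. ennreal (d i x)) \<partial>circle_lebesgue) \<noteq> \<infinity>"
    by (auto simp: top_unique)
  then have "AE x in circle_lebesgue. (\<Sum>i. ennreal (d i x)) \<noteq> \<infinity>"
    by (intro nn_integral_PInf_AE) measurable
  then show ?thesis
  proof eventually_elim
    case (elim x)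
    then have "summable (\<lambda>i. d i x)"
      by (intro summable_suminf_not_top) (auto simp: d_def)
    then have "summable (\<lambda>i. avg (s (Suc i)) x - avg (s i) x)"
      unfolding d_def by (rule summable_norm_cancel)
    then have "convergent (\<lambda>n. (\<Sum>i<n. avg (s (Suc i)) x - avg (s i) x))"
      by (simp add: summable_iff_convergent)
    then have "convergent (\<lambda>n. avg (s n) x - avg (s 0) x)"
      by (simp only: sum_lessThan_telescope[of "\<lambda>i. avg (s i) x"])
    then have "convergent (\<lambda>n. (avg (s n) x - avg (s 0) x) + avg (s 0) x)"
      by (intro convergent_add convergent_const)
    then show ?case by simp
  qed
qed

lemma measurable_avg [measurable]: "avg n \<in> borel_measurable borel"
  by (rule borel_measurable_continuous_onI[OF continuous_on_avg])

text \<open>The limit of the averages along a fast subsequence has energy \<open>min_energy\<close>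
  by dominated convergence, so it is not almost everywhere 0. Since \<open>u\<close> has modulus 1,
  the set where it does not vanish is rotation invariant, hence of full measure by
  ergodicity.\<close>

lemma invariant_function_exists:
  assumes irr: "\<alpha> \<notin> \<rat>" and pos: "min_energy > 0"
  obtains \<phi> where "\<phi> \<in> borel_measurable borel"
    "AE x in circle_lebesgue. \<phi> x \<noteq> 0 \<and> u x * \<phi> (x + circle_of \<alpha>) = \<phi> x"
proof -
  obtain s where s: "\<And>i. i < s i" "\<And>i. energy (\<lambda>x. avg (s (Suc i)) x - avg (s i) x) \<le> (1/8) ^ i"
    using fast_subsequence by metis
  have s_lim: "filterlim s at_top sequentially"
    by (rule filterlim_at_top_mono[OF filterlim_ident])
        (use s(1) in \<open>auto intro: always_eventually less_imp_le\<close>)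
  \<comment> \<open>\<open>lim\<close> is unspecified where the averages diverge, but that happens
    only on a null set and \<open>\<phi>\<close> is still Borel.\<close>
  define \<phi> where "\<phi> x = lim (\<lambda>i. avg (s i) x)" for x
  have [measurable]: "\<phi> \<in> borel_measurable borel" unfolding \<phi>_def[abs_def] by measurable
  have "AE x in circle_lebesgue. convergent (\<lambda>i. avg (s i) x)"
    by (rule AE_convergent_avg[OF s(2)])
  then have conv: "AE x in circle_lebesgue. (\<lambda>i. avg (s i) x) \<longlonglongrightarrow> \<phi> x"
    by eventually_elim (simp add: \<phi>_def convergent_LIMSEQ_iff)
  have inv: "AE x in circle_lebesgue. u x * \<phi> (x + circle_of \<alpha>) = \<phi> x"
    using conv AE_circle_translation[OF conv, of "circle_of \<alpha>"]
  proof eventually_elim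
    case (elim x)
    have "(\<lambda>i. u x * avg (s i) (x + circle_of \<alpha>) - avg (s i) x) \<longlonglongrightarrow> u x * \<phi> (x + circle_of \<alpha>) - \<phi> x"
      by (intro tendsto_intros elim)
    moreover have "(\<lambda>i. u x * avg (s i) (x + circle_of \<alpha>) - avg (s i) x) \<longlonglongrightarrow> 0"
    proof (rule Lim_null_comparison)
      show "\<forall>\<^sub>F i in sequentially. norm (u x * avg (s i) (x + circle_of \<alpha>) - avg (s i) x) \<le> 2 / real (s i)"
        using u_mult_avg_rot s(1) by (intro always_eventually allI) (metis less_nat_zero_code neq0_conv)
      show "(\<lambda>i. 2 / real (s i)) \<longlonglongrightarrow> 0"
        by (rule filterlim_compose[OF lim_const_over_n s_lim])
    qed
    ultimately have "u x * \<phi> (x + circle_of \<alpha>) - \<phi> x = 0" by (rule LIMSEQ_unique)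
    then show ?case by simp
  qed
  have "(\<lambda>i. energy (avg (s i))) \<longlonglongrightarrow> energy \<phi>"
    unfolding energy_def
  proof (rule integral_dominated_convergence[where w = "\<lambda>_. 1"])
    show "AE x in circle_lebesgue. (\<lambda>i. (norm (avg (s i) x))\<^sup>2) \<longlonglongrightarrow> (norm (\<phi> x))\<^sup>2"
      using conv by eventually_elim (intro tendsto_intros)
    show "AE x in circle_lebesgue. norm ((norm (avg (s i) x))\<^sup>2) \<le> 1" for i
      using norm_avg_le[of "s i"] by (simp add: power_le_one)
  qed auto
  moreover have "(\<lambda>i. energy (avg (s i))) \<longlonglongrightarrow> min_energy"
    by (rule filterlim_compose[OF energy_avg_tendsto s_lim])
  ultimately have en: "energy \<phi> = min_energy" by (rule LIMSEQ_unique)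
  define E where "E = {x. \<phi> x \<noteq> 0}"
  have [measurable]: "E \<in> sets borel" unfolding E_def by measurable
  have "AE x in circle_lebesgue. x \<in> E"
  proof (rule rotation_ergodic[OF irr])
    show "AE x in circle_lebesgue. x + circle_of \<alpha> \<in> E \<longleftrightarrow> x \<in> E"
      using inv
    proof eventually_elim
      case (elim x)
      have "u x \<noteq> 0" using norm_u[of x] by force
      then show ?case using elim unfolding E_def by force
    qed
    show "emeasure circle_lebesgue E \<noteq> 0"
    proof
      assume "emeasure circle_lebesgue E = 0"
      then have "AE x in circle_lebesgue. x \<notin> E" by (intro AE_I[of _ _ E]) auto
      then have "AE x in circle_lebesgue. (norm (\<phi> x))\<^sup>2 = 0"
        by eventually_elim (simp add: E_def)
      then have "energy \<phi> = 0"
        unfolding energy_def by (subst integral_cong_AE[where g = "\<lambda>_. 0"]) auto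
      then show False using en pos by simp
    qed
  qed measurable
  then have "AE x in circle_lebesgue. \<phi> x \<noteq> 0 \<and> u x * \<phi> (x + circle_of \<alpha>) = \<phi> x"
    using inv by eventually_elim (simp add: E_def)
  then show ?thesis using that[of \<phi>] by simp
qed

text \<open>Fix \<open>K\<close> with \<open>avg K\<close> small in mean. At every point
  \<open>avg R\<close> is close to an orbit average of \<open>avg K\<close> with unimodular weights,
  hence bounded by the orbit average of its norm; this norm is continuous, so unique ergodicity
  brings the orbit average uniformly close to the small integral.\<close>

lemma avg_uniform_limit:
  assumes irr: "\<alpha> \<notin> \<rat>" and min0: "min_energy \<le> 0"
  shows "uniform_limit UNIV avg (\<lambda>_. 0) sequentially"
proof (rule uniform_limitI)
  fix e :: real assume "e > 0"
  \<comment> \<open>Three errors of size \<open>d\<close> occur: the integral, its distance from the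
    orbit average, and the boundary term.\<close>
  define d where "d = e / 4"
  have "d > 0" using \<open>e > 0\<close> by (simp add: d_def)
  then obtain K where K: "K > 0" "energy (avg K) < min_energy + d\<^sup>2"
    using min_energy_approx[of "d\<^sup>2"] by (metis zero_less_power)
  have cn: "continuous_on UNIV (\<lambda>x. norm (avg K x))"
    by (intro continuous_intros continuous_on_avg)
  have int: "integrable circle_lebesgue (\<lambda>x. norm (avg K x))"
    by (rule integrable_circle_continuous[OF finite_measure_circle_lebesgue _ cn]) simp
  \<comment> \<open>The arithmetic-geometric mean inequality at scale \<open>d\<close> turns energy
    below d^2 into a mean norm of at most \<open>d\<close>.\<close>
  have pt: "norm (avg K x) \<le> d / 2 + (norm (avg K x))\<^sup>2 / (2 * d)" for x
  proof -
    have "0 \<le> (norm (avg K x) - d)\<^sup>2 / (2 * d)" using \<open>d > 0\<close> by simp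
    also have "\<dots> = d / 2 + (norm (avg K x))\<^sup>2 / (2 * d) - norm (avg K x)"
      using \<open>d > 0\<close> by (simp add: power2_eq_square field_simps)
    finally show ?thesis by simp
  qed
  have "(LINT x|circle_lebesgue. norm (avg K x)) \<le> (LINT x|circle_lebesgue. d / 2
      + (norm (avg K x))\<^sup>2 / (2 * d))"
    by (rule integral_mono) (use int pt integrable_norm_sq[OF continuous_on_avg, of K] in auto)
  also have "\<dots> = d / 2 + energy (avg K) / (2 * d)"
    unfolding energy_def using integrable_norm_sq[OF continuous_on_avg, of K] by simp
  also have "\<dots> \<le> d / 2 + d\<^sup>2 / (2 * d)"
    using K(2) min0 \<open>d > 0\<close> by (intro add_left_mono divide_right_mono) auto
  also have "\<dots> = d" using \<open>d > 0\<close> by (simp add: power2_eq_square)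
  finally have I: "(LINT x|circle_lebesgue. norm (avg K x)) \<le> d" .
  have "\<forall>\<^sub>F R in sequentially. \<forall>x\<in>UNIV. dist ((\<Sum>r<R. norm (avg K (x + circle_of (real r * \<alpha>)))) / real R)
      (LINT x|circle_lebesgue. norm (avg K x)) < d"
    by (rule uniform_limitD[OF rotation_uniform_limit[OF irr cn] \<open>d > 0\<close>])
  moreover have "\<forall>\<^sub>F R in sequentially. 2 * real K / real R < d"
    by (rule order_tendstoD(2)[OF lim_const_over_n \<open>d > 0\<close>])
  ultimately show "\<forall>\<^sub>F R in sequentially. \<forall>x\<in>UNIV. dist (avg R x) 0 < e"
    using eventually_gt_at_top[of 0]
  proof eventually_elim
    case (elim R)
    show ?case
    proof
      fix x
      have 1: "norm (wavg R (avg K) x) \<le> (\<Sum>r<R. norm (avg K (x + circle_of (real r * \<alpha>)))) / real R"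
        unfolding wavg_def norm_divide norm_of_nat
        by (intro divide_right_mono sum_norm_le) (simp_all add: norm_mult rot_def)
      have 2: "norm (avg R x) \<le> norm (wavg R (avg K) x) + norm (wavg R (avg K) x - avg R x)"
        using norm_triangle_sub[of "avg R x" "wavg R (avg K) x"] by (simp add: norm_minus_commute)
      have 3: "norm (wavg R (avg K) x - avg R x) \<le> 2 * real K / real R"
        by (rule wavg_avg_close[OF K(1) elim(3)])
      have "norm (avg R x) < 3 * d"
        using 1 2 3 bspec[OF elim(1) UNIV_I, of x] elim(2) I unfolding dist_real_def by linarith
      then show "dist (avg R x) 0 < e" using \<open>e > 0\<close> by (simp add: d_def)
    qed
  qed
qed

end


section \<open>Decay of character averages along the skew product\<close>

lemma birkhoff_sum_add:
  "birkhoff_sum \<alpha> (m + n) g x = birkhoff_sum \<alpha> m g x + birkhoff_sum \<alpha> n g (x + circle_of (real m * \<alpha>))"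
proof (induction n)
  case (Suc n)
  then show ?case
    by (simp add: birkhoff_sum_def add.assoc distrib_right flip: circle_of_add)
qed (simp add: birkhoff_sum_def)

lemma cis_eq_1_imp: "cis t = 1 \<Longrightarrow> \<exists>n::int. t = 2 * pi * of_int n"
proof -
  assume "cis t = 1"
  then have "cos t = 1" by (simp add: complex_eq_iff)
  then show ?thesis by (auto simp: cos_one_2pi_int mult_ac)
qed

text \<open>For \<open>k = 0\<close> the averages are geometric sums with ratio different from 1 by
  irrationality. For \<open>k \<noteq> 0\<close> a positive \<open>min_energy\<close> would give an
  invariant function, and its argument would solve the equation excluded for r = k and
  \<open>\<beta>\<close> = - j \<open>\<alpha>\<close>.\<close>

lemma character_average_uniform_limit:
  fixes \<alpha> :: real and g :: "circle \<Rightarrow> real" and j k :: int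
  assumes irr: "\<alpha> \<notin> \<rat>" and g: "continuous_on UNIV g"
    and not_cohomologous: "\<And>r \<beta> :: real. r \<noteq> 0 \<Longrightarrow>
        \<not> (\<exists>\<psi> :: circle \<Rightarrow> real. \<psi> \<in> borel_measurable circle_lebesgue \<and>
            (AE x in circle_lebesgue.
               r * g x - (\<psi> (x + circle_of \<alpha>) - \<psi> x + \<beta>) \<in> \<int>))"
    and jk: "j \<noteq> 0 \<or> k \<noteq> 0"
  shows "uniform_limit UNIV
    (\<lambda>L x. (\<Sum>b<L. circle_char j (circle_of (real b * \<alpha>))
        * circle_char k (circle_of (birkhoff_sum \<alpha> b g x))) / of_nat L)
    (\<lambda>_. 0) sequentially"
proof -
  define u where "u x = circle_char j (circle_of \<alpha>) * circle_char k (circle_of (g x))" for x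
  interpret unimodular_cocycle \<alpha> u
    by standard (auto simp: u_def norm_mult intro!: continuous_intros g)
  have iter_eq: "iter b x = circle_char j (circle_of (real b * \<alpha>))
      * circle_char k (circle_of (birkhoff_sum \<alpha> b g x))" for b x
  proof (induction b)
    case (Suc b)
    have "circle_of (real (Suc b) * \<alpha>) = circle_of (real b * \<alpha>) + circle_of \<alpha>"
      by (simp add: circle_of_add[symmetric] algebra_simps)
    moreover have "birkhoff_sum \<alpha> (Suc b) g x = birkhoff_sum \<alpha> b g x + g (rot b x)"
      by (simp add: birkhoff_sum_def rot_def)
    moreover have "iter (Suc b) x = iter b x * u (rot b x)" by (simp add: iter_def)
    moreover have "u (rot b x) = circle_char j (circle_of \<alpha>) * circle_char k (circle_of (g (rot b x)))"
      by (rule u_def)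
    ultimately show ?case using Suc by (simp only: circle_char_add circle_of_add mult_ac)
  qed (simp add: iter_def birkhoff_sum_def circle_of_0)
  have "uniform_limit UNIV avg (\<lambda>_. 0) sequentially"
  proof (cases "k = 0")
    case True
    with jk have "j \<noteq> 0" by simp
    define z where "z = circle_char j (circle_of \<alpha>)"
    have z: "norm z = 1" "z \<noteq> 1"
      using circle_char_irrational_neq_1[OF irr \<open>j \<noteq> 0\<close>] by (auto simp: z_def)
    have bound: "norm (avg L x) \<le> 2 / norm (1 - z) / real L" for L x
    proof -
      have eq: "avg L x = (\<Sum>b<L. z ^ b) / of_nat L"
        by (simp add: avg_def iter_eq True circle_char_circle_of_mult z_def)
      show ?thesis
        unfolding eq norm_divide norm_of_nat
        by (intro divide_right_mono norm_geometric_sum_le z of_nat_0_le_iff)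
    qed
    show ?thesis
    proof (rule uniform_limitI)
      fix e :: real assume "e > 0"
      have "\<forall>\<^sub>F L in sequentially. 2 / norm (1 - z) / real L < e"
        by (rule order_tendstoD(2)[OF lim_const_over_n \<open>e > 0\<close>])
      then show "\<forall>\<^sub>F L in sequentially. \<forall>x\<in>UNIV. dist (avg L x) 0 < e"
      proof eventually_elim
        case (elim L)
        then show ?case using le_less_trans[OF bound elim] by simp
      qed
    qed
  next
    case False
    show ?thesis
    proof (rule avg_uniform_limit[OF irr], rule ccontr)
      assume "\<not> min_energy \<le> 0"
      then have "min_energy > 0" by simp
      then obtain \<phi> where [measurable]: "\<phi> \<in> borel_measurable borel"
        and \<phi>: "AE x in circle_lebesgue. \<phi> x \<noteq> 0 \<and> u x * \<phi> (x + circle_of \<alpha>) = \<phi> x"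
        by (rule invariant_function_exists[OF irr])
      \<comment> \<open>A version of \<open>Arg\<close> that is measurable by construction:
        continuous off the cut and constant on it. The two can differ only at 0, a value that
        \<open>\<phi>\<close> avoids almost everywhere.\<close>
      define A where "A z = (if z \<in> - \<real>\<^sub>\<le>\<^sub>0 then Arg z else pi)" for z :: complex
      have [measurable]: "A \<in> borel_measurable borel"
        unfolding A_def[abs_def]
        by (intro borel_measurable_continuous_on_if continuous_on_Arg continuous_intros)
           (auto intro: borel_comp borel_closed)
      have A: "cis (A z) = z / of_real (norm z)" if "z \<noteq> 0" for z
      proof -
        have "A z = Arg z"
          using that by (auto simp: A_def elim!: nonpos_Reals_cases)
        then show ?thesis using that Arg_eq[OF that] by (simp add: cis_conv_exp field_simps)
      qed
      \<comment> \<open>The minus sign is due to the direction of the invariance: \<open>u x\<close>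
        is \<open>\<phi> x\<close> divided by the rotated value, while the coboundary is rotated
        minus original.\<close>
      define \<psi> where "\<psi> x = - A (\<phi> x) / (2 * pi)" for x
      have "\<psi> \<in> borel_measurable circle_lebesgue"
        unfolding \<psi>_def[abs_def] by measurable
      moreover have "AE x in circle_lebesgue. of_int k * g x - (\<psi> (x + circle_of \<alpha>) - \<psi> x + - (of_int j
          * \<alpha>)) \<in> \<int>"
        using \<phi> AE_circle_translation[OF \<phi>, of "circle_of \<alpha>"]
      proof eventually_elim
        case (elim x)
        define a a' where "a = A (\<phi> x)" and "a' = A (\<phi> (x + circle_of \<alpha>))"
        have n: "norm (\<phi> x) = norm (\<phi> (x + circle_of \<alpha>))"
          using elim(1) norm_u[of x] by (metis mult_1 norm_mult)
        have "u x * cis a' = cis a"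
          using elim n unfolding a_def a'_def by (subst (1 2) A) (auto simp: field_simps)
        then have "cis (2 * pi * of_int j * \<alpha> + 2 * pi * of_int k * g x + a') = cis a"
          by (simp add: u_def circle_char_circle_of cis_mult)
        then have "cis (2 * pi * of_int j * \<alpha> + 2 * pi * of_int k * g x + a' - a) = 1"
          by (simp flip: cis_divide)
        then obtain n :: int where "2 * pi * of_int j * \<alpha> + 2 * pi * of_int k * g x + a' - a = 2 * pi
            * of_int n"
          using cis_eq_1_imp by blast
        then have "of_int k * g x - (\<psi> (x + circle_of \<alpha>) - \<psi> x + - (of_int j * \<alpha>)) = of_int n"
          unfolding \<psi>_def a_def[symmetric] a'_def[symmetric] by (simp add: field_simps)
        then show ?case by simp
      qed
      ultimately show False using not_cohomologous[of "of_int k" "- (of_int j * \<alpha>)"] False by auto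
    qed
  qed
  then show ?thesis unfolding avg_def iter_eq .
qed

section \<open>Square orbits\<close>

text \<open>Going from (X + h)^2 to the time shifted by \<open>q * m\<close> costs \<open>m\<close>
  times \<open>d0\<close>; reducing the offset modulo \<open>Q\<close> costs one \<open>d1\<close>
  per multiple of \<open>Q\<close> removed. Then \<open>c\<close>, the inverse of \<open>q\<close>
  modulo \<open>Q\<close>, turns the residue h^2 + 2 X h + q m into \<open>v h + m\<close>: the step
  \<open>q\<close> becomes 1, and the quadratic coefficient \<open>c\<close> is still coprime to
  \<open>Q\<close>. This is the shape treated by \<open>residue_sum_deviation\<close>, with
  \<open>G\<close> running through \<open>F\<close> along multiples of \<open>q\<close>.\<close>

lemma block_estimate:
  fixes F :: "nat \<Rightarrow> complex" and q Q X H M :: nat and d0 d1 :: real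
  assumes cop: "coprime q Q" and Q: "Q > 0" "q \<le> Q" and H: "0 < H" "H \<le> Q" and M: "0 < M"
    and F: "\<And>b. norm (F b) \<le> 1"
    and d0: "d0 \<ge> 0" "\<And>b m. norm (F (b + q * m) - F b) \<le> real m * d0"
    and d1: "d1 \<ge> 0" "\<And>b m. norm (F (b + Q * m) - F b) \<le> real m * d1"
  shows "norm (\<Sum>h<H. F ((X + h)\<^sup>2)) \<le> real H * (norm (\<Sum>b<Q. F (X\<^sup>2 + b)) / real Q + real M * d0
    + ((2 * real X * real H + (real H)\<^sup>2) / real Q + real M) * d1
    + sqrt (4 * real Q ^ 2 * (harm Q)\<^sup>2 * (real H + real M)) / (real H * real M))"
proof -
  obtain c where c: "[q * c = 1] (mod Q)"
    using cong_solve_coprime_nat[OF cop] by auto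
  have copc: "coprime c Q"
    using c coprime_iff_invertible_nat[of c Q] by (auto simp: mult.commute)
  define G where "G b = F (X\<^sup>2 + (q * b) mod Q)" for b
  define v where "v h = c * (h\<^sup>2 + 2 * X * h)" for h
  define y where "y h m = h\<^sup>2 + 2 * X * h + q * m" for h m
  define E where "E = real M * d0 + ((2 * real X * real H + (real H)\<^sup>2) / real Q + real M) * d1"
  define S where "S = sqrt (4 * real Q ^ 2 * (harm Q)\<^sup>2 * (real H + real M))"
  have Gv: "G ((v h + m) mod Q) = F (X\<^sup>2 + y h m mod Q)" for h m
  proof -
    have "[q * (v h + m) = (q * c) * (h\<^sup>2 + 2 * X * h) + q * m] (mod Q)"
      by (simp add: v_def algebra_simps)
    also have "[(q * c) * (h\<^sup>2 + 2 * X * h) + q * m = 1 * (h\<^sup>2 + 2 * X * h) + q * m] (mod Q)"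
      by (intro cong_add cong_mult c cong_refl)
    finally have "(q * (v h + m)) mod Q = y h m mod Q" by (simp add: y_def cong_def)
    then show ?thesis by (simp add: G_def mod_mult_right_eq)
  qed
  have sumG: "(\<Sum>b<Q. G b) = (\<Sum>b<Q. F (X\<^sup>2 + b))"
    unfolding G_def using sum.reindex_bij_betw[OF bij_betw_mult_mod[OF cop Q(1)], of "\<lambda>b. F (X\<^sup>2 + b)"] .
  have "norm ((\<Sum>h<H. \<Sum>m<M. G ((v h + m) mod Q)) - of_nat (H * M) / of_nat Q * (\<Sum>b<Q. G b)) \<le> S"
    unfolding S_def v_def
    by (rule order_trans[OF residue_sum_deviation real_sqrt_le_mono])
       (use Q F H sum_quadratic_linear_le[OF copc] in \<open>auto simp: G_def\<close>)
  then have 1: "norm (\<Sum>h<H. \<Sum>m<M. G ((v h + m) mod Q)) \<le> real (H * M) * (norm (\<Sum>b<Q. F (X\<^sup>2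
      + b)) / real Q) + S"
    unfolding sumG
    using norm_triangle_sub[of "\<Sum>h<H. \<Sum>m<M. G ((v h + m) mod Q)" "of_nat (H * M) / of_nat Q *
        (\<Sum>b<Q. F (X\<^sup>2 + b))"]
    by (simp add: norm_mult norm_divide)
  have close: "norm (F ((X + h)\<^sup>2) - G ((v h + m) mod Q)) \<le> E" if "h < H" "m < M" for h m
  proof -
    have sq: "(X + h)\<^sup>2 = X\<^sup>2 + h\<^sup>2 + 2 * X * h" by (simp add: power2_eq_square algebra_simps)
    have a: "norm (F (X\<^sup>2 + y h m) - F ((X + h)\<^sup>2)) \<le> real m * d0"
      using d0(2)[of "(X + h)\<^sup>2" m] by (simp add: sq y_def add.assoc)
    have eq: "(X\<^sup>2 + y h m mod Q) + Q * (y h m div Q) = X\<^sup>2 + y h m"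
      by simp
    have b: "norm (F (X\<^sup>2 + y h m) - F (X\<^sup>2 + y h m mod Q)) \<le> real (y h m div Q) * d1"
      using d1(2)[of "X\<^sup>2 + y h m mod Q" "y h m div Q"] by (simp only: eq)
    have "norm (F ((X + h)\<^sup>2) - G ((v h + m) mod Q)) \<le> real m * d0 + real (y h m div Q) * d1"
      unfolding Gv using a b norm_triangle_le[of "F ((X + h)\<^sup>2) - F (X\<^sup>2 + y h m)" "F (X\<^sup>2 + y h m)
          - F (X\<^sup>2 + y h m mod Q)"]
      by (simp add: norm_minus_commute)
    also have "\<dots> \<le> E"
    proof -
      have "y h m \<le> H\<^sup>2 + 2 * X * H + Q * M"
        unfolding y_def using that Q by (intro add_mono mult_le_mono power_mono) auto
      then have "real (y h m) \<le> real (H\<^sup>2 + 2 * X * H + Q * M)" by (simp only: of_nat_le_iff)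
      also have "real (H\<^sup>2 + 2 * X * H + Q * M) = ((2 * real X * real H + (real H)\<^sup>2) / real Q + real M)
          * real Q"
        using Q(1) by (simp add: field_simps)
      finally have up: "real (y h m) \<le> ((2 * real X * real H + (real H)\<^sup>2) / real Q + real M) * real Q" .
      have "real (y h m div Q) * real Q \<le> real (y h m)"
        unfolding of_nat_mult[symmetric] by (simp only: of_nat_le_iff div_times_less_eq_dividend)
      then have "real (y h m div Q) * real Q \<le> ((2 * real X * real H + (real H)\<^sup>2) / real Q + real M)
          * real Q"
        using up by linarith
      then have "real (y h m div Q) \<le> (2 * real X * real H + (real H)\<^sup>2) / real Q + real M"
        using Q(1) by (simp only: mult_le_cancel_right_pos of_nat_0_less_iff)
      then show ?thesis
        unfolding E_def using that d0(1) d1(1) by (intro add_mono mult_right_mono) auto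
    qed
    finally show ?thesis .
  qed
  \<comment> \<open>The left sum does not involve \<open>m\<close>; repeating it \<open>M\<close>
    times makes room for the average over \<open>m\<close>.\<close>
  have split: "of_nat M * (\<Sum>h<H. F ((X + h)\<^sup>2)) = (\<Sum>h<H. \<Sum>m<M. F ((X + h)\<^sup>2) - G ((v h + m) mod Q))
      + (\<Sum>h<H. \<Sum>m<M. G ((v h + m) mod Q))"
    by (simp add: sum_subtractf sum_distrib_left)
  have "real M * norm (\<Sum>h<H. F ((X + h)\<^sup>2)) = norm (of_nat M * (\<Sum>h<H. F ((X + h)\<^sup>2)))"
    by (simp only: norm_mult norm_of_nat)
  also have "\<dots> \<le> norm (\<Sum>h<H. \<Sum>m<M. F ((X + h)\<^sup>2) - G ((v h + m) mod Q)) + norm (\<Sum>h<H. \<Sum>m<M. G ((v h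
      + m) mod Q))"
    unfolding split by (rule norm_triangle_ineq)
  also have "norm (\<Sum>h<H. \<Sum>m<M. F ((X + h)\<^sup>2) - G ((v h + m) mod Q)) \<le> (\<Sum>h<H. \<Sum>m<M. E)"
    by (intro sum_norm_le close) auto
  also have "(\<Sum>h<H. \<Sum>m<M. E) = real H * real M * E" by simp
  also note 1
  finally have "real M * norm (\<Sum>h<H. F ((X + h)\<^sup>2))
    \<le> real H * real M * E + (real H * real M * (norm (\<Sum>b<Q. F (X\<^sup>2 + b)) / real Q) + S)" by simp
  also have "\<dots> = real M * (real H * (norm (\<Sum>b<Q. F (X\<^sup>2 + b)) / real Q + E + S / (real H * real M)))"
    using H M by (simp add: distrib_left)
  finally have "norm (\<Sum>h<H. F ((X + h)\<^sup>2)) \<le> real H * (norm (\<Sum>b<Q. F (X\<^sup>2 + b)) / real Q + E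
      + S / (real H * real M))"
    using M by (simp only: mult_le_cancel_left_pos of_nat_0_less_iff)
  then show ?thesis unfolding E_def S_def by (simp only: add.assoc)
qed

lemma norm_sum_blocks_le:
  fixes a :: "nat \<Rightarrow> complex"
  assumes H: "H > 0" and a: "\<And>n. norm (a n) \<le> 1"
    and blocks: "\<And>X. X \<le> N \<Longrightarrow> norm (\<Sum>h<H. a (X + h)) \<le> real H * e"
  shows "norm (\<Sum>n<N. a n) \<le> real N * e + real H"
proof -
  define K where "K = N div H"
  have KH: "K * H \<le> N" by (simp add: K_def)
  have rem: "N - K * H < H" using H by (simp add: K_def modulo_nat_def[symmetric])
  have e: "e \<ge> 0"
    using order_trans[OF norm_ge_zero blocks[of 0]] H by (simp add: zero_le_mult_iff)
  have "(\<Sum>n<N. a n) = (\<Sum>n<K * H. a n) + (\<Sum>n\<in>{K*H..<N}. a n)"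
    using KH by (subst sum.union_disjoint[symmetric]) (auto intro!: sum.cong)
  then have "norm (\<Sum>n<N. a n) \<le> norm (\<Sum>n<K * H. a n) + norm (\<Sum>n\<in>{K*H..<N}. a n)"
    by (simp add: norm_triangle_ineq)
  moreover have "norm (\<Sum>n\<in>{K*H..<N}. a n) \<le> real H"
    using sum_norm_le[of "{K*H..<N}" a "\<lambda>_. 1"] a rem by simp
  moreover have "norm (\<Sum>n<K * H. a n) \<le> real N * e"
  proof -
    have "(\<Sum>n<K * H. a n) = (\<Sum>i<K. \<Sum>n\<in>{i*H..<i*H+H}. a n)"
      by (rule sum.nat_group[symmetric])
    also have "\<dots> = (\<Sum>i<K. \<Sum>h<H. a (i * H + h))"
    proof (rule sum.cong[OF refl])
      show "sum a {i*H..<i*H+H} = (\<Sum>h<H. a (i * H + h))" for i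
        using sum.atLeastLessThan_shift_0[of a "i * H" "i * H + H"] by (simp add: atLeast0LessThan)
    qed
    also have "norm \<dots> \<le> (\<Sum>i<K. real H * e)"
    proof (rule sum_norm_le)
      fix i assume "i \<in> {..<K}"
      then have "i * H \<le> K * H" by simp
      then show "norm (\<Sum>h<H. a (i * H + h)) \<le> real H * e"
        using KH by (intro blocks) linarith
    qed
    also have "\<dots> = real (K * H) * e" by simp
    also have "\<dots> \<le> real N * e" using KH e by (intro mult_right_mono) (simp_all only: of_nat_le_iff)
    finally show ?thesis .
  qed
  ultimately show ?thesis by linarith
qed

lemma harm_le_ln:
  assumes "n > 0" shows "harm n \<le> 1 + ln (real n)"
proof -
  obtain m where m: "n = Suc m" using assms by (cases n) auto
  show ?thesis
    using decseqD[OF decseq_harm_diff_ln, of 0 m] by (simp add: m harm_def)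
qed

text \<open>With \<open>M = H\<close> the term is sqrt 8 * Q * harm Q * H^(-3/2); inserting H >=
  Q^(3/4) / 2 gives the constant 8 and the exponent 1 - 9/8. In powers of \<open>w\<close> = Q^(1/8)
  all exponents are integers.\<close>

lemma deviation_term_le:
  assumes "Q > 0" "real Q powr (3/4) / 2 \<le> real H"
  shows "sqrt (4 * real Q ^ 2 * (harm Q)\<^sup>2 * (real H + real H)) / (real H * real H)
    \<le> 8 * real Q powr (- 1/8) * (1 + ln (real Q))"
proof -
  define w where "w = real Q powr (1/8)"
  have w: "w > 0" using assms by (simp add: w_def)
  have w8: "w ^ 8 = real Q" and w6: "w ^ 6 = real Q powr (3/4)"
    using assms by (simp_all add: w_def powr_power powr_numeral)
  have H: "real H \<ge> w ^ 6 / 2" using assms w6 by simp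
  then have Hpos: "real H > 0" using w by (smt (verit) half_gt_zero zero_less_power)
  have "sqrt (4 * real Q ^ 2 * (harm Q)\<^sup>2 * (real H + real H)) / (real H * real H) \<le> 8 * harm Q / w"
  proof -
    have "(w ^ 6 / 2) ^ 3 \<le> real H ^ 3" using H w by (intro power_mono) auto
    then have H3: "w ^ 18 \<le> 8 * real H ^ 3" by (simp add: power_divide power_mult[symmetric])
    have "sqrt (4 * real Q ^ 2 * (harm Q)\<^sup>2 * (real H + real H)) \<le> 8 * harm Q / w * (real H * real H)"
    proof (rule real_le_lsqrt)
      have "w ^ 2 * (8 * real Q ^ 2 * real H) = 8 * w ^ 18 * real H"
        by (simp add: w8[symmetric] power_mult[symmetric] power_add[symmetric])
      also have "\<dots> \<le> 8 * (8 * real H ^ 3) * real H"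
        using H3 by (intro mult_right_mono mult_left_mono) auto
      also have "\<dots> = 64 * real H ^ 4" by (simp add: power_Suc[symmetric] eval_nat_numeral)
      finally have "8 * real Q ^ 2 * real H \<le> 64 * real H ^ 4 / w ^ 2"
        using w by (simp add: field_simps)
      then have "(harm Q)\<^sup>2 * (8 * real Q ^ 2 * real H) \<le> (harm Q)\<^sup>2 * (64 * real H ^ 4 / w ^ 2)"
        by (intro mult_left_mono) auto
      also have "\<dots> = (8 * harm Q / w * (real H * real H))\<^sup>2"
        by (simp add: power_mult_distrib power_divide power_mult[symmetric] power2_eq_square eval_nat_numeral)
      finally show "4 * real Q ^ 2 * (harm Q)\<^sup>2 * (real H + real H) \<le> (8 * harm Q / w * (real H * real H))\<^sup>2"
        by (simp add: algebra_simps)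
    qed (use w in \<open>auto simp: harm_nonneg\<close>)
    then show ?thesis using Hpos by (simp add: divide_le_eq)
  qed
  also have "\<dots> \<le> 8 * (1 + ln (real Q)) / w"
    using harm_le_ln[OF assms(1)] w by (intro divide_right_mono mult_left_mono) auto
  also have "\<dots> = 8 * real Q powr (- 1/8) * (1 + ln (real Q))"
  proof -
    have "real Q powr (- 1/8) = inverse w"
      using powr_minus[of "real Q" "1/8"] by (simp only: w_def minus_divide_left)
    then show ?thesis by (simp only: divide_inverse mult_ac)
  qed
  finally show ?thesis .
qed

section \<open>Almost invariance under shifts by denominators\<close>

lemma norm_circle_char_minus_1_le:
  "norm (circle_char j (circle_of t) - 1) \<le> 2 * pi * \<bar>of_int j\<bar> * \<bar>t - of_int p\<bar>"
proof -
  \<comment> \<open>The integer \<open>p\<close> is free: for the rotation it will be an integer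
    close to q \<open>\<alpha>\<close>, for Birkhoff sums, which are small themselves, it will be
    0.\<close>
  have "circle_of t = circle_of (t - of_int p)" by (simp add: circle_of_eq_iff)
  then have "circle_char j (circle_of t) = unit_exp (of_int j * (t - of_int p))"
    by (simp only: circle_char_circle_of unit_exp_def mult.assoc)
  then have "norm (circle_char j (circle_of t) - 1) = 2 * \<bar>sin (pi * (of_int j * (t - of_int p)))\<bar>"
    using norm_one_minus_unit_exp by (metis norm_minus_commute)
  also have "\<dots> \<le> 2 * \<bar>pi * (of_int j * (t - of_int p))\<bar>"
    by (intro mult_left_mono abs_sin_x_le_abs_x) simp
  also have "\<dots> = 2 * pi * \<bar>of_int j\<bar> * \<bar>t - of_int p\<bar>" by (simp add: abs_mult)
  finally show ?thesis .
qed

lemma continuous_on_birkhoff_sum: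
  "continuous_on UNIV g \<Longrightarrow> continuous_on A (birkhoff_sum \<alpha> n g)"
  unfolding birkhoff_sum_def[abs_def]
  by (intro continuous_intros) (auto intro!: continuous_on_compose2[of UNIV g] continuous_intros)

text \<open>A real supremum bounds its members once the range is bounded, which compactness of the
  circle provides.\<close>

lemma abs_birkhoff_sum_le_Sup:
  assumes "continuous_on UNIV g"
  shows "\<bar>birkhoff_sum \<alpha> n g x\<bar> \<le> (SUP x. \<bar>birkhoff_sum \<alpha> n g x\<bar>)"
proof (rule cSUP_upper)
  have "compact ((\<lambda>x. \<bar>birkhoff_sum \<alpha> n g x\<bar>) ` UNIV)"
    by (intro compact_continuous_image compact_circle continuous_intros continuous_on_birkhoff_sum assms)
  then show "bdd_above (range (\<lambda>x. \<bar>birkhoff_sum \<alpha> n g x\<bar>))"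
    by (intro bounded_imp_bdd_above compact_imp_bounded)
qed simp

text \<open>The sequence F of the overview, with \<open>z\<close> as the pair (x, y).\<close>

definition orbit_char :: "real \<Rightarrow> (circle \<Rightarrow> real) \<Rightarrow> int \<Rightarrow> int \<Rightarrow> circle \<times> circle \<Rightarrow> nat \<Rightarrow> complex"
  where "orbit_char \<alpha> g j k z n =
    circle_char j (fst z + circle_of (real n * \<alpha>)) * circle_char k (snd z
        + circle_of (birkhoff_sum \<alpha> n g (fst z)))"

lemma norm_orbit_char [simp]: "norm (orbit_char \<alpha> g j k z n) = 1"
  by (simp add: orbit_char_def norm_mult)

lemma orbit_char_add:
  "orbit_char \<alpha> g j k z (b + n) = orbit_char \<alpha> g j k z b *
    (circle_char j (circle_of (real n * \<alpha>)) * circle_char k (circle_of (birkhoff_sum \<alpha> n g (fst z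
        + circle_of (real b * \<alpha>)))))"
proof -
  have "circle_of (real (b + n) * \<alpha>) = circle_of (real b * \<alpha>) + circle_of (real n * \<alpha>)"
    by (simp add: circle_of_add[symmetric] algebra_simps)
  then show ?thesis
    by (simp add: orbit_char_def birkhoff_sum_add circle_of_add circle_char_add)
qed

text \<open>One shift multiplies by a product u v, where u is near 1 because the denominator times
  \<open>\<alpha>\<close> is near an integer and v is near 1 because the Birkhoff sum is small at
  every point. The identity u v - 1 = u (v - 1) + (u - 1) adds the two errors, and the m shifts add
  up.\<close>

lemma orbit_char_shift:
  assumes irr: "\<alpha> \<notin> \<rat>" and g: "continuous_on UNIV g"
  shows "norm (orbit_char \<alpha> g j k z (b + cf_denom \<alpha> n * m) - orbit_char \<alpha> g j k z b)
    \<le> real m * (2 * pi * \<bar>of_int j\<bar> * (1 / cf_denom \<alpha> (Suc n))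
        + 2 * pi * \<bar>of_int k\<bar> * (SUP x. \<bar>birkhoff_sum \<alpha> (cf_denom \<alpha> n) g x\<bar>))"
proof (induction m)
  case (Suc m)
  define D where "D = 2 * pi * \<bar>of_int j\<bar> * (1 / cf_denom \<alpha> (Suc n))
        + 2 * pi * \<bar>of_int k\<bar> * (SUP x. \<bar>birkhoff_sum \<alpha> (cf_denom \<alpha> n) g x\<bar>)"
  define q where "q = cf_denom \<alpha> n"
  define b' where "b' = b + q * m"
  define u where "u = circle_char j (circle_of (real q * \<alpha>))"
  define v where "v = circle_char k (circle_of (birkhoff_sum \<alpha> q g (fst z + circle_of (real b' * \<alpha>))))"
  obtain p :: int where p: "\<bar>real q * \<alpha> - p\<bar> \<le> 1 / cf_denom \<alpha> (Suc n)"
    unfolding q_def by (rule cf_denom_near_int[OF irr])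
  have "norm (u - 1) \<le> 2 * pi * \<bar>of_int j\<bar> * \<bar>real q * \<alpha> - p\<bar>"
    unfolding u_def by (rule norm_circle_char_minus_1_le)
  also have "\<dots> \<le> 2 * pi * \<bar>of_int j\<bar> * (1 / cf_denom \<alpha> (Suc n))"
    by (intro mult_left_mono p) auto
  finally have u: "norm (u - 1) \<le> 2 * pi * \<bar>of_int j\<bar> * (1 / cf_denom \<alpha> (Suc n))" .
  have "norm (v - 1) \<le> 2 * pi * \<bar>of_int k\<bar> * \<bar>birkhoff_sum \<alpha> q g (fst z + circle_of (real b' * \<alpha>))
      - of_int 0\<bar>"
    unfolding v_def by (rule norm_circle_char_minus_1_le)
  also have "\<dots> \<le> 2 * pi * \<bar>of_int k\<bar> * (SUP x. \<bar>birkhoff_sum \<alpha> q g x\<bar>)"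
    using abs_birkhoff_sum_le_Sup[OF g, of \<alpha> q] by (intro mult_left_mono) auto
  finally have v: "norm (v - 1) \<le> 2 * pi * \<bar>of_int k\<bar> * (SUP x. \<bar>birkhoff_sum \<alpha> q g x\<bar>)" .
  have "orbit_char \<alpha> g j k z (b' + q) - orbit_char \<alpha> g j k z b'
      = orbit_char \<alpha> g j k z b' * (u * (v - 1) + (u - 1))"
    unfolding orbit_char_add u_def v_def by (simp add: algebra_simps)
  then have "norm (orbit_char \<alpha> g j k z (b' + q) - orbit_char \<alpha> g j k z b') = norm (u * (v - 1) + (u - 1))"
    by (simp add: norm_mult)
  also have "\<dots> \<le> norm (v - 1) + norm (u - 1)"
    by (rule order_trans[OF norm_triangle_ineq]) (simp add: norm_mult u_def)
  finally have step: "norm (orbit_char \<alpha> g j k z (b' + q) - orbit_char \<alpha> g j k z b')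
    \<le> D"
    unfolding D_def q_def[symmetric]
    using u v by linarith
  have "b + cf_denom \<alpha> n * Suc m = b' + q" by (simp add: b'_def q_def)
  then have "norm (orbit_char \<alpha> g j k z (b + cf_denom \<alpha> n * Suc m) - orbit_char \<alpha> g j k z b)
    \<le> norm (orbit_char \<alpha> g j k z (b' + q) - orbit_char \<alpha> g j k z b')
      + norm (orbit_char \<alpha> g j k z b' - orbit_char \<alpha> g j k z b)"
    using norm_triangle_ineq[of "orbit_char \<alpha> g j k z (b' + q) - orbit_char \<alpha> g j k z b'"
        "orbit_char \<alpha> g j k z b' - orbit_char \<alpha> g j k z b"] by simp
  also note step
  also have "norm (orbit_char \<alpha> g j k z b' - orbit_char \<alpha> g j k z b) \<le> real m * D"
    using Suc by (simp add: b'_def q_def D_def)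
  also have "D + real m * D = real (Suc m) * D" by (simp add: algebra_simps)
  finally show ?case by (simp add: D_def)
qed simp

text \<open>The cost of a single shift in \<open>orbit_char_shift\<close>; at \<open>n\<close> and
  \<open>Suc n\<close> it serves as \<open>d0\<close> and \<open>d1\<close> of
  \<open>block_estimate\<close>.\<close>

definition shift_bound :: "real \<Rightarrow> (circle \<Rightarrow> real) \<Rightarrow> int \<Rightarrow> int \<Rightarrow> nat \<Rightarrow> real"
  where "shift_bound \<alpha> g j k n = 2 * pi * \<bar>of_int j\<bar> * (1 / cf_denom \<alpha> (Suc n))
    + 2 * pi * \<bar>of_int k\<bar> * (SUP x. \<bar>birkhoff_sum \<alpha> (cf_denom \<alpha> n) g x\<bar>)"

lemma shift_bound_nonneg:
  assumes "continuous_on UNIV g" shows "shift_bound \<alpha> g j k n \<ge> 0"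
proof -
  have "(SUP x. \<bar>birkhoff_sum \<alpha> (cf_denom \<alpha> n) g x\<bar>) \<ge> 0"
    by (rule order_trans[OF abs_ge_zero abs_birkhoff_sum_le_Sup[OF assms, of _ _ 0]])
  then show ?thesis unfolding shift_bound_def by (intro add_nonneg_nonneg mult_nonneg_nonneg) auto
qed

text \<open>Of the six copies of Q^(-1/20), one pays for the shifts by the smaller denominator, four
  for the shifts by \<open>Q\<close>, and one for the incomplete last block. The logarithmic term is
  the Weyl error.\<close>

lemma square_average_bound:
  assumes irr: "\<alpha> \<notin> \<rat>" and g: "continuous_on UNIV g"
    and Q: "Q = cf_denom \<alpha> (Suc n)" and P: "P = cf_denom \<alpha> (Suc (Suc n))"
    and \<delta>0: "shift_bound \<alpha> g j k n \<le> real Q powr (- 4 / 5)"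
    and \<delta>1: "shift_bound \<alpha> g j k (Suc n) \<le> real P powr (- 4 / 5)"
    and \<eta>: "\<And>x. norm ((\<Sum>b<Q. circle_char j (circle_of (real b * \<alpha>))
        * circle_char k (circle_of (birkhoff_sum \<alpha> b g x))) / of_nat Q) \<le> \<eta>"
    and N: "real Q powr (4/5) \<le> real N" "real N \<le> real P powr (4/5)"
  shows "norm ((\<Sum>i<N. orbit_char \<alpha> g j k z (i\<^sup>2)) / of_nat N)
    \<le> \<eta> + 6 * real Q powr (- 1/20) + 8 * real Q powr (- 1/8) * (1 + ln (real Q))"
proof -
  define q where "q = cf_denom \<alpha> n"
  have q0: "q > 0" and Q0: "Q > 0" and P0: "P > 0"
    using cf_denom_pos[OF irr] by (auto simp: q_def Q P)
  have QP: "Q \<le> P" using cf_denom_strict_mono[OF irr, of n] by (simp add: Q P)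
  have qQ: "q \<le> Q"
  proof (cases n)
    case 0
    then show ?thesis using Q0 by (simp add: q_def)
  next
    case (Suc m)
    then show ?thesis using cf_denom_strict_mono[OF irr, of m] by (simp add: q_def Q)
  qed
  have Q1: "real Q \<ge> 1" using Q0 by simp
  have N0: "real N > 0" using N(1) Q0 by (smt (verit) powr_gt_zero of_nat_0_less_iff)
  define y where "y = real Q powr (3/4)"
  have y1: "y \<ge> 1" unfolding y_def using Q1 by (intro ge_one_powr_ge_zero) auto
  define H where "H = nat \<lfloor>y\<rfloor>"
  have Hy: "real H \<le> y" "y / 2 \<le> real H" and H0: "H > 0"
  proof -
    have "\<lfloor>y\<rfloor> \<ge> 1" using y1 by linarith
    then have "real H = of_int \<lfloor>y\<rfloor>" "H > 0" by (auto simp: H_def)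
    then show "real H \<le> y" "y / 2 \<le> real H" "H > 0" using y1 by linarith+
  qed
  have "y \<le> real Q powr 1" unfolding y_def using Q1 by (intro powr_mono) auto
  then have HQ: "H \<le> Q" using Hy(1) by simp
  \<comment> \<open>The quantities H Q^(-4/5), H / N and H / Q are all at most \<open>t\<close>,
    whose exponent is 3/4 - 4/5.\<close>
  define t where "t = real Q powr (- 1/20)"
  have t1: "y * real Q powr (- 4/5) = t" "y / real Q powr (4/5) = t"
    unfolding y_def t_def powr_add[symmetric] powr_diff[symmetric] by simp_all
  have "y / real Q powr 1 \<le> t"
    unfolding y_def t_def powr_diff[symmetric] using Q1 by (intro powr_mono) auto
  then have t2: "y / real Q \<le> t" using Q0 by simp
  define dev where "dev = 8 * real Q powr (- 1/8) * (1 + ln (real Q))"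
  define F where "F = orbit_char \<alpha> g j k z"
  define e where "e = \<eta> + 5 * t + dev"
  have "norm (\<Sum>h<H. F ((X + h)\<^sup>2)) \<le> real H * e" if X: "X \<le> N" for X
  proof -
    have "norm (\<Sum>h<H. F ((X + h)\<^sup>2)) \<le> real H * (norm (\<Sum>b<Q. F (X\<^sup>2 + b)) / real Q + real H
        * shift_bound \<alpha> g j k n
        + ((2 * real X * real H + (real H)\<^sup>2) / real Q + real H) * shift_bound \<alpha> g j k (Suc n)
        + sqrt (4 * real Q ^ 2 * (harm Q)\<^sup>2 * (real H + real H)) / (real H * real H))"
    proof (rule block_estimate)
      show "coprime q Q" unfolding q_def Q by (rule coprime_cf_denom)
      show "norm (F (b + q * m) - F b) \<le> real m * shift_bound \<alpha> g j k n" for b m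
        unfolding F_def q_def shift_bound_def by (rule orbit_char_shift[OF irr g])
      show "norm (F (b + Q * m) - F b) \<le> real m * shift_bound \<alpha> g j k (Suc n)" for b m
        unfolding F_def Q shift_bound_def by (rule orbit_char_shift[OF irr g])
    qed (use Q0 qQ H0 HQ shift_bound_nonneg[OF g] in \<open>auto simp: F_def\<close>)
    also have "\<dots> \<le> real H * e"
    proof (rule mult_left_mono)
      have 1: "norm (\<Sum>b<Q. F (X\<^sup>2 + b)) / real Q \<le> \<eta>"
      proof -
        have "(\<Sum>b<Q. F (X\<^sup>2 + b)) = F (X\<^sup>2) * (\<Sum>b<Q. circle_char j (circle_of (real b * \<alpha>)) *
            circle_char k (circle_of (birkhoff_sum \<alpha> b g (fst z + circle_of (real (X\<^sup>2) * \<alpha>)))))"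
          unfolding F_def orbit_char_add by (simp only: sum_distrib_left)
        then show ?thesis
          using \<eta>[of "fst z + circle_of (real (X\<^sup>2) * \<alpha>)"] by
              (simp only: F_def norm_mult norm_divide norm_orbit_char mult_1 norm_of_nat)
      qed
      have 2: "real H * shift_bound \<alpha> g j k n \<le> t"
      proof -
        have "real H * shift_bound \<alpha> g j k n \<le> y * real Q powr (- 4/5)"
          using Hy(1) \<delta>0 y1 shift_bound_nonneg[OF g] by (intro mult_mono) auto
        then show ?thesis unfolding t1 .
      qed
      \<comment> \<open>The 2 N H / Q shifts cost at most \<open>2 * t\<close>, as N P^(-4/5) <= 1
        and H / Q <= t; the other 2 H shifts cost at most \<open>2 * t\<close> because P >=
        Q.\<close>
      have 3: "((2 * real X * real H + (real H)\<^sup>2) / real Q + real H) * shift_bound \<alpha> g j k (Suc n) \<le> 4 * t"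
      proof -
        have "(real H)\<^sup>2 / real Q \<le> real H"
          using HQ Q0 by (simp add: power2_eq_square divide_le_eq mult_left_mono)
        moreover have "2 * real X * real H / real Q \<le> 2 * real N * real H / real Q"
          using X by (intro divide_right_mono mult_right_mono mult_left_mono) auto
        ultimately have "(2 * real X * real H + (real H)\<^sup>2) / real Q + real H \<le> 2 * real N
            * real H / real Q + 2 * real H"
          by (simp add: add_divide_distrib)
        then have "((2 * real X * real H + (real H)\<^sup>2) / real Q + real H) * shift_bound \<alpha> g j k (Suc n)
            \<le> (2 * real N * real H / real Q + 2 * real H) * real P powr (- 4 / 5)"
          using \<delta>1 shift_bound_nonneg[OF g] by (intro mult_mono) auto
        also have "\<dots> = 2 * (real H / real Q) * (real N * real P powr (- 4 / 5)) + 2 * (real H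
            * real P powr (- 4 / 5))"
          by (simp add: algebra_simps)
        also have "\<dots> \<le> 2 * t * 1 + 2 * t"
        proof (intro add_mono mult_mono)
          show "real H / real Q \<le> t"
            using t2 divide_right_mono[OF Hy(1), of "real Q"] by simp
          have "real N * real P powr (- 4 / 5) \<le> real P powr (4 / 5) * real P powr (- 4 / 5)"
            using N(2) by (intro mult_right_mono) auto
          also have "\<dots> = 1" using P0 by (simp add: powr_add[symmetric])
          finally show "real N * real P powr (- 4 / 5) \<le> 1" .
          have "real P powr (- 4 / 5) \<le> real Q powr (- 4/5)"
            using Q0 QP by (intro powr_mono2') auto
          then have "real H * real P powr (- 4 / 5) \<le> y * real Q powr (- 4/5)"
            using Hy(1) y1 by (intro mult_mono) auto
          then show "real H * real P powr (- 4 / 5) \<le> t" unfolding t1 .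
        qed (auto simp: t_def)
        finally show ?thesis by simp
      qed
      have 4: "sqrt (4 * real Q ^ 2 * (harm Q)\<^sup>2 * (real H + real H)) / (real H * real H) \<le> dev"
        unfolding dev_def by (rule deviation_term_le[OF Q0]) (use Hy(2) in \<open>simp add: y_def\<close>)
      show "norm (\<Sum>b<Q. F (X\<^sup>2 + b)) / real Q + real H * shift_bound \<alpha> g j k n
        + ((2 * real X * real H + (real H)\<^sup>2) / real Q + real H) * shift_bound \<alpha> g j k (Suc n)
        + sqrt (4 * real Q ^ 2 * (harm Q)\<^sup>2 * (real H + real H)) / (real H * real H) \<le> e"
        unfolding e_def using 1 2 3 4 by linarith
    qed simp
    finally show ?thesis .
  qed
  then have "norm (\<Sum>i<N. F (i\<^sup>2)) \<le> real N * e + real H"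
    by (intro norm_sum_blocks_le[OF H0]) (auto simp: F_def)
  then have "norm ((\<Sum>i<N. F (i\<^sup>2)) / of_nat N) \<le> (real N * e + real H) / real N"
    unfolding norm_divide norm_of_nat by (rule divide_right_mono) simp
  also have "\<dots> = e + real H / real N" using N0 by (simp add: add_divide_distrib)
  also have "real H / real N \<le> y / real Q powr (4/5)"
    using Hy(1) N(1) Q0 by (intro frac_le) auto
  also have "y / real Q powr (4/5) = t" by (rule t1)
  finally show ?thesis unfolding F_def e_def dev_def t_def by simp
qed

lemma filterlim_cf_denom_Suc:
  assumes "\<alpha> \<notin> \<rat>" shows "filterlim (\<lambda>n. cf_denom \<alpha> (Suc n)) at_top sequentially"
proof (rule filterlim_at_top_mono[OF filterlim_ident])
  show "\<forall>\<^sub>F n in sequentially. n \<le> cf_denom \<alpha> (Suc n)"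
    using cf_denom_ge[OF assms] Suc_leD by (intro always_eventually allI) blast
qed

text \<open>The little-o absorbs the constants depending on \<open>j\<close> and \<open>k\<close>,
  and 1 / Q = Q^(-1/5) * Q^(-4/5) gains a power for the rotation part. With \<open>c\<close> = 1 /
  (2 B) each summand is at most half of the target; the 1 in \<open>B\<close> keeps it
  positive.\<close>

lemma eventually_shift_bound_le:
  assumes irr: "\<alpha> \<notin> \<rat>" and g: "continuous_on UNIV g"
    and small: "(\<lambda>n. SUP x. \<bar>birkhoff_sum \<alpha> (cf_denom \<alpha> n) g x\<bar>)
        \<in> o(\<lambda>n. real (cf_denom \<alpha> (Suc n)) powr (- 4 / 5))"
  shows "\<forall>\<^sub>F n in sequentially. shift_bound \<alpha> g j k n \<le> real (cf_denom \<alpha> (Suc n)) powr (- 4 / 5)"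
proof -
  define B where "B = 2 * pi * \<bar>of_int j\<bar> + 2 * pi * \<bar>of_int k\<bar> + (1::real)"
  have "B \<ge> 1" by (simp add: B_def)
  define c where "c = 1 / (2 * B)"
  have "c > 0" using \<open>B \<ge> 1\<close> by (simp add: c_def)
  have jB: "2 * pi * \<bar>of_int j\<bar> \<le> B" and kB: "2 * pi * \<bar>of_int k\<bar> \<le> B" by (simp_all add: B_def)
  have "(\<lambda>L::nat. real L powr (- 1/5)) \<longlonglongrightarrow> 0" by real_asymp
  then have "\<forall>\<^sub>F L in sequentially. real L powr (- 1/5) < c"
    by (rule order_tendstoD(2)) fact
  then have "\<forall>\<^sub>F n in sequentially. real (cf_denom \<alpha> (Suc n)) powr (- 1/5) < c"
    using filterlim_cf_denom_Suc[OF irr] unfolding filterlim_iff by blast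
  moreover have "\<forall>\<^sub>F n in sequentially. norm (SUP x. \<bar>birkhoff_sum \<alpha> (cf_denom \<alpha> n) g x\<bar>)
      \<le> c * norm (real (cf_denom \<alpha> (Suc n)) powr (- 4 / 5))"
    by (rule landau_o.smallD[OF small \<open>c > 0\<close>])
  ultimately show ?thesis
  proof eventually_elim
    case (elim n)
    define Q where "Q = real (cf_denom \<alpha> (Suc n))"
    define w where "w = Q powr (- 4 / 5)"
    have Q0: "Q > 0" using cf_denom_pos[OF irr, of n] by (simp add: Q_def)
    have w0: "w \<ge> 0" by (simp add: w_def)
    have "1 / Q = Q powr (- 1/5) * w"
      unfolding w_def powr_add[symmetric] using powr_neg_one[OF Q0] by simp
    also have "\<dots> \<le> c * w"
      using elim(1) w0 by (intro mult_right_mono) (auto simp: Q_def)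
    finally have 1: "1 / Q \<le> c * w" .
    have 2: "(SUP x. \<bar>birkhoff_sum \<alpha> (cf_denom \<alpha> n) g x\<bar>) \<le> c * w"
      using elim(2) by (simp add: w_def Q_def)
    have "shift_bound \<alpha> g j k n \<le> 2 * pi * \<bar>of_int j\<bar> * (c * w) + 2 * pi * \<bar>of_int k\<bar> * (c * w)"
      unfolding shift_bound_def Q_def[symmetric] by (intro add_mono mult_left_mono 1 2) auto
    also have "\<dots> \<le> B * (c * w) + B * (c * w)"
      using \<open>c > 0\<close> w0 by (intro add_mono mult_right_mono jB kB) auto
    also have "\<dots> = w" using \<open>B \<ge> 1\<close> by (simp add: c_def)
    finally show ?case unfolding w_def Q_def .
  qed
qed

text \<open>The 4/5 powers of consecutive denominators tend to infinity, so every large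
  \<open>N\<close> lies between two of them and \<open>square_average_bound\<close> applies to that
  pair.\<close>

lemma orbit_char_square_average:
  fixes \<alpha> :: real and g :: "circle \<Rightarrow> real" and j k :: int
  assumes irr: "\<alpha> \<notin> \<rat>" and g: "continuous_on UNIV g"
    and small: "(\<lambda>n. SUP x. \<bar>birkhoff_sum \<alpha> (cf_denom \<alpha> n) g x\<bar>)
        \<in> o(\<lambda>n. real (cf_denom \<alpha> (Suc n)) powr (- 4 / 5))"
    and not_cohomologous: "\<And>r \<beta> :: real. r \<noteq> 0 \<Longrightarrow>
        \<not> (\<exists>\<psi> :: circle \<Rightarrow> real. \<psi> \<in> borel_measurable circle_lebesgue \<and>
            (AE x in circle_lebesgue.
               r * g x - (\<psi> (x + circle_of \<alpha>) - \<psi> x + \<beta>) \<in> \<int>))"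
    and jk: "j \<noteq> 0 \<or> k \<noteq> 0"
  shows "(\<lambda>N. (\<Sum>n<N. orbit_char \<alpha> g j k z (n\<^sup>2)) / of_nat N) \<longlonglongrightarrow> 0"
proof (rule LIMSEQ_I)
  fix e :: real assume "e > 0"
  define q where "q n = cf_denom \<alpha> n" for n
  define a where "a L x = (\<Sum>b<L. circle_char j (circle_of (real b * \<alpha>))
      * circle_char k (circle_of (birkhoff_sum \<alpha> b g x))) / of_nat L"
    for L x
  define r where "r L = 6 * real L powr (- 1/20) + 8 * real L powr (- 1/8) * (1 + ln (real L))" for L :: nat
  have q_lim: "filterlim (\<lambda>n. q (Suc n)) at_top sequentially"
    unfolding q_def by (rule filterlim_cf_denom_Suc[OF irr])
  have "uniform_limit UNIV a (\<lambda>_. 0) sequentially"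
    unfolding a_def[abs_def] by (rule character_average_uniform_limit[OF irr g not_cohomologous jk])
  from uniform_limitD[OF this, of "e / 2"]
  have "\<forall>\<^sub>F L in sequentially. \<forall>x. norm (a L x) < e / 2"
    using \<open>e > 0\<close> by simp
  then have ev1: "\<forall>\<^sub>F n in sequentially. \<forall>x. norm (a (q (Suc n)) x) < e / 2"
    using q_lim unfolding filterlim_iff by blast
  have "r \<longlonglongrightarrow> 0" unfolding r_def[abs_def] by real_asymp
  then have "\<forall>\<^sub>F L in sequentially. r L < e / 2"
    by (rule order_tendstoD(2)) (use \<open>e > 0\<close> in simp)
  then have ev2: "\<forall>\<^sub>F n in sequentially. r (q (Suc n)) < e / 2"
    using q_lim unfolding filterlim_iff by blast
  have ev3: "\<forall>\<^sub>F n in sequentially. shift_bound \<alpha> g j k n \<le> real (q (Suc n)) powr (- 4 / 5)"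
    unfolding q_def by (rule eventually_shift_bound_le[OF irr g small])
  have "\<forall>\<^sub>F n in sequentially. (\<forall>x. norm (a (q (Suc n)) x) < e / 2) \<and> r (q (Suc n)) < e / 2
      \<and> shift_bound \<alpha> g j k n \<le> real (q (Suc n)) powr (- 4 / 5)"
    using ev1 ev2 ev3 by eventually_elim simp
  then obtain n0 where n0: "\<And>n. n \<ge> n0 \<Longrightarrow> (\<forall>x. norm (a (q (Suc n)) x) < e / 2) \<and> r (q (Suc n)) < e / 2
      \<and> shift_bound \<alpha> g j k n \<le> real (q (Suc n)) powr (- 4 / 5)"
    by (auto simp: eventually_sequentially)
  have mono: "q (Suc m) \<le> q (Suc n)" if "m \<le> n" for m n
    using lift_Suc_mono_le[of "\<lambda>n. q (Suc n)" m n] cf_denom_strict_mono[OF irr] that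
    by (simp add: q_def less_imp_le del: cf_denom.simps)
  have "norm ((\<Sum>n<N. orbit_char \<alpha> g j k z (n\<^sup>2)) / of_nat N - 0) < e"
      if N: "N \<ge> nat \<lceil>real (q (Suc n0)) powr (4/5)\<rceil>" for N
  proof -
    have N1: "real (q (Suc n0)) powr (4/5) \<le> real N" using N by linarith
    \<comment> \<open>\<open>q (Suc m)\<close> is the first of these denominators whose 4/5 power
      exceeds \<open>N\<close>. Since \<open>n0 < m\<close>, it has a predecessor that is covered by
      \<open>n0\<close>, and minimality places \<open>N\<close> above the power of that
      predecessor.\<close>
    define m where "m = (LEAST m. real N < real (q (Suc m)) powr (4/5))"
    have exm: "\<exists>m. real N < real (q (Suc m)) powr (4/5)"
    proof -
      have "filterlim (\<lambda>L::nat. real L powr (4/5)) at_top sequentially" by real_asymp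
      then have "filterlim (\<lambda>m. real (q (Suc m)) powr (4/5)) at_top sequentially"
        by (rule filterlim_compose[OF _ q_lim])
      then have "\<forall>\<^sub>F m in sequentially. real N < real (q (Suc m)) powr (4/5)"
        by (simp add: filterlim_at_top_dense)
      then show ?thesis by (rule eventually_happens'[OF sequentially_bot])
    qed
    have m1: "real N < real (q (Suc m)) powr (4/5)" unfolding m_def by (rule LeastI_ex[OF exm])
    have "n0 < m"
    proof (rule ccontr)
      assume "\<not> n0 < m"
      then have "real (q (Suc m)) powr (4/5) \<le> real (q (Suc n0)) powr (4/5)"
        using mono[of m n0] by (intro powr_mono2) auto
      then show False using m1 N1 by simp
    qed
    then obtain n where n: "m = Suc n" "n \<ge> n0" by (cases m) auto
    have m2: "real (q (Suc n)) powr (4/5) \<le> real N"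
      using not_less_Least[of n "\<lambda>m. real N < real (q (Suc m)) powr (4/5)"] n(1) by (simp add: m_def)
    have "norm ((\<Sum>i<N. orbit_char \<alpha> g j k z (i\<^sup>2)) / of_nat N)
        \<le> e / 2 + 6 * real (q (Suc n)) powr (- 1/20) + 8 * real (q (Suc n)) powr (- 1/8) * (1
            + ln (real (q (Suc n))))"
    proof (rule square_average_bound[OF irr g])
      show "q (Suc n) = cf_denom \<alpha> (Suc n)" by (simp only: q_def)
      show "q (Suc (Suc n)) = cf_denom \<alpha> (Suc (Suc n))" by (simp only: q_def)
      show "shift_bound \<alpha> g j k n \<le> real (q (Suc n)) powr (- 4 / 5)" using n0[OF n(2)] by blast
      show "shift_bound \<alpha> g j k (Suc n) \<le> real (q (Suc (Suc n))) powr (- 4 / 5)"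
          using n0[of "Suc n"] n(2) by auto
      show "norm ((\<Sum>b<q (Suc n). circle_char j (circle_of (real b * \<alpha>))
          * circle_char k (circle_of (birkhoff_sum \<alpha> b g x))) / of_nat (q (Suc n))) \<le> e / 2" for x
        using n0[OF n(2)] unfolding a_def by (blast intro: less_imp_le)
      show "real (q (Suc n)) powr (4/5) \<le> real N" by (rule m2)
      show "real N \<le> real (q (Suc (Suc n))) powr (4/5)" using m1 n(1) by simp
    qed
    also have "\<dots> = e / 2 + r (q (Suc n))" by (simp add: r_def)
    also have "\<dots> < e" using n0[OF n(2)] by auto
    finally show ?thesis by simp
  qed
  then show "\<exists>no. \<forall>N\<ge>no. norm ((\<Sum>n<N. orbit_char \<alpha> g j k z (n\<^sup>2)) / of_nat N - 0) < e" by blast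
qed

section \<open>Return to the torus: orbits, product measure, approximation\<close>

lemma skew_product_funpow:
  "(skew_product \<alpha> g ^^ n) z = (fst z + circle_of (real n * \<alpha>), snd z
      + circle_of (birkhoff_sum \<alpha> n g (fst z)))"
proof (induction n)
  case (Suc n)
  then show ?case
    by (simp add: skew_product_def birkhoff_sum_def circle_of_add[symmetric] add.assoc distrib_right add.commute)
qed (simp add: birkhoff_sum_def circle_of_0)

abbreviation (input) torus_lebesgue :: "(circle \<times> circle) measure"
  where "torus_lebesgue \<equiv> circle_lebesgue \<Otimes>\<^sub>M circle_lebesgue"

interpretation torus: pair_sigma_finite circle_lebesgue circle_lebesgue
  by (intro pair_sigma_finite.intro) (rule circle_lebesgue.sigma_finite_measure_axioms)+

interpretation torus: finite_measure torus_lebesgue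
  by (intro finite_measure_pair_measure circle_lebesgue.finite_measure_axioms)

lemma measure_torus_UNIV: "measure torus_lebesgue (space torus_lebesgue) = 1"
proof -
  have "emeasure torus_lebesgue (UNIV \<times> UNIV) = 1 * 1"
    using emeasure_space_circle_lebesgue
    by (subst circle_lebesgue.emeasure_pair_measure_Times) auto
  then show ?thesis by (simp add: measure_def space_pair_measure)
qed

lemma trig_poly_measurable: "p \<in> trig_poly \<Longrightarrow> p \<in> borel_measurable torus_lebesgue"
proof (induction rule: trig_poly.induct)
  case (add p q)
  then show ?case by (intro borel_measurable_add)
qed measurable

text \<open>Measurability is with respect to the product sigma-algebra, not the Borel sets of the
  torus. It follows from uniform approximation by trigonometric polynomials, which are product
  measurable term by term.\<close>

lemma torus_continuous_integrable:
  fixes f :: "circle \<times> circle \<Rightarrow> real"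
  assumes "continuous_on UNIV f"
  shows "integrable torus_lebesgue f"
proof -
  have "\<exists>p. p \<in> trig_poly \<and> (\<forall>z. \<bar>f z - p z\<bar> < 1 / real (Suc n))" for n
    using trig_poly_dense[OF assms, of "1 / real (Suc n)"]
        by (metis of_nat_0_less_iff zero_less_Suc zero_less_divide_1_iff)
  then obtain p where p: "\<And>n. p n \<in> trig_poly" "\<And>n z. \<bar>f z - p n z\<bar> < 1 / real (Suc n)"
    by metis
  have "f \<in> borel_measurable torus_lebesgue"
  proof (rule borel_measurable_LIMSEQ_real)
    show "p n \<in> borel_measurable torus_lebesgue" for n by (rule trig_poly_measurable[OF p(1)])
    fix z
    have "(\<lambda>n. p n z - f z) \<longlonglongrightarrow> 0"
    proof (rule Lim_null_comparison)
      show "\<forall>\<^sub>F n in sequentially. norm (p n z - f z) \<le> 1 / real (Suc n)"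
        using p(2)[of z] by (intro always_eventually allI) (simp add: abs_minus_commute less_imp_le)
      show "(\<lambda>n. 1 / real (Suc n)) \<longlonglongrightarrow> 0" by real_asymp
    qed
    then show "(\<lambda>n. p n z) \<longlonglongrightarrow> f z" by (rule LIM_zero_cancel)
  qed
  moreover have "bounded (range f)"
    using compact_Times[OF compact_circle compact_circle] assms
    by (intro compact_imp_bounded compact_continuous_image) auto
  then obtain B where "\<And>z. norm (f z) \<le> B"
    unfolding bounded_iff by blast
  ultimately show ?thesis by (intro torus.integrable_const_bound[of _ B]) auto
qed

lemma integral_torus_char:
  "(LINT z|torus_lebesgue. circle_char j (fst z) * circle_char k (snd z)) = (if j = 0 \<and> k = 0 then 1 else 0)"
proof -
  have "integrable torus_lebesgue (\<lambda>z. circle_char j (fst z) * circle_char k (snd z))"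
    by (rule torus.integrable_const_bound[of _ 1]) (auto simp: norm_mult)
  then have "(LINT z|torus_lebesgue. circle_char j (fst z) * circle_char k (snd z))
      = (LINT x|circle_lebesgue. LINT y|circle_lebesgue. circle_char j x * circle_char k y)"
    using torus.integral_fst'[of "\<lambda>z. circle_char j (fst z) * circle_char k (snd z)"] by simp
  then show ?thesis by (simp add: integral_circle_char)
qed

theorem theorem8:
  fixes \<alpha> :: real and g :: "circle \<Rightarrow> real"
  assumes irrational: "\<alpha> \<notin> \<rat>"
    and continuous: "continuous_on UNIV g"
    and small: "(\<lambda>n. SUP x. \<bar>birkhoff_sum \<alpha> (cf_denom \<alpha> n) g x\<bar>)
        \<in> o(\<lambda>n. real (cf_denom \<alpha> (Suc n)) powr (- 4 / 5))"
    and not_cohomologous: "\<And>r \<beta> :: real. r \<noteq> 0 \<Longrightarrow>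
        \<not> (\<exists>\<psi> :: circle \<Rightarrow> real. \<psi> \<in> borel_measurable circle_lebesgue \<and>
            (AE x in circle_lebesgue.
               r * g x - (\<psi> (x + circle_of \<alpha>) - \<psi> x + \<beta>) \<in> \<int>))"
  shows "\<forall>z :: circle \<times> circle. \<forall>f :: circle \<times> circle \<Rightarrow> complex. continuous_on UNIV f \<longrightarrow>
      (\<lambda>N. (\<Sum>n<N. f ((skew_product \<alpha> g ^^ (n\<^sup>2)) z)) / of_nat N)
        \<longlonglongrightarrow> (LINT w|(circle_lebesgue \<Otimes>\<^sub>M circle_lebesgue). f w)"
proof (intro allI impI)
  fix z :: "circle \<times> circle" and f :: "circle \<times> circle \<Rightarrow> complex"
  assume f: "continuous_on UNIV f"
  define w where "w n = (skew_product \<alpha> g ^^ (n\<^sup>2)) z" for n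
  have char: "circle_char j (fst (w n)) * circle_char k (snd (w n)) = orbit_char \<alpha> g j k z (n\<^sup>2)" for j k n
    by (simp add: w_def skew_product_funpow orbit_char_def)
  have trig: "(\<lambda>N. (\<Sum>n<N. p (w n)) / real N) \<longlonglongrightarrow> (LINT w|torus_lebesgue. p w)" if "p \<in> trig_poly" for p
    using that
  proof induction
    case (monom c j k)
    have "(\<lambda>N. (\<Sum>n<N. circle_char j (fst (w n)) * circle_char k (snd (w n))) / of_nat N)
        \<longlonglongrightarrow> (LINT z|torus_lebesgue. circle_char j (fst z) * circle_char k (snd z))"
    proof (cases "j = 0 \<and> k = 0")
      case True
      \<comment> \<open>At N = 0 the quotient is 0 by convention, so the sequence is only eventually
        1.\<close>
      have "(\<lambda>N. (of_nat N / of_nat N :: complex)) \<longlonglongrightarrow> 1"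
        by (rule tendsto_eventually) (use eventually_gt_at_top[of 0] in eventually_elim, simp)
      then show ?thesis unfolding integral_torus_char using True by simp
    next
      case False
      then show ?thesis unfolding integral_torus_char char
        using orbit_char_square_average[OF irrational continuous small not_cohomologous, of j k z] by auto
    qed
    then have "(\<lambda>N. Re (c * ((\<Sum>n<N. circle_char j (fst (w n)) * circle_char k (snd (w n))) / of_nat N)))
        \<longlonglongrightarrow> Re (c * (LINT z|torus_lebesgue. circle_char j (fst z) * circle_char k (snd z)))"
      by (intro tendsto_intros)
    moreover have "Re (c * (LINT z|torus_lebesgue. circle_char j (fst z) * circle_char k (snd z)))
        = (LINT z|torus_lebesgue. Re (c * circle_char j (fst z) * circle_char k (snd z)))"
    proof -
      have "integrable torus_lebesgue (\<lambda>z. c * (circle_char j (fst z) * circle_char k (snd z)))"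
        by (rule torus.integrable_const_bound[of _ "norm c"]) (auto simp: norm_mult)
      then have "Re (LINT z|torus_lebesgue. c * (circle_char j (fst z) * circle_char k (snd z)))
          = (LINT z|torus_lebesgue. Re (c * (circle_char j (fst z) * circle_char k (snd z))))"
        by (rule integral_Re[symmetric])
      then show ?thesis by (simp only: integral_mult_right_zero mult.assoc)
    qed
    moreover have "Re (c * ((\<Sum>n<N. circle_char j (fst (w n)) * circle_char k (snd (w n))) / of_nat N))
        = (\<Sum>n<N. Re (c * circle_char j (fst (w n)) * circle_char k (snd (w n)))) / real N" for N
    proof -
      have "c * ((\<Sum>n<N. circle_char j (fst (w n)) * circle_char k (snd (w n))) / of_nat N)
          = (\<Sum>n<N. c * circle_char j (fst (w n)) * circle_char k (snd (w n))) / of_real (real N)"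
        by (simp add: sum_distrib_left mult.assoc)
      then show ?thesis by (simp only: Re_divide_of_real Re_sum)
    qed
    ultimately show ?case by (simp only:)
  next
    case (add p q)
    have "integrable torus_lebesgue p" "integrable torus_lebesgue q"
      by (intro torus_continuous_integrable continuous_on_trig_poly add.hyps)+
    then show ?case
      using tendsto_add[OF add.IH] by (simp add: sum.distrib add_divide_distrib)
  qed
  have real: "(\<lambda>N. (\<Sum>n<N. h (w n)) / real N) \<longlonglongrightarrow> (LINT w|torus_lebesgue. h w)"
    if h: "continuous_on UNIV h" for h :: "circle \<times> circle \<Rightarrow> real"
  proof (rule LIMSEQ_I)
    fix e :: real assume "e > 0"
    then obtain p where p: "p \<in> trig_poly" "\<And>z. \<bar>h z - p z\<bar> < e / 3"
      using trig_poly_dense[OF h, of "e / 3"] by auto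
    have ih: "integrable torus_lebesgue h" and ip: "integrable torus_lebesgue p"
      by (intro torus_continuous_integrable h continuous_on_trig_poly p)+
    have "\<bar>(LINT w|torus_lebesgue. h w) - (LINT w|torus_lebesgue. p w)\<bar> = \<bar>LINT w|torus_lebesgue. h w - p w\<bar>"
      using ih ip by simp
    also have "\<dots> \<le> (LINT w|torus_lebesgue. \<bar>h w - p w\<bar>)" by (rule integral_abs_bound)
    also have "\<dots> \<le> (LINT w|torus_lebesgue. e / 3)"
      by (rule integral_mono) (use ih ip less_imp_le[OF p(2)] in auto)
    also have "\<dots> = e / 3" using measure_torus_UNIV by simp
    finally have I: "\<bar>(LINT w|torus_lebesgue. h w) - (LINT w|torus_lebesgue. p w)\<bar> \<le> e / 3" .
    have A: "\<bar>(\<Sum>n<N. h (w n)) / real N - (\<Sum>n<N. p (w n)) / real N\<bar> \<le> e / 3" for N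
    proof -
      have "\<bar>(\<Sum>n<N. h (w n)) - (\<Sum>n<N. p (w n))\<bar> \<le> real N * (e / 3)"
        unfolding sum_subtractf[symmetric]
        using sum_norm_le[of "{..<N}" "\<lambda>n. h (w n) - p (w n)" "\<lambda>_. e / 3"] less_imp_le[OF p(2)] by simp
      then show ?thesis using \<open>e > 0\<close> by (cases "N = 0")
          (simp_all add: diff_divide_distrib[symmetric] field_simps)
    qed
    obtain no where no: "\<And>N. N \<ge> no \<Longrightarrow> \<bar>(\<Sum>n<N. p (w n)) / real N - (LINT w|torus_lebesgue. p w)\<bar> < e / 3"
      using LIMSEQ_D[OF trig[OF p(1)], of "e / 3"] \<open>e > 0\<close> by auto
    have "norm ((\<Sum>n<N. h (w n)) / real N - (LINT w|torus_lebesgue. h w)) < e" if "N \<ge> no" for N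
      using no[OF that] A[of N] I unfolding real_norm_def by linarith
    then show "\<exists>no. \<forall>N\<ge>no. norm ((\<Sum>n<N. h (w n)) / real N - (LINT w|torus_lebesgue. h w)) < e" by blast
  qed
  \<comment> \<open>The approximation is for real functions, so the complex \<open>f\<close> is
    split; its integrability lets the integral commute with real and imaginary parts.\<close>
  have cRe: "continuous_on UNIV (\<lambda>z. Re (f z))" and cIm: "continuous_on UNIV (\<lambda>z. Im (f z))"
    by (intro continuous_intros f)+
  have fint: "integrable torus_lebesgue f"
  proof -
    have "integrable torus_lebesgue (\<lambda>z. complex_of_real (Re (f z)) + \<i> * complex_of_real (Im (f z)))"
      by (intro Bochner_Integration.integrable_add integrable_mult_right integrable_of_real
          torus_continuous_integrable cRe cIm)
    then show ?thesis by (simp only: complex_eq[symmetric])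
  qed
  show "(\<lambda>N. (\<Sum>n<N. f ((skew_product \<alpha> g ^^ (n\<^sup>2)) z)) / of_nat N) \<longlonglongrightarrow> (LINT w|torus_lebesgue. f w)"
    unfolding w_def[symmetric] tendsto_complex_iff
    using real[OF cRe] real[OF cIm] integral_Re[OF fint] integral_Im[OF fint]
    by (simp add: Re_divide_of_nat Im_divide_of_nat)
qed

end
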